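(* Let $\mu\in\mathscr K(X)$ be a $G$-Kato measure whose fine support $F$ satisfies $F=X$. Then: (1) The resolvent $(\check R_\alpha)_{\alpha>0}$ has the Feller property on $C_0(X)$. (2) The semigroup $(\check{\bf P}_t)_{t\ge0}$ has the Feller property on $C_0(X)$.
   Context: $X$ is a locally compact separable metric space, $m$ a positive Radon measure on the Borel sets of $X$ with full support, $X_\partial=X\cup\{\partial\}$ the one-point compactification; every function $u$ on $X$ is extended by $u(\partial)=0$. $\mathscr B_b(X)$ denotes the bounded Borel functions on $X$ with the sup norm $\|\cdot\|_\infty$, and $C_0(X)$ the continuous functions vanishing at infinity. $\mathbb X=(\Omega,\mathscr M,\mathscr M_t,(\mathbb P_x)_{x\in X_\partial},(\mathbb X_t)_{0\le t\le\infty},(\theta_t),\zeta)$ is a standard process in the sense of Blumenthal–Getoor (not necessarily symmetric) with state space $X$ and cemetery $\partial$ (with $\mathbb X_\infty=\partial$). It is transient and has a dual standard process $\hat{\mathbb X}$ (duality with respect to $m$) with the same properties. Its transition semigroup ${\bf P}_tu(x)=\mathbb E_x[u(\mathbb X_t)]$ has a jointly measurable density $p_t(x,y)$ with respect to $m$, with $p_t(x,y)>0$ for all $t>0$, $x,y\in X$. For $\alpha\ge0$, $G_\alpha(x,y)=\int_0^\infty e^{-\alpha t}p_t(x,y)\,dt$, $G:=G_0\not\equiv\infty$, and $G:X\times X\to(0,\infty]$ is lower semicontinuous. A positive Radon measure $\mu$ on $X$ is $G$-Kato if $G^\mu1:=\int_XG(\cdot,y)\,d\mu(y)\in C_0(X)$;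 $\mathscr K(X)$ is the set of $G$-Kato measures. Each $\mu\in\mathscr K(X)$ has a unique (up to equivalence) positive continuous additive functional (PCAF) ${\bf A}$ of $\mathbb X$ with Revuz measure $\mu$; it satisfies $\mathbb E_x[\int_0^\infty e^{-\alpha t}u(\mathbb X_t)\,d{\bf A}_t]=\int_XG_\alpha(x,y)u(y)\,d\mu(y)$ for $u\in\mathscr B_b(X)$, $\alpha\ge0$, $x\in X$. Put $\tau_t=\inf\{s\ge0:{\bf A}_s>t\}$ and, for $u\in\mathscr B_b(X)$, $x\in X$, $\check{\bf P}_tu(x)=\mathbb E_x[u(\mathbb X_{\tau_t})]$ and $\check R_\alpha u(x)=\mathbb E_x[\int_0^\infty e^{-\alpha t}u(\mathbb X_{\tau_t})\,dt]$. The fine support $F$ of $\mu$ is the smallest nearly Borel finely closed set $B\subset X$ with $\mu(B^c)=0$; it equals $\{x\in X:\mathbb P_x(\tau_0=0)=1\}$. Feller property on $C_0(X)$: the semigroup (resp. resolvent) is sub-Markovian, maps $C_0(X)$ into itself, and $\|\check{\bf P}_tu-u\|_\infty\to0$ as $t\to0$ (resp. $\|\alpha\check R_\alpha u-u\|_\infty\to0$ as $\alpha\to\infty$) for all $u\in C_0(X)$. *)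

theory Defs
  imports "HOL-Probability.Probability"
begin

section \<open>State space with cemetery\<close>

text \<open>The one-point compactification of \<open>X\<close> lives on \<^typ>\<open>'a option\<close>, with \<^const>\<open>None\<close> as the
  cemetery. If \<open>X\<close> is already compact, \<^const>\<open>None\<close> is an isolated point.\<close>

abbreviation cem_top :: "'a::topological_space option topology" where
  "cem_top \<equiv> Alexandroff_compactification euclidean"

definition cem_borel :: "'a::topological_space option measure" where
  "cem_borel = sigma UNIV {U. openin cem_top U}"

definition ext0 :: "('a \<Rightarrow> 'b::zero) \<Rightarrow> 'a option \<Rightarrow> 'b" where
  "ext0 u = case_option 0 u"

definition bounded_borel :: "('a::topological_space \<Rightarrow> real) set" where
  "bounded_borel = {u. u \<in> borel_measurable borel \<and> bounded (range u)}"

definition C0 :: "('a::topological_space \<Rightarrow> real) set" where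
  "C0 = {u. continuous_on UNIV u \<and> (\<forall>\<epsilon>>0. \<exists>K. compact K \<and> (\<forall>x. x \<notin> K \<longrightarrow> \<bar>u x\<bar> < \<epsilon>))}"

definition supnorm :: "('a \<Rightarrow> real) \<Rightarrow> real" where
  "supnorm u = (SUP x. \<bar>u x\<bar>)"

definition radon_measure :: "'a::topological_space measure \<Rightarrow> bool" where
  "radon_measure \<mu> \<longleftrightarrow> sets \<mu> = sets borel \<and>
     (\<forall>K. compact K \<longrightarrow> emeasure \<mu> K < \<infinity>) \<and>
     (\<forall>B\<in>sets borel. emeasure \<mu> B = (SUP K\<in>{K. compact K \<and> K \<subseteq> B}. emeasure \<mu> K))"

definition full_support :: "'a::topological_space measure \<Rightarrow> bool" where
  "full_support \<mu> \<longleftrightarrow> (\<forall>U. open U \<and> U \<noteq> {} \<longrightarrow> emeasure \<mu> U > 0)"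

section \<open>Standard processes\<close>

text \<open>Times range over \<open>[0,\<infinity>]\<close>, i.e. over \<^typ>\<open>ennreal\<close>. The fields are the measurable space
  \<open>(\<Omega>, M)\<close>, the filtration, the coordinates, the shifts and the measures \<open>P_x\<close> (\<open>x\<close> may be the
  cemetery). Only the \<open>\<sigma>\<close>-algebras of \<open>events\<close> and \<open>filt\<close> matter.\<close>

record ('w, 'a) process =
  events :: "'w measure"
  filt :: "ennreal \<Rightarrow> 'w measure"
  coord :: "ennreal \<Rightarrow> 'w \<Rightarrow> 'a option"
  shift :: "ennreal \<Rightarrow> 'w \<Rightarrow> 'w"
  law :: "'a option \<Rightarrow> 'w measure"

abbreviation paths :: "('w, 'a) process \<Rightarrow> 'w set" where
  "paths Z \<equiv> space (events Z)"

definition lifetime :: "('w, 'a) process \<Rightarrow> 'w \<Rightarrow> ennreal" where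
  "lifetime Z \<omega> = Inf {t. coord Z t \<omega> = None}"

text \<open>The uncompleted natural filtration.\<close>

definition nat_filt :: "('w, 'a::topological_space) process \<Rightarrow> ennreal \<Rightarrow> 'w measure" where
  "nat_filt Z t = sigma (paths Z)
     {coord Z s -` B \<inter> paths Z | s B. s \<le> t \<and> B \<in> sets cem_borel}"

definition initial_law :: "'a::topological_space option measure \<Rightarrow> bool" where
  "initial_law \<nu> \<longleftrightarrow> sets \<nu> = sets cem_borel \<and> finite_measure \<nu>"

text \<open>\<open>P_\<nu>(\<Lambda>) = \<integral> P_x(\<Lambda>) \<nu>(dx)\<close> on the \<open>\<sigma>\<close>-algebra generated by the coordinates.\<close>

definition law_from ::
    "('w, 'a::topological_space) process \<Rightarrow> 'a option measure \<Rightarrow> 'w measure" where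
  "law_from Z \<nu> = measure_of (paths Z) (sets (nat_filt Z \<infinity>))
     (\<lambda>\<Lambda>. \<integral>\<^sup>+ x. emeasure (law Z x) \<Lambda> \<partial>\<nu>)"

text \<open>The augmented natural filtration: the intersection over all initial laws \<open>\<nu>\<close> of the
  augmentations of \<^const>\<open>nat_filt\<close> by the \<open>P_\<nu>\<close>-null sets.\<close>

definition aug_filt :: "('w, 'a::topological_space) process \<Rightarrow> ennreal \<Rightarrow> 'w measure" where
  "aug_filt Z t = sigma (paths Z)
     {\<Lambda>. \<forall>\<nu>. initial_law \<nu> \<longrightarrow>
        (\<exists>\<Lambda>'\<in>sets (nat_filt Z t).
           (\<Lambda> - \<Lambda>') \<union> (\<Lambda>' - \<Lambda>) \<in> null_sets (completion (law_from Z \<nu>)))}"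

definition markov_process :: "('w, 'a::topological_space) process \<Rightarrow> bool" where
  "markov_process Z \<longleftrightarrow>
     filtration (paths Z) (filt Z) \<and>
     (\<forall>t. sets (filt Z t) \<subseteq> sets (events Z)) \<and>
     (\<forall>x. prob_space (law Z x) \<and> sets (law Z x) = sets (events Z)) \<and>
     (\<forall>t. coord Z t \<in> measurable (filt Z t) cem_borel) \<and>
     (\<forall>\<omega>\<in>paths Z. coord Z \<infinity> \<omega> = None) \<and>
     (\<forall>\<omega>\<in>paths Z. \<forall>s t. s \<le> t \<and> coord Z s \<omega> = None \<longrightarrow> coord Z t \<omega> = None) \<and>
     (\<forall>t. \<forall>\<omega>\<in>paths Z. shift Z t \<omega> \<in> paths Z) \<and>
     (\<exists>\<omega>0\<in>paths Z. \<forall>\<omega>\<in>paths Z. shift Z \<infinity> \<omega> = \<omega>0) \<and>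
     (\<forall>s t. \<forall>\<omega>\<in>paths Z. coord Z s (shift Z t \<omega>) = coord Z (t + s) \<omega>) \<and>
     (\<forall>t. \<forall>B\<in>sets cem_borel.
        (\<lambda>x. emeasure (law Z x) {\<omega>\<in>paths Z. coord Z t \<omega> \<in> B}) \<in> borel_measurable cem_borel) \<and>
     (\<forall>x s t. \<forall>B\<in>sets cem_borel. \<forall>\<Lambda>\<in>sets (filt Z t).
        emeasure (law Z x) {\<omega>\<in>\<Lambda>. coord Z (t + s) \<omega> \<in> B} =
        (\<integral>\<^sup>+ \<omega>\<in>\<Lambda>. emeasure (law Z (coord Z t \<omega>)) {\<omega>'\<in>paths Z. coord Z s \<omega>' \<in> B} \<partial>law Z x))"

definition strong_markov :: "('w, 'a::topological_space) process \<Rightarrow> bool" where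
  "strong_markov Z \<longleftrightarrow>
     (\<forall>T. stopping_time (filt Z) T \<longrightarrow>
        (\<lambda>\<omega>. coord Z (T \<omega>) \<omega>)
          \<in> measurable (filtration.pre_sigma (paths Z) (filt Z) T) cem_borel \<and>
        (\<forall>x s. \<forall>B\<in>sets cem_borel. \<forall>\<Lambda>\<in>sets (filtration.pre_sigma (paths Z) (filt Z) T).
           emeasure (law Z x) {\<omega>\<in>\<Lambda>. coord Z (T \<omega> + s) \<omega> \<in> B} =
           (\<integral>\<^sup>+ \<omega>\<in>\<Lambda>. emeasure (law Z (coord Z (T \<omega>) \<omega>)) {\<omega>'\<in>paths Z. coord Z s \<omega>' \<in> B}
              \<partial>law Z x)))"

definition quasi_left_continuous :: "('w, 'a::topological_space) process \<Rightarrow> bool" where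
  "quasi_left_continuous Z \<longleftrightarrow>
     (\<forall>T :: nat \<Rightarrow> 'w \<Rightarrow> ennreal.
        (\<forall>n. stopping_time (filt Z) (T n)) \<and> (\<forall>\<omega>\<in>paths Z. incseq (\<lambda>n. T n \<omega>)) \<longrightarrow>
        (\<forall>x. AE \<omega> in law Z x. (SUP n. T n \<omega>) < lifetime Z \<omega> \<longrightarrow>
           limitin cem_top (\<lambda>n. coord Z (T n \<omega>) \<omega>) (coord Z (SUP n. T n \<omega>) \<omega>) sequentially))"

text \<open>The completeness requirement on the filtration is used in the form
  ``\<open>filt\<close> contains the augmented natural filtration''; the \<open>\<sigma>\<close>-algebras of the filtration may be
  larger than those generated by the coordinates.\<close>

definition standard_process :: "('w, 'a::topological_space) process \<Rightarrow> bool" where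
  "standard_process Z \<longleftrightarrow>
     markov_process Z \<and>
     (\<forall>x. AE \<omega> in law Z x. coord Z 0 \<omega> = x) \<and>
     (\<forall>t<\<infinity>. sets (filt Z t) = (\<Inter>s\<in>{t<..}. sets (filt Z s))) \<and>
     (\<forall>t. sets (aug_filt Z t) \<subseteq> sets (filt Z t)) \<and>
     (\<forall>\<omega>\<in>paths Z. \<forall>t<\<infinity>. limitin cem_top (\<lambda>s. coord Z s \<omega>) (coord Z t \<omega>) (at_right t)) \<and>
     (\<forall>x. AE \<omega> in law Z x. \<forall>t. 0 < t \<and> t < lifetime Z \<omega> \<longrightarrow>
        (\<exists>l. limitin cem_top (\<lambda>s. coord Z s \<omega>) l (at_left t))) \<and>
     strong_markov Z \<and>
     quasi_left_continuous Z"

text \<open>Transience: some strictly positive Borel function has an everywhere finite potential.\<close>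

definition transient :: "('w, 'a::topological_space) process \<Rightarrow> bool" where
  "transient Z \<longleftrightarrow>
     (\<exists>h :: 'a \<Rightarrow> real. h \<in> borel_measurable borel \<and> (\<forall>x. 0 < h x) \<and>
        (\<forall>x. (\<integral>\<^sup>+ \<omega>. (\<integral>\<^sup>+ t\<in>{0..}. ennreal (ext0 h (coord Z (ennreal t) \<omega>)) \<partial>lborel)
                \<partial>law Z (Some x)) < \<infinity>))"

definition in_duality ::
    "'a::topological_space measure \<Rightarrow> ('w, 'a) process \<Rightarrow> ('v, 'a) process \<Rightarrow> bool" where
  "in_duality m Z Z' \<longleftrightarrow>
     (\<forall>t<\<infinity>. \<forall>u\<in>borel_measurable borel. \<forall>v\<in>borel_measurable borel.
        (\<integral>\<^sup>+ x. v x * (\<integral>\<^sup>+ \<omega>. ext0 u (coord Z t \<omega>) \<partial>law Z (Some x)) \<partial>m) =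
        (\<integral>\<^sup>+ x. u x * (\<integral>\<^sup>+ \<omega>. ext0 v (coord Z' t \<omega>) \<partial>law Z' (Some x)) \<partial>m))"

definition transition_density ::
    "'a::topological_space measure \<Rightarrow> ('w, 'a) process \<Rightarrow> (real \<Rightarrow> 'a \<Rightarrow> 'a \<Rightarrow> real) \<Rightarrow> bool" where
  "transition_density m Z p \<longleftrightarrow>
     (\<lambda>(t, x, y). p t x y)
       \<in> borel_measurable (restrict_space borel {0<..} \<Otimes>\<^sub>M borel \<Otimes>\<^sub>M borel) \<and>
     (\<forall>t>0. \<forall>x y. 0 < p t x y) \<and>
     (\<forall>t>0. \<forall>x. \<forall>B\<in>sets borel.
        emeasure (law Z (Some x)) {\<omega>\<in>paths Z. coord Z (ennreal t) \<omega> \<in> Some ` B} =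
        (\<integral>\<^sup>+ y\<in>B. ennreal (p t x y) \<partial>m))"

definition green :: "(real \<Rightarrow> 'a \<Rightarrow> 'a \<Rightarrow> real) \<Rightarrow> real \<Rightarrow> 'a \<Rightarrow> 'a \<Rightarrow> ennreal" where
  "green p \<alpha> x y = (\<integral>\<^sup>+ t\<in>{0<..}. ennreal (exp (- \<alpha> * t) * p t x y) \<partial>lborel)"

definition G_Kato ::
    "(real \<Rightarrow> 'a \<Rightarrow> 'a \<Rightarrow> real) \<Rightarrow> 'a::topological_space measure \<Rightarrow> bool" where
  "G_Kato p \<mu> \<longleftrightarrow> radon_measure \<mu> \<and>
     (\<forall>x. (\<integral>\<^sup>+ y. green p 0 x y \<partial>\<mu>) < \<infinity>) \<and>
     (\<lambda>x. enn2real (\<integral>\<^sup>+ y. green p 0 x y \<partial>\<mu>)) \<in> C0"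

section \<open>Additive functionals and time change\<close>

text \<open>Positive continuous additive functionals (in the strict sense, i.e. with no exceptional set
  of starting points), with a defining set \<open>\<Lambda>\<close>. The value \<open>A \<infinity>\<close> is irrelevant.\<close>

definition pcaf ::
    "('w, 'a::topological_space) process \<Rightarrow> (ennreal \<Rightarrow> 'w \<Rightarrow> ennreal) \<Rightarrow> bool" where
  "pcaf Z A \<longleftrightarrow>
     (\<forall>t<\<infinity>. A t \<in> borel_measurable (aug_filt Z t)) \<and>
     (\<exists>\<Lambda>\<in>sets (aug_filt Z \<infinity>).
        (\<forall>x. AE \<omega> in law Z x. \<omega> \<in> \<Lambda>) \<and>
        (\<forall>\<omega>\<in>\<Lambda>.
           (\<forall>t<\<infinity>. shift Z t \<omega> \<in> \<Lambda>) \<and>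
           A 0 \<omega> = 0 \<and>
           continuous_on {..<\<infinity>} (\<lambda>t. A t \<omega>) \<and>
           (\<forall>t<lifetime Z \<omega>. A t \<omega> < \<infinity>) \<and>
           (\<forall>t<\<infinity>. lifetime Z \<omega> \<le> t \<longrightarrow> A t \<omega> = A (lifetime Z \<omega>) \<omega>) \<and>
           (\<forall>s<\<infinity>. \<forall>t<\<infinity>. A (t + s) \<omega> = A t \<omega> + A s (shift Z t \<omega>))))"

text \<open>The Lebesgue--Stieltjes integral \<open>\<integral>\<^bsub>[0,\<infinity>)\<^esub> f(t) da(t)\<close> for continuous nondecreasing \<open>a\<close> with
  \<open>a(0) = 0\<close>. As \<^const>\<open>interval_measure\<close> needs a real-valued integrator, \<open>a\<close> is frozen at times \<open>b\<close>
  with \<open>a(b) < \<infinity>\<close>; by continuity these times exhaust the support of \<open>da\<close>. Negative times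
  carry no mass because \<open>ennreal t = 0\<close> for \<open>t \<le> 0\<close>.\<close>

definition stieltjes :: "(ennreal \<Rightarrow> ennreal) \<Rightarrow> (real \<Rightarrow> ennreal) \<Rightarrow> ennreal" where
  "stieltjes a f = (SUP b\<in>{b. 0 \<le> b \<and> a (ennreal b) < \<infinity>}.
     \<integral>\<^sup>+ t. f t \<partial>interval_measure (\<lambda>s. enn2real (a (ennreal (min s b)))))"

text \<open>\<open>\<integral> f d\<mu> = lim\<^bsub>t\<down>0\<^esub> (1/t) E\<^sub>m[\<integral>\<^sub>0\<^sup>t f(X\<^sub>s) dA\<^sub>s]\<close>.\<close>

definition revuz_measure ::
    "('w, 'a::topological_space) process \<Rightarrow> 'a measure \<Rightarrow> (ennreal \<Rightarrow> 'w \<Rightarrow> ennreal) \<Rightarrow> 'a measure \<Rightarrow> bool"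
  where
  "revuz_measure Z m A \<mu> \<longleftrightarrow>
     (\<forall>f :: 'a \<Rightarrow> ennreal. f \<in> borel_measurable borel \<longrightarrow>
        ((\<lambda>t. (\<integral>\<^sup>+ x. (\<integral>\<^sup>+ \<omega>. stieltjes (\<lambda>s. A s \<omega>)
                   (\<lambda>s. indicator {0..t} s * ext0 f (coord Z (ennreal s) \<omega>)) \<partial>law Z (Some x)) \<partial>m)
               / ennreal t)
          \<longlongrightarrow> (\<integral>\<^sup>+ y. f y \<partial>\<mu>)) (at_right 0))"

definition inv_clock :: "(ennreal \<Rightarrow> 'w \<Rightarrow> ennreal) \<Rightarrow> real \<Rightarrow> 'w \<Rightarrow> ennreal" where
  "inv_clock A t \<omega> = Inf {s. s < \<infinity> \<and> ennreal t < A s \<omega>}"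

definition tc_semigroup ::
    "('w, 'a) process \<Rightarrow> (ennreal \<Rightarrow> 'w \<Rightarrow> ennreal) \<Rightarrow> real \<Rightarrow> ('a \<Rightarrow> real) \<Rightarrow> 'a \<Rightarrow> real" where
  "tc_semigroup Z A t u x = (\<integral>\<omega>. ext0 u (coord Z (inv_clock A t \<omega>) \<omega>) \<partial>law Z (Some x))"

definition tc_resolvent ::
    "('w, 'a) process \<Rightarrow> (ennreal \<Rightarrow> 'w \<Rightarrow> ennreal) \<Rightarrow> real \<Rightarrow> ('a \<Rightarrow> real) \<Rightarrow> 'a \<Rightarrow> real" where
  "tc_resolvent Z A \<alpha> u x =
     (\<integral>\<omega>. (LINT t:{0..}|lborel. exp (- \<alpha> * t) * ext0 u (coord Z (inv_clock A t \<omega>) \<omega>))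
        \<partial>law Z (Some x))"

section \<open>Fine support\<close>

definition nearly_borel :: "('w, 'a::topological_space) process \<Rightarrow> 'a set \<Rightarrow> bool" where
  "nearly_borel Z B \<longleftrightarrow>
     (\<forall>\<nu>. initial_law \<nu> \<longrightarrow>
        (\<exists>B1\<in>sets borel. \<exists>B2\<in>sets borel. B1 \<subseteq> B \<and> B \<subseteq> B2 \<and>
           {\<omega>\<in>paths Z. \<exists>t. coord Z t \<omega> \<in> Some ` (B2 - B1)} \<in> null_sets (completion (law_from Z \<nu>))))"

definition hitting_time :: "('w, 'a) process \<Rightarrow> 'a set \<Rightarrow> 'w \<Rightarrow> ennreal" where
  "hitting_time Z D \<omega> = Inf {t. 0 < t \<and> coord Z t \<omega> \<in> Some ` D}"

definition thin_at :: "('w, 'a::topological_space) process \<Rightarrow> 'a set \<Rightarrow> 'a \<Rightarrow> bool" where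
  "thin_at Z B x \<longleftrightarrow>
     (\<exists>D. nearly_borel Z D \<and> B \<subseteq> D \<and> (AE \<omega> in law Z (Some x). 0 < hitting_time Z D \<omega>))"

definition finely_closed :: "('w, 'a::topological_space) process \<Rightarrow> 'a set \<Rightarrow> bool" where
  "finely_closed Z B \<longleftrightarrow> (\<forall>x. x \<notin> B \<longrightarrow> thin_at Z B x)"

text \<open>Nearly Borel sets are universally measurable, so \<open>\<mu>(- B)\<close> is evaluated in the completion.\<close>

definition fine_support ::
    "('w, 'a::topological_space) process \<Rightarrow> 'a measure \<Rightarrow> 'a set \<Rightarrow> bool" where
  "fine_support Z \<mu> F \<longleftrightarrow>
     (let carries = (\<lambda>B. nearly_borel Z B \<and> finely_closed Z B \<and> - B \<in> null_sets (completion \<mu>))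
      in carries F \<and> (\<forall>B. carries B \<longrightarrow> F \<subseteq> B))"

section \<open>Feller property\<close>

text \<open>The families act on bounded Borel functions; being a semigroup (resp. resolvent) of linear
  operators there is part of the notion.\<close>

definition linear_on_bounded_borel ::
    "(('a::topological_space \<Rightarrow> real) \<Rightarrow> 'a \<Rightarrow> real) \<Rightarrow> bool" where
  "linear_on_bounded_borel L \<longleftrightarrow>
     (\<forall>u\<in>bounded_borel. L u \<in> bounded_borel) \<and>
     (\<forall>u\<in>bounded_borel. \<forall>v\<in>bounded_borel. \<forall>a b x.
        L (\<lambda>y. a * u y + b * v y) x = a * L u x + b * L v x)"

definition sub_markovian :: "(('a::topological_space \<Rightarrow> real) \<Rightarrow> 'a \<Rightarrow> real) \<Rightarrow> bool" where
  "sub_markovian L \<longleftrightarrow>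
     (\<forall>u\<in>bounded_borel. (\<forall>x. 0 \<le> u x \<and> u x \<le> 1) \<longrightarrow> (\<forall>x. 0 \<le> L u x \<and> L u x \<le> 1))"

definition feller_semigroup ::
    "(real \<Rightarrow> ('a::topological_space \<Rightarrow> real) \<Rightarrow> 'a \<Rightarrow> real) \<Rightarrow> bool" where
  "feller_semigroup T \<longleftrightarrow>
     (\<forall>t\<ge>0. linear_on_bounded_borel (T t)) \<and>
     (\<forall>s\<ge>0. \<forall>t\<ge>0. \<forall>u\<in>bounded_borel. T (s + t) u = T s (T t u)) \<and>
     (\<forall>t\<ge>0. sub_markovian (T t)) \<and>
     (\<forall>t\<ge>0. \<forall>u\<in>C0. T t u \<in> C0) \<and>
     (\<forall>u\<in>C0. ((\<lambda>t. supnorm (\<lambda>x. T t u x - u x)) \<longlongrightarrow> 0) (at_right 0))"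

definition feller_resolvent ::
    "(real \<Rightarrow> ('a::topological_space \<Rightarrow> real) \<Rightarrow> 'a \<Rightarrow> real) \<Rightarrow> bool" where
  "feller_resolvent R \<longleftrightarrow>
     (\<forall>\<alpha>>0. linear_on_bounded_borel (R \<alpha>)) \<and>
     (\<forall>\<alpha>>0. \<forall>\<beta>>0. \<forall>u\<in>bounded_borel. \<forall>x.
        R \<alpha> u x - R \<beta> u x = (\<beta> - \<alpha>) * R \<alpha> (R \<beta> u) x) \<and>
     (\<forall>\<alpha>>0. sub_markovian (\<lambda>u x. \<alpha> * R \<alpha> u x)) \<and>
     (\<forall>\<alpha>>0. \<forall>u\<in>C0. R \<alpha> u \<in> C0) \<and>
     (\<forall>u\<in>C0. ((\<lambda>\<alpha>. supnorm (\<lambda>x. \<alpha> * R \<alpha> u x - u x)) \<longlongrightarrow> 0) at_top)"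

end

theory Submission
  imports Defs
begin

text \<open>Write \<open>Y\<^sub>t\<close> for the time-changed process. Its potential is \<open>V u = R\<^sub>0 u = \<integral> G(\<cdot>,y) u(y) \<mu>(dy)\<close>. For
  \<open>0 \<le> u \<le> 1\<close> both \<open>V u\<close> and \<open>V (1 - u)\<close> are lower semicontinuous by Fatou and their sum \<open>V 1\<close> is
  in \<open>C\<^sub>0\<close>, so \<open>V\<close> maps bounded Borel functions into \<open>C\<^sub>0\<close>; the resolvent equation carries this over
  to all \<open>R\<^sub>\<alpha>\<close>.

  The full fine support enters through sets that carry \<open>\<mu>\<close>. Since \<open>Y\<^sub>0 \<circ> \<theta>\<^bsub>\<tau>(t)\<^esub> = Y\<^sub>t\<close> and \<open>G > 0\<close>, the set
  \<open>{P\<^sub>0 f = f}\<close> carries \<open>\<mu>\<close>. For supermedian \<open>f\<close> it is finely closed, because \<open>P\<^sub>0 f\<close> is an increasing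
  limit of continuous potentials and a maximal inequality keeps the paths away from \<open>{P\<^sub>0 f > c}\<close>;
  hence \<open>V f(Y\<^sub>0) = V f(x)\<close> almost surely. In a second step \<open>P\<^sub>0 f = f\<close> follows for all bounded
  continuous \<open>f\<close>: before \<open>\<tau>\<^sub>0\<close> the paths stay in a level set of all \<open>R\<^sub>n f\<close>.

  Strong continuity of the resolvent is Dini's theorem for supermedian functions in \<open>C\<^sub>0\<close>, whose
  differences form a lattice that is dense in \<open>C\<^sub>0\<close>. For the semigroup, \<open>P\<^sub>t V f = V f - \<integral>\<^sub>0\<^sup>t P\<^sub>s f ds\<close>,
  and the integral lies in \<open>C\<^sub>0\<close> by approximation with polynomials in \<open>e\<^sup>-\<^sup>s\<close>.\<close>

section \<open>The state space with cemetery\<close>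

text \<open>Two obstacles shape the development. \<open>pcaf\<close> makes \<open>A t\<close>
  measurable only for the augmented filtration, whereas \<open>strong_markov\<close> speaks of a
  single later coordinate. The strong Markov property is therefore carried over to functionals that
  are measurable after completion under every initial law; the initial law that occurs is that of X
  at the stopping time. For the same reason x \<mapsto> E_x[u(Y_t)] is not Borel by construction:
  Borel measurability of R_a u and P_t u is drawn from C0 statements, and for R_a u it is carried as
  a hypothesis until then. The other obstacle is that \<tau>_0 may be positive, so Y_0 need not be
  the starting point. Minimality of the fine support yields something only for sets known to be
  finely closed, and continuity of f does not give this for {P_0 f = f}. For supermedian f one has
  P_0 f \<le> f and monotone approximation, and this one-sided control suffices. For other f the set
  is enlarged by all points that some R_n f separates from the given one; fine closedness of the
  enlarged set can be checked.\<close>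

lemma openin_cem_Some: "open U \<Longrightarrow> openin cem_top (Some ` U)"
  by simp

lemma openin_cem_vimage: 
  fixes U :: "'a::t2_space option set"
  assumes "openin cem_top U"
  shows "open (Some -` U)"
proof -
  have "continuous_map euclidean cem_top (Some :: 'a \<Rightarrow> _)"
    by (rule continuous_map_Some)
  from openin_continuous_map_preimage[OF this assms] show ?thesis
    by (simp add: vimage_def)
qed

lemma space_cem_borel [simp]: "space cem_borel = UNIV"
  unfolding cem_borel_def by (simp add: space_measure_of_conv)

lemma sets_cem_borel: "sets cem_borel = sigma_sets UNIV {U. openin cem_top U}"
  unfolding cem_borel_def by (simp add: sets_measure_of_conv)

lemma Some_closed_in_cem_borel:
  fixes C :: "'a::t2_space set"
  assumes "closed C" shows "Some ` C \<in> sets cem_borel"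
proof -
  have "Some ` C = Some ` UNIV - Some ` (- C)" by auto
  moreover have "Some ` (UNIV :: 'a set) \<in> sets cem_borel" "Some ` (- C) \<in> sets cem_borel"
    using assms by (auto simp: sets_cem_borel intro!: sigma_sets.Basic openin_cem_Some)
  ultimately show ?thesis by auto
qed

text \<open>For the generated sigma-algebra only closedness of the complement matters, not its
  compactness. The split is on whether the cemetery belongs to the set; measurability can then be
  tested on images of closed sets alone.\<close>

lemma cem_openE:
  fixes U :: "'a::t2_space option set"
  assumes "openin cem_top U"
  obtains C where "closed C" "U = UNIV - Some ` C"
    | C where "closed C" "U = Some ` UNIV - Some ` C"
proof (cases "None \<in> U")
  case True
  have "U = UNIV - Some ` (- (Some -` U))" using True
    by (intro set_eqI, case_tac x) auto
  then show ?thesis using that(1)[of "- (Some -` U)"] openin_cem_vimage[OF assms] by auto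
next
  case False
  have "U = Some ` UNIV - Some ` (- (Some -` U))" using False
    by (intro set_eqI, case_tac x) auto
  then show ?thesis using that(2)[of "- (Some -` U)"] openin_cem_vimage[OF assms] by auto
qed

lemma measurable_cemI:
  fixes g :: "'w \<Rightarrow> 'a::t2_space option"
  assumes "\<And>C. closed C \<Longrightarrow> g -` Some ` C \<inter> space M \<in> sets M"
  shows "g \<in> M \<rightarrow>\<^sub>M cem_borel"
  unfolding cem_borel_def
proof (rule measurable_measure_of)
  fix U :: "'a option set" assume "U \<in> {U. openin cem_top U}"
  then have "openin cem_top U" by simp
  then show "g -` U \<inter> space M \<in> sets M"
  proof (cases rule: cem_openE)
    case (1 C)
    then have "g -` U \<inter> space M = space M - (g -` Some ` C \<inter> space M)" by auto
    then show ?thesis using assms[OF 1(1)] by auto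
  next
    case (2 C)
    then have "g -` U \<inter> space M = (g -` Some ` UNIV \<inter> space M) - (g -` Some ` C \<inter> space M)" by auto
    then show ?thesis using assms[OF 2(1)] assms[of UNIV] by auto
  qed
qed auto

lemma measurable_ext0 [measurable]:
  fixes u :: "'a::t2_space \<Rightarrow> 'b::{zero, topological_space}"
  assumes [measurable]: "u \<in> borel_measurable borel"
  shows "ext0 u \<in> borel_measurable cem_borel"
proof -
  let ?S = "sigma UNIV {Some ` C | C :: 'a set. closed C}"
  have Some_sigma: "B \<in> sets borel \<Longrightarrow> Some ` B \<in> sets cem_borel" for B :: "'a set"
  proof -
    assume "B \<in> sets borel"
    then have "B \<in> sigma_sets UNIV {C. closed C}"
      by (simp add: borel_eq_closed)
    then show ?thesis
    proof induction
      case (Basic a) then show ?case by (simp add: Some_closed_in_cem_borel)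
    next
      case Empty then show ?case by simp
    next
      case (Compl a)
      have "Some ` (UNIV - a) = Some ` UNIV - Some ` a" by auto
      then show ?case using Compl Some_closed_in_cem_borel[of UNIV] by auto
    next
      case (Union a) then show ?case by (simp add: image_UN)
    qed
  qed
  show ?thesis
  proof (rule measurableI)
    fix B :: "'b set" assume B: "B \<in> sets borel"
    have *: "Some ` (u -` B) \<in> sets cem_borel"
      using measurable_sets[OF assms B] by (intro Some_sigma) auto
    have N: "- range Some \<in> sets (cem_borel :: 'a option measure)"
      using sets.compl_sets[OF Some_closed_in_cem_borel[of UNIV]] by (simp add: Compl_eq_Diff_UNIV)
    have "ext0 u -` B = Some ` (u -` B) \<union> (if 0 \<in> B then - range Some else {})"
      by (intro set_eqI, case_tac x) (auto simp: ext0_def)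
    then show "ext0 u -` B \<inter> space cem_borel \<in> sets cem_borel" using * N by auto
  qed auto
qed

lemma ext0_simps [simp]: "ext0 u None = 0" "ext0 u (Some x) = u x"
  by (auto simp: ext0_def)

text \<open>The value 1 is used on the closed set because \<open>ext0\<close> sends the cemetery to
  0: the zero set of the extended distance function would contain \<open>None\<close>.\<close>

lemma ext0_closed_indicator:
  fixes C :: "'a::metric_space set"
  assumes "closed C" "C \<noteq> {}"
  shows "Some ` C = ext0 (\<lambda>x. 1 / (1 + infdist x C)) -` {1 :: real}"
proof -
  have "1 / (1 + infdist x C) = 1 \<longleftrightarrow> x \<in> C" for x
    using infdist_nonneg[of x C] in_closed_iff_infdist_zero[OF assms, of x]
    by (auto simp: divide_simps)
  then show ?thesis by (intro set_eqI, case_tac x) (auto simp: ext0_def)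
qed

text \<open>The test functions are real, so that pointwise limits of measurable functions become
  available for processes with values in the compactification.\<close>

lemma measurable_cem_contI:
  fixes g :: "'w \<Rightarrow> 'a::metric_space option"
  assumes "\<And>f :: 'a \<Rightarrow> real. continuous_on UNIV f \<Longrightarrow> (\<lambda>\<omega>. ext0 f (g \<omega>)) \<in> borel_measurable M"
  shows "g \<in> M \<rightarrow>\<^sub>M cem_borel"
proof (rule measurable_cemI)
  fix C :: "'a set" assume C: "closed C"
  show "g -` Some ` C \<inter> space M \<in> sets M"
  proof (cases "C = {}")
    case False
    have "1 + infdist x C \<noteq> 0" for x using infdist_nonneg[of x C] by linarith
    then have "continuous_on UNIV (\<lambda>x. 1 / (1 + infdist x C))"
      by (intro continuous_intros) auto
    from measurable_sets[OF assms[OF this], of "{1}"]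
    show ?thesis by (simp add: ext0_closed_indicator[OF C False] vimage_def)
  qed simp
qed

text \<open>Time is discretised from the right. Right continuity is asked only of the real functions
  \<open>ext0 f (Y t \<omega>)\<close>, so f need not extend continuously to the cemetery.\<close>

lemma right_continuous_process_measurable:
  fixes Y :: "real \<Rightarrow> 'w \<Rightarrow> 'a::metric_space option"
  assumes Y: "\<And>t. Y t \<in> M \<rightarrow>\<^sub>M cem_borel"
    and rc: "\<And>\<omega> t f. \<omega> \<in> space M \<Longrightarrow> continuous_on UNIV (f :: 'a \<Rightarrow> real) \<Longrightarrow>
      ((\<lambda>s. ext0 f (Y s \<omega>)) \<longlongrightarrow> ext0 f (Y t \<omega>)) (at_right t)"
  shows "(\<lambda>(t, \<omega>). Y t \<omega>) \<in> borel \<Otimes>\<^sub>M M \<rightarrow>\<^sub>M cem_borel"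
proof (rule measurable_cem_contI)
  fix f :: "'a \<Rightarrow> real" assume f: "continuous_on UNIV f"
  then have [measurable]: "f \<in> borel_measurable borel" by (rule borel_measurable_continuous_onI)
  \<comment> \<open>The summand 1 puts the grid point strictly to the right of t, as right
    continuity needs; \<open>Suc n\<close> keeps the mesh 1/(n+1) defined at n = 0.\<close>
  define d where "d n t = (real_of_int \<lfloor>real (Suc n) * t\<rfloor> + 1) / real (Suc n)" for n :: nat and t :: real
  have d_gt: "t < d n t" for n t unfolding d_def by (simp add: pos_less_divide_eq mult.commute del: of_nat_Suc)
  have d_le: "d n t \<le> t + 1 / real (Suc n)" for n t
  proof -
    have "(of_int \<lfloor>real (Suc n) * t\<rfloor> :: real) \<le> real (Suc n) * t" by linarith
    then have "d n t \<le> (real (Suc n) * t + 1) / real (Suc n)"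
      unfolding d_def by (intro divide_right_mono) auto
    also have "\<dots> = t + 1 / real (Suc n)" by (simp add: field_simps)
    finally show ?thesis .
  qed
  have d_lim: "(\<lambda>n. d n t) \<longlonglongrightarrow> t" for t
  proof (rule real_tendsto_sandwich[where f = "\<lambda>_. t" and h = "\<lambda>n. t + 1 / real (Suc n)"])
    show "(\<lambda>n. t + 1 / real (Suc n)) \<longlonglongrightarrow> t"
      using tendsto_add[OF tendsto_const[of t] LIMSEQ_Suc[OF lim_inverse_n']] by simp
  qed (use d_gt d_le in \<open>auto intro!: always_eventually less_imp_le simp del: of_nat_Suc\<close>)
  have d_filt: "filterlim (\<lambda>n. d n t) (at_right t) sequentially" for t
    using d_lim d_gt by (auto simp: filterlim_at intro!: always_eventually) (metis less_irrefl)
  show "(\<lambda>\<omega>. ext0 f (case \<omega> of (t, \<omega>) \<Rightarrow> Y t \<omega>)) \<in> borel_measurable (borel \<Otimes>\<^sub>M M)"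
  proof (rule borel_measurable_LIMSEQ_real)
    fix n
    have aux: "(\<lambda>z. ext0 f (Y ((real_of_int i + 1) / real (Suc n)) (snd z))) \<in> borel_measurable (borel \<Otimes>\<^sub>M M)"
      for i :: int
      using measurable_compose[OF measurable_compose[OF measurable_snd Y] measurable_ext0[OF \<open>f \<in> borel_measurable borel\<close>]] .
    \<comment> \<open>The floor takes countably many values, and for each of them the time is
      fixed.\<close>
    have *: "(\<lambda>z. ext0 f (Y ((real_of_int \<lfloor>real (Suc n) * fst z\<rfloor> + 1) / real (Suc n)) (snd z)))
      \<in> borel_measurable (borel \<Otimes>\<^sub>M M)"
      by (rule measurable_compose_countable[where g = "\<lambda>z. \<lfloor>real (Suc n) * fst z\<rfloor>", OF aux]) measurable
    show "(\<lambda>z. ext0 f (Y (d n (fst z)) (snd z))) \<in> borel_measurable (borel \<Otimes>\<^sub>M M)"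
      using * by (simp add: d_def)
  next
    fix z :: "real \<times> 'w" assume "z \<in> space (borel \<Otimes>\<^sub>M M)"
    then have "snd z \<in> space M" by (auto simp: space_pair_measure)
    from filterlim_compose[OF rc[OF this f, of "fst z"] d_filt]
    show "(\<lambda>n. ext0 f (Y (d n (fst z)) (snd z))) \<longlonglongrightarrow> ext0 f (case z of (t, \<omega>) \<Rightarrow> Y t \<omega>)"
      by (simp add: case_prod_beta)
  qed
qed

section \<open>The strong Markov property on the augmented filtration\<close>

locale std_process =
  fixes Z :: "('w, 'a::{metric_space, second_countable_topology}) process"
  assumes standard_process_Z: "standard_process Z"
begin

lemma markov_process_Z: "markov_process Z"
  using standard_process_Z unfolding standard_process_def by simp

sublocale filtration "paths Z" "filt Z"
  using markov_process_Z unfolding markov_process_def by simp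

lemma filt_events: "sets (filt Z t) \<subseteq> sets (events Z)"
  using markov_process_Z unfolding markov_process_def by simp

lemma prob_law: "prob_space (law Z x)"
  and sets_law [simp, measurable_cong]: "sets (law Z x) = sets (events Z)"
  using markov_process_Z unfolding markov_process_def by simp_all

lemma space_law [simp]: "space (law Z x) = paths Z"
  by (rule sets_eq_imp_space_eq) simp

lemma coord_filt: "coord Z t \<in> filt Z t \<rightarrow>\<^sub>M cem_borel"
  and coord_top: "\<omega> \<in> paths Z \<Longrightarrow> coord Z \<infinity> \<omega> = None"
  and coord_None_mono: "\<omega> \<in> paths Z \<Longrightarrow> s \<le> t \<Longrightarrow> coord Z s \<omega> = None \<Longrightarrow> coord Z t \<omega> = None"
  and shift_paths: "\<omega> \<in> paths Z \<Longrightarrow> shift Z t \<omega> \<in> paths Z"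
  and coord_shift: "\<omega> \<in> paths Z \<Longrightarrow> coord Z s (shift Z t \<omega>) = coord Z (t + s) \<omega>"
  using markov_process_Z unfolding markov_process_def by simp_all

lemma coord_prob_measurable:
  "B \<in> sets cem_borel \<Longrightarrow>
    (\<lambda>x. emeasure (law Z x) {\<omega>\<in>paths Z. coord Z t \<omega> \<in> B}) \<in> borel_measurable cem_borel"
  using markov_process_Z unfolding markov_process_def by simp

lemma AE_coord_0: "AE \<omega> in law Z x. coord Z 0 \<omega> = x"
  using standard_process_Z unfolding standard_process_def by simp

lemma filt_right_cont: "t < \<infinity> \<Longrightarrow> sets (filt Z t) = (\<Inter>s\<in>{t<..}. sets (filt Z s))"
  using standard_process_Z unfolding standard_process_def by simp

lemma aug_filt_sub_filt: "sets (aug_filt Z t) \<subseteq> sets (filt Z t)"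
  using standard_process_Z unfolding standard_process_def by simp

lemma coord_right_cont:
  "\<omega> \<in> paths Z \<Longrightarrow> t < \<infinity> \<Longrightarrow> limitin cem_top (\<lambda>s. coord Z s \<omega>) (coord Z t \<omega>) (at_right t)"
  using standard_process_Z unfolding standard_process_def by simp

lemma strong_markov_meas:
  "stopping_time (filt Z) T \<Longrightarrow> (\<lambda>\<omega>. coord Z (T \<omega>) \<omega>) \<in> pre_sigma T \<rightarrow>\<^sub>M cem_borel"
  using standard_process_Z unfolding standard_process_def strong_markov_def by simp

lemma strong_markov_set:
  "stopping_time (filt Z) T \<Longrightarrow> B \<in> sets cem_borel \<Longrightarrow> \<Gamma> \<in> sets (pre_sigma T) \<Longrightarrow>
     emeasure (law Z x) {\<omega>\<in>\<Gamma>. coord Z (T \<omega> + s) \<omega> \<in> B} =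
           (\<integral>\<^sup>+ \<omega>\<in>\<Gamma>. emeasure (law Z (coord Z (T \<omega>) \<omega>)) {\<omega>'\<in>paths Z. coord Z s \<omega>' \<in> B}
              \<partial>law Z x)"
  using standard_process_Z unfolding standard_process_def strong_markov_def by simp

lemma stopping_time_shift:
  assumes T: "stopping_time (filt Z) T"
  shows "stopping_time (filt Z) (\<lambda>\<omega>. T \<omega> + s)"
proof (rule stopping_timeI)
  fix t
  consider "t = \<infinity>" | "t < \<infinity>" "s \<le> t" | "t < s" by (metis infinity_ennreal_def linorder_not_less top.not_eq_extremum)
  then show "Measurable.pred (filt Z t) (\<lambda>x. T x + s \<le> t)"
  proof cases
    case 2
    then have "s \<noteq> top" by auto
    have "T x + s \<le> t \<longleftrightarrow> T x \<le> t - s" for x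
    proof
      assume "T x + s \<le> t"
      then have "T x + s - s \<le> t - s" by (rule ennreal_minus_mono) simp
      then show "T x \<le> t - s" using \<open>s \<noteq> top\<close> by (simp add: ennreal_add_diff_cancel_right)
    next
      assume "T x \<le> t - s"
      then have "T x + s \<le> t - s + s" by (rule add_right_mono)
      then show "T x + s \<le> t" using \<open>s \<le> t\<close> by (simp add: diff_add_cancel_ennreal)
    qed
    moreover have "Measurable.pred (filt Z t) (\<lambda>x. T x \<le> t - s)"
      by (rule stopping_time_le_const[OF T]) (simp add: diff_le_self_ennreal)
    ultimately show ?thesis by simp
  next
    case 3
    then have "\<not> T x + s \<le> t" for x by (metis add.commute le_add_same_cancel1 leD le_iff_add order_trans zero_le)
    then show ?thesis by simp
  qed simp
qed

lemma pre_sigma_events: "stopping_time (filt Z) T \<Longrightarrow> sets (pre_sigma T) \<subseteq> sets (events Z)"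
proof
  fix A assume T: "stopping_time (filt Z) T" and "A \<in> sets (pre_sigma T)"
  from sets_pre_sigmaD[OF this, of \<infinity>] have "A \<in> sets (filt Z \<infinity>)" by simp
  then show "A \<in> sets (events Z)" using filt_events by blast
qed

lemma coord_stop_measurable:
  assumes "stopping_time (filt Z) T"
  shows "(\<lambda>\<omega>. coord Z (T \<omega>) \<omega>) \<in> events Z \<rightarrow>\<^sub>M cem_borel"
  using strong_markov_meas[OF assms] pre_sigma_events[OF assms]
  by (auto simp: measurable_def space_pre_sigma)

lemma coord_measurable [measurable]: "coord Z t \<in> events Z \<rightarrow>\<^sub>M cem_borel"
  using coord_stop_measurable[OF stopping_time_const[of "filt Z" t]] by simp

section \<open>Coordinate sigma-algebras and measurability of the shift\<close>

lemma space_nat_filt [simp]: "space (nat_filt Z t) = paths Z"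
  unfolding nat_filt_def by (simp add: space_measure_of_conv)

lemma sets_nat_filt:
  "sets (nat_filt Z t) = sigma_sets (paths Z)
     {coord Z s -` B \<inter> paths Z | s B. s \<le> t \<and> B \<in> sets cem_borel}"
  unfolding nat_filt_def by (rule sets_measure_of) auto

lemma coord_nat_filt: "s \<le> t \<Longrightarrow> coord Z s \<in> nat_filt Z t \<rightarrow>\<^sub>M cem_borel"
  by (rule measurableI) (auto simp: sets_nat_filt intro!: sigma_sets.Basic)

lemma coord_nat_filt_top [measurable]: "coord Z s \<in> nat_filt Z top \<rightarrow>\<^sub>M cem_borel"
  by (rule coord_nat_filt) simp

lemma nat_filt_sub_filt: "sets (nat_filt Z t) \<subseteq> sets (filt Z t)"
  unfolding sets_nat_filt
proof -
  have "{coord Z s -` B \<inter> paths Z | s B. s \<le> t \<and> B \<in> sets cem_borel} \<subseteq> sets (filt Z t)"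
  proof safe
    fix s B assume "s \<le> t" "B \<in> sets (cem_borel :: 'a option measure)"
    then have "coord Z s -` B \<inter> space (filt Z s) \<in> sets (filt Z s)"
      by (intro measurable_sets[OF coord_filt])
    then show "coord Z s -` B \<inter> paths Z \<in> sets (filt Z t)"
      using sets_F_mono[OF \<open>s \<le> t\<close>] by (auto simp: space_F)
  qed
  from sets.sigma_sets_subset[OF this] show "sigma_sets (paths Z)
     {coord Z s -` B \<inter> paths Z | s B. s \<le> t \<and> B \<in> sets cem_borel} \<subseteq> sets (filt Z t)" by (simp add: space_F)
qed

lemma nat_filt_sub_events: "sets (nat_filt Z t) \<subseteq> sets (events Z)"
  using nat_filt_sub_filt filt_events by blast

lemma measurable_sub_algebra:
  "f \<in> M \<rightarrow>\<^sub>M K \<Longrightarrow> space M = space N \<Longrightarrow> sets M \<subseteq> sets N \<Longrightarrow> f \<in> N \<rightarrow>\<^sub>M K"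
  unfolding measurable_def by auto

lemma measurable_nat_filt_events: "f \<in> nat_filt Z t \<rightarrow>\<^sub>M N \<Longrightarrow> f \<in> events Z \<rightarrow>\<^sub>M N"
  using nat_filt_sub_events[of t] by (auto elim: measurable_sub_algebra)

text \<open>Only the coordinates of a shifted path are known, so the target is the coordinate
  sigma-algebra. The preimage of {X_s \<in> B} is {X_(T+s) \<in> B}, and T + s is again a stopping
  time.\<close>

lemma shift_measurable:
  assumes T: "stopping_time (filt Z) T"
  shows "(\<lambda>\<omega>. shift Z (T \<omega>) \<omega>) \<in> events Z \<rightarrow>\<^sub>M nat_filt Z top"
  unfolding nat_filt_def
proof (rule measurable_measure_of)
  fix S assume "S \<in> {coord Z s -` B \<inter> paths Z | s B. s \<le> top \<and> B \<in> sets cem_borel}"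
  then obtain s B where S: "S = coord Z s -` B \<inter> paths Z" and B: "B \<in> sets cem_borel" by auto
  have "(\<lambda>\<omega>. shift Z (T \<omega>) \<omega>) -` S \<inter> paths Z = (\<lambda>\<omega>. coord Z (T \<omega> + s) \<omega>) -` B \<inter> paths Z"
    by (auto simp: S shift_paths coord_shift)
  also have "\<dots> \<in> sets (events Z)"
    by (rule measurable_sets[OF coord_stop_measurable[OF stopping_time_shift[OF T]] B])
  finally show "(\<lambda>\<omega>. shift Z (T \<omega>) \<omega>) -` S \<inter> space (events Z) \<in> sets (events Z)" .
qed (auto simp: shift_paths)

section \<open>From a single coordinate to all path functionals\<close>

definition one_kernel :: "ennreal \<Rightarrow> 'a option \<Rightarrow> 'a option measure" where
  "one_kernel s y = distr (law Z y) cem_borel (coord Z s)"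

lemma one_kernel_measurable [measurable]: "one_kernel s \<in> cem_borel \<rightarrow>\<^sub>M subprob_algebra cem_borel"
proof (rule measurable_subprob_algebra)
  fix y
  interpret prob_space "law Z y" by (rule prob_law)
  show "subprob_space (one_kernel s y)" unfolding one_kernel_def
    by (rule prob_space_imp_subprob_space[OF prob_space_distr]) simp
next
  fix B assume B: "B \<in> sets (cem_borel :: 'a option measure)"
  have "emeasure (one_kernel s y) B = emeasure (law Z y) {\<omega>\<in>paths Z. coord Z s \<omega> \<in> B}" for y
    unfolding one_kernel_def using B
    by (subst emeasure_distr) (auto intro!: arg_cong[where f = "emeasure _"])
  then show "(\<lambda>y. emeasure (one_kernel s y) B) \<in> borel_measurable cem_borel"
    using coord_prob_measurable[OF B] by simp
qed (simp add: one_kernel_def)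

text \<open>The law of X_T under P_x on the event \<Gamma>. It is finite, hence an
  \<open>initial_law\<close> and thus one of the laws under which \<open>aug_filt\<close> is
  completed; this lets the strong Markov property reach the augmented filtration.\<close>

definition part_law :: "('w \<Rightarrow> ennreal) \<Rightarrow> 'w set \<Rightarrow> 'a option \<Rightarrow> 'a option measure" where
  "part_law T \<Gamma> x = distr (density (law Z x) (indicator \<Gamma>)) cem_borel (\<lambda>\<omega>. coord Z (T \<omega>) \<omega>)"

text \<open>Written as a composition of kernels, the identity for single sets yields integrals of
  arbitrary nonnegative functions through \<open>nn_integral_bind\<close>.\<close>

lemma strong_markov_one_kernel:
  assumes T: "stopping_time (filt Z) T" and \<Gamma>: "\<Gamma> \<in> sets (pre_sigma T)"
  shows "part_law (\<lambda>\<omega>. T \<omega> + s) \<Gamma> x = part_law T \<Gamma> x \<bind> one_kernel s"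
proof (rule measure_eqI)
  show "sets (part_law (\<lambda>\<omega>. T \<omega> + s) \<Gamma> x) = sets (part_law T \<Gamma> x \<bind> one_kernel s)"
    by (subst sets_bind[where N = cem_borel]) (auto simp: part_law_def one_kernel_def)
next
  fix B assume "B \<in> sets (part_law (\<lambda>\<omega>. T \<omega> + s) \<Gamma> x)"
  then have B: "B \<in> sets cem_borel" by (simp add: part_law_def)
  have [measurable]: "\<Gamma> \<in> sets (events Z)" using pre_sigma_events[OF T] \<Gamma> by blast
  note [measurable] = coord_stop_measurable[OF T] coord_stop_measurable[OF stopping_time_shift[OF T, of s]]
  have *: "emeasure (one_kernel s y) B = emeasure (law Z y) {\<omega>\<in>paths Z. coord Z s \<omega> \<in> B}" for y
    unfolding one_kernel_def using B
    by (subst emeasure_distr) (auto intro!: arg_cong[where f = "emeasure _"])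
  have [measurable]: "(\<lambda>y. emeasure (one_kernel s y) B) \<in> borel_measurable cem_borel"
    unfolding * using B by (rule coord_prob_measurable)
  have \<Gamma>sub: "\<Gamma> \<subseteq> paths Z" using \<open>\<Gamma> \<in> sets (events Z)\<close> sets.sets_into_space by blast
  have "{\<omega>\<in>\<Gamma>. coord Z (T \<omega> + s) \<omega> \<in> B} = \<Gamma> \<inter> ((\<lambda>\<omega>. coord Z (T \<omega> + s) \<omega>) -` B \<inter> space (events Z))"
    using \<Gamma>sub by auto
  also have "\<dots> \<in> sets (events Z)" using B by measurable
  finally have **: "{\<omega>\<in>\<Gamma>. coord Z (T \<omega> + s) \<omega> \<in> B} \<in> sets (events Z)" .
  have "emeasure (part_law (\<lambda>\<omega>. T \<omega> + s) \<Gamma> x) B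
    = emeasure (law Z x) {\<omega>\<in>\<Gamma>. coord Z (T \<omega> + s) \<omega> \<in> B}"
    unfolding part_law_def using B
    apply (subst emeasure_distr, simp, simp)
    apply (subst emeasure_density, simp, simp)
    apply (subst nn_integral_indicator[symmetric])
    subgoal using ** by simp
    subgoal using \<Gamma>sub by (intro nn_integral_cong) (auto split: split_indicator)
    done
  also have "\<dots> = (\<integral>\<^sup>+ \<omega>\<in>\<Gamma>. emeasure (one_kernel s (coord Z (T \<omega>) \<omega>)) B \<partial>law Z x)"
    unfolding * by (rule strong_markov_set[OF T B \<Gamma>])
  also have "\<dots> = emeasure (part_law T \<Gamma> x \<bind> one_kernel s) B"
    using B
    apply (subst emeasure_bind[where N = cem_borel])
    apply (simp add: part_law_def)
    apply (simp add: part_law_def)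
    apply simp
    apply (simp add: part_law_def)
    apply (subst nn_integral_distr, simp, simp)
    apply (subst nn_integral_density, simp, simp)
    apply (simp add: mult.commute)
    done
  finally show "emeasure (part_law (\<lambda>\<omega>. T \<omega> + s) \<Gamma> x) B = emeasure (part_law T \<Gamma> x \<bind> one_kernel s) B" .
qed

lemma nn_integral_part_law:
  assumes T: "stopping_time (filt Z) T" and \<Gamma>: "\<Gamma> \<in> sets (pre_sigma T)"
    and [measurable]: "h \<in> borel_measurable cem_borel"
  shows "(\<integral>\<^sup>+ y. h y \<partial>part_law T \<Gamma> x) = (\<integral>\<^sup>+ \<omega>. h (coord Z (T \<omega>) \<omega>) * indicator \<Gamma> \<omega> \<partial>law Z x)"
proof -
  have [measurable]: "\<Gamma> \<in> sets (events Z)" using pre_sigma_events[OF T] \<Gamma> by blast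
  note [measurable] = coord_stop_measurable[OF T]
  show ?thesis unfolding part_law_def
    apply (subst nn_integral_distr, simp, simp)
    apply (subst nn_integral_density, simp, simp)
    apply (simp add: mult.commute)
    done
qed

lemma nn_integral_one_kernel:
  "h \<in> borel_measurable cem_borel \<Longrightarrow> (\<integral>\<^sup>+ y'. h y' \<partial>one_kernel s y) = (\<integral>\<^sup>+ \<omega>. h (coord Z s \<omega>) \<partial>law Z y)"
  unfolding one_kernel_def by (subst nn_integral_distr) auto

lemma strong_markov_fun:
  assumes T: "stopping_time (filt Z) T" and \<Gamma>: "\<Gamma> \<in> sets (pre_sigma T)"
    and h[measurable]: "h \<in> borel_measurable cem_borel"
  shows "(\<integral>\<^sup>+ \<omega>. h (coord Z (T \<omega> + s) \<omega>) * indicator \<Gamma> \<omega> \<partial>law Z x) =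
    (\<integral>\<^sup>+ \<omega>. (\<integral>\<^sup>+ \<omega>'. h (coord Z s \<omega>') \<partial>law Z (coord Z (T \<omega>) \<omega>)) * indicator \<Gamma> \<omega> \<partial>law Z x)"
proof -
  have "\<Gamma> \<in> sets (pre_sigma (\<lambda>\<omega>. T \<omega> + s))"
    using mono_pre_sigma[OF T stopping_time_shift[OF T, of s]] \<Gamma> by (auto simp: subset_eq)
  from nn_integral_part_law[OF stopping_time_shift[OF T] this h]
  have "(\<integral>\<^sup>+ \<omega>. h (coord Z (T \<omega> + s) \<omega>) * indicator \<Gamma> \<omega> \<partial>law Z x) = (\<integral>\<^sup>+ y. h y \<partial>(part_law T \<Gamma> x \<bind> one_kernel s))"
    by (simp add: strong_markov_one_kernel[OF T \<Gamma>])
  also have "\<dots> = (\<integral>\<^sup>+ y. (\<integral>\<^sup>+ y'. h y' \<partial>one_kernel s y) \<partial>part_law T \<Gamma> x)"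
    by (rule nn_integral_bind[where B = cem_borel])
      (auto simp: part_law_def)
  also have "\<dots> = (\<integral>\<^sup>+ \<omega>. (\<integral>\<^sup>+ y'. h y' \<partial>one_kernel s (coord Z (T \<omega>) \<omega>)) * indicator \<Gamma> \<omega> \<partial>law Z x)"
    by (rule nn_integral_part_law[OF T \<Gamma>]) measurable
  finally show ?thesis by (simp add: nn_integral_one_kernel)
qed

lemma law_fun_measurable:
  assumes [measurable]: "h \<in> borel_measurable cem_borel"
  shows "(\<lambda>y. \<integral>\<^sup>+ \<omega>. h (coord Z s \<omega>) \<partial>law Z y) \<in> borel_measurable cem_borel"
proof -
  have "(\<lambda>y. \<integral>\<^sup>+ y'. h y' \<partial>one_kernel s y) \<in> borel_measurable cem_borel" by measurable
  then show ?thesis by (simp add: nn_integral_one_kernel)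
qed

definition cyl :: "ennreal set \<Rightarrow> (ennreal \<Rightarrow> 'a option set) \<Rightarrow> 'w set" where
  "cyl I B = {\<omega>\<in>paths Z. \<forall>i\<in>I. coord Z i \<omega> \<in> B i}"

text \<open>Condition at the earliest time r: T + r is a stopping time, the event {X_(T+r) \<in> B
  r} is absorbed into \<Gamma>, and the remaining times, counted from r, are fewer. Measurability in
  y and the Markov property are proved together because the former makes the function g of the
  induction hypothesis admissible in \<open>strong_markov_fun\<close>.\<close>

lemma cylinder_markov:
  assumes "finite I" "\<And>i. B i \<in> sets cem_borel"
  shows "(\<lambda>y. emeasure (law Z y) (cyl I B)) \<in> borel_measurable cem_borel \<and>
    (\<forall>T \<Gamma> x. stopping_time (filt Z) T \<longrightarrow> \<Gamma> \<in> sets (pre_sigma T) \<longrightarrow>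
      emeasure (law Z x) {\<omega>\<in>\<Gamma>. \<forall>i\<in>I. coord Z (T \<omega> + i) \<omega> \<in> B i} =
      (\<integral>\<^sup>+ \<omega>. emeasure (law Z (coord Z (T \<omega>) \<omega>)) (cyl I B) * indicator \<Gamma> \<omega> \<partial>law Z x))"
  using assms
proof (induction "card I" arbitrary: I B rule: less_induct)
  case less
  show ?case
  proof (cases "I = {}")
    case True
    have 1: "emeasure (law Z y) (cyl {} B) = 1" for y
      using prob_space.emeasure_space_1[OF prob_law, of y] by (simp add: cyl_def)
    have "emeasure (law Z x) \<Gamma> = (\<integral>\<^sup>+ \<omega>. indicator \<Gamma> \<omega> \<partial>law Z x)"
      if "stopping_time (filt Z) T" "\<Gamma> \<in> sets (pre_sigma T)" for T \<Gamma> x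
      using pre_sigma_events[OF that(1)] that(2) by (subst nn_integral_indicator) auto
    then show ?thesis using True by (simp add: 1 del: nn_integral_indicator)
  next
    case False
    define r where "r = Min I"
    define I' where "I' = (\<lambda>i. i - r) ` (I - {r})"
    define B' where "B' = (\<lambda>j. B (r + j))"
    have rI: "r \<in> I" using False less.prems by (simp add: r_def)
    have r_le: "i \<in> I \<Longrightarrow> r + (i - r) = i" for i
      using less.prems by (simp add: r_def add_diff_inverse_ennreal)
    have I'_iff: "(\<forall>i\<in>I. P i) \<longleftrightarrow> P r \<and> (\<forall>j\<in>I'. P (r + j))" for P
    proof -
      have "(\<forall>j\<in>I'. P (r + j)) \<longleftrightarrow> (\<forall>i\<in>I - {r}. P (r + (i - r)))" by (simp add: I'_def)
      also have "\<dots> \<longleftrightarrow> (\<forall>i\<in>I - {r}. P i)" by (intro ball_cong) (auto simp: r_le)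
      finally show ?thesis using rI by blast
    qed
    have fI': "finite I'" using less.prems by (simp add: I'_def)
    have "card I' \<le> card (I - {r})" unfolding I'_def using less.prems by (intro card_image_le) auto
    also have "\<dots> < card I" using less.prems rI by (intro psubset_card_mono) auto
    finally have cI': "card I' < card I" .
    have Br [measurable]: "B r \<in> sets cem_borel" using less.prems by simp
    define g where "g y = emeasure (law Z y) (cyl I' B')" for y
    have IH1 [measurable]: "g \<in> borel_measurable cem_borel"
      and IH2: "\<And>T \<Gamma> x. stopping_time (filt Z) T \<Longrightarrow> \<Gamma> \<in> sets (pre_sigma T) \<Longrightarrow>
      emeasure (law Z x) {\<omega>\<in>\<Gamma>. \<forall>i\<in>I'. coord Z (T \<omega> + i) \<omega> \<in> B' i} =
      (\<integral>\<^sup>+ \<omega>. g (coord Z (T \<omega>) \<omega>) * indicator \<Gamma> \<omega> \<partial>law Z x)"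
      using less.hyps[OF cI' fI', of B'] less.prems unfolding B'_def g_def by simp_all
    define h where "h y = indicator (B r) y * g y" for y
    have [measurable]: "h \<in> borel_measurable cem_borel" unfolding h_def by measurable
    have step: "emeasure (law Z x) {\<omega>\<in>\<Gamma>. \<forall>i\<in>I. coord Z (T \<omega> + i) \<omega> \<in> B i} =
      (\<integral>\<^sup>+ \<omega>. h (coord Z (T \<omega> + r) \<omega>) * indicator \<Gamma> \<omega> \<partial>law Z x)"
      if T: "stopping_time (filt Z) T" and \<Gamma>: "\<Gamma> \<in> sets (pre_sigma T)" for T \<Gamma> x
    proof -
      let ?S = "\<lambda>\<omega>. T \<omega> + r"
      have S: "stopping_time (filt Z) ?S" by (rule stopping_time_shift[OF T])
      have "\<Gamma> \<in> sets (pre_sigma ?S)" using mono_pre_sigma[OF T S] \<Gamma> by (auto simp: subset_eq)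
      moreover have "(\<lambda>\<omega>. coord Z (?S \<omega>) \<omega>) -` B r \<inter> space (pre_sigma ?S) \<in> sets (pre_sigma ?S)"
        by (rule measurable_sets[OF strong_markov_meas[OF S] Br])
      ultimately have "\<Gamma> \<inter> ((\<lambda>\<omega>. coord Z (?S \<omega>) \<omega>) -` B r \<inter> space (pre_sigma ?S)) \<in> sets (pre_sigma ?S)" by (rule sets.Int)
      moreover have \<Gamma>sub: "\<Gamma> \<subseteq> paths Z" using \<Gamma> sets.sets_into_space by (force simp: space_pre_sigma)
      moreover from \<Gamma>sub have "\<Gamma> \<inter> ((\<lambda>\<omega>. coord Z (?S \<omega>) \<omega>) -` B r \<inter> space (pre_sigma ?S)) =
        {\<omega>\<in>\<Gamma>. coord Z (?S \<omega>) \<omega> \<in> B r}" by (auto simp: space_pre_sigma)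
      ultimately have *: "{\<omega>\<in>\<Gamma>. coord Z (?S \<omega>) \<omega> \<in> B r} \<in> sets (pre_sigma ?S)" by simp
      have "{\<omega>\<in>\<Gamma>. \<forall>i\<in>I. coord Z (T \<omega> + i) \<omega> \<in> B i} =
         {\<omega>\<in>{\<omega>\<in>\<Gamma>. coord Z (?S \<omega>) \<omega> \<in> B r}. \<forall>j\<in>I'. coord Z (?S \<omega> + j) \<omega> \<in> B' j}"
        by (auto simp: I'_iff B'_def add.assoc)
      then have "emeasure (law Z x) {\<omega>\<in>\<Gamma>. \<forall>i\<in>I. coord Z (T \<omega> + i) \<omega> \<in> B i}
        = (\<integral>\<^sup>+ \<omega>. g (coord Z (?S \<omega>) \<omega>) * indicator {\<omega>\<in>\<Gamma>. coord Z (?S \<omega>) \<omega> \<in> B r} \<omega> \<partial>law Z x)"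
        using IH2[OF S *] by simp
      also have "\<dots> = (\<integral>\<^sup>+ \<omega>. h (coord Z (?S \<omega>) \<omega>) * indicator \<Gamma> \<omega> \<partial>law Z x)"
        by (intro nn_integral_cong) (auto simp: h_def split: split_indicator)
      finally show ?thesis .
    qed
    have c: "emeasure (law Z y) (cyl I B) = (\<integral>\<^sup>+ \<omega>. h (coord Z r \<omega>) \<partial>law Z y)" for y
    proof -
      have "paths Z \<in> sets (pre_sigma (\<lambda>_. 0))"
        using sets.top[of "pre_sigma (\<lambda>_. 0)"] by (simp add: space_pre_sigma)
      from step[OF stopping_time_const this, of y]
      have "emeasure (law Z y) (cyl I B) = (\<integral>\<^sup>+ \<omega>. h (coord Z r \<omega>) * indicator (paths Z) \<omega> \<partial>law Z y)"
        by (simp add: cyl_def)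
      also have "\<dots> = (\<integral>\<^sup>+ \<omega>. h (coord Z r \<omega>) \<partial>law Z y)"
        by (intro nn_integral_cong) auto
      finally show ?thesis .
    qed
    show ?thesis
    proof (intro conjI allI impI)
      show "(\<lambda>y. emeasure (law Z y) (cyl I B)) \<in> borel_measurable cem_borel"
        unfolding c by (rule law_fun_measurable) simp
      show "emeasure (law Z x) {\<omega>\<in>\<Gamma>. \<forall>i\<in>I. coord Z (T \<omega> + i) \<omega> \<in> B i} =
      (\<integral>\<^sup>+ \<omega>. emeasure (law Z (coord Z (T \<omega>) \<omega>)) (cyl I B) * indicator \<Gamma> \<omega> \<partial>law Z x)"
        if T: "stopping_time (filt Z) T" and \<Gamma>: "\<Gamma> \<in> sets (pre_sigma T)" for T \<Gamma> x
        unfolding c step[OF T \<Gamma>] by (rule strong_markov_fun[OF T \<Gamma>]) simp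
    qed
  qed
qed

definition cyls :: "'w set set" where
  "cyls = {cyl I B | I B. finite I \<and> (\<forall>i. B i \<in> sets cem_borel)}"

lemma cyls_Pow: "cyls \<subseteq> Pow (paths Z)"
  by (auto simp: cyls_def cyl_def)

lemma Int_stable_cyls: "Int_stable cyls"
proof (rule Int_stableI)
  fix a b assume "a \<in> cyls" "b \<in> cyls"
  then obtain I B J C where a: "a = cyl I B" "finite I" "\<And>i. B i \<in> sets cem_borel"
    and b: "b = cyl J C" "finite J" "\<And>i. C i \<in> sets cem_borel" by (auto simp: cyls_def)
  let ?D = "\<lambda>i. (if i \<in> I then B i else UNIV) \<inter> (if i \<in> J then C i else UNIV)"
  have "a \<inter> b = cyl (I \<union> J) ?D" by (auto simp: a b cyl_def)
  moreover have "?D i \<in> sets cem_borel" for i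
    using a b sets.top[of "cem_borel :: 'a option measure"] by auto
  ultimately show "a \<inter> b \<in> cyls" using a b unfolding cyls_def by blast
qed

lemma cyl_in_nat_filt: "finite I \<Longrightarrow> (\<And>i. B i \<in> sets cem_borel) \<Longrightarrow> cyl I B \<in> sets (nat_filt Z top)"
proof (induction I rule: finite_induct)
  case empty then show ?case using sets.top[of "nat_filt Z top"] by (simp add: cyl_def)
next
  case (insert i I)
  have "cyl (insert i I) B = (coord Z i -` B i \<inter> space (nat_filt Z top)) \<inter> cyl I B"
    by (auto simp: cyl_def)
  moreover have "coord Z i -` B i \<inter> space (nat_filt Z top) \<in> sets (nat_filt Z top)"
    by (rule measurable_sets[OF coord_nat_filt_top insert.prems])
  ultimately show ?case using insert by auto
qed

lemma sets_nat_filt_cyls: "sets (nat_filt Z top) = sigma_sets (paths Z) cyls"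
proof (rule equalityI)
  show "sets (nat_filt Z top) \<subseteq> sigma_sets (paths Z) cyls"
    unfolding sets_nat_filt
  proof (rule sigma_sets_mono, safe)
    fix s B assume B: "B \<in> sets (cem_borel :: 'a option measure)"
    have "coord Z s -` B \<inter> paths Z = cyl {s} (\<lambda>_. B)" by (auto simp: cyl_def)
    then have "coord Z s -` B \<inter> paths Z \<in> cyls" unfolding cyls_def using B by blast
    then show "coord Z s -` B \<inter> paths Z \<in> sigma_sets (paths Z) cyls" by blast
  qed
next
  have "cyls \<subseteq> sets (nat_filt Z top)" by (auto simp: cyls_def intro: cyl_in_nat_filt)
  from sets.sigma_sets_subset[OF this] show "sigma_sets (paths Z) cyls \<subseteq> sets (nat_filt Z top)" by simp
qed

lemma paths_in_cyls: "paths Z \<in> cyls"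
proof -
  have "paths Z = cyl {} (\<lambda>_. UNIV)" by (simp add: cyl_def)
  moreover have "UNIV \<in> sets (cem_borel :: 'a option measure)" 
    using sets.top[of "cem_borel :: 'a option measure"] by simp
  ultimately show ?thesis unfolding cyls_def by blast
qed

text \<open>P_y cut down to the coordinate sigma-algebra. On \<open>events\<close>, which may be
  larger, y \<mapsto> P_y(\<Lambda>) is not assumed to be measurable.\<close>

definition path_kernel :: "'a option \<Rightarrow> 'w measure" where
  "path_kernel y = distr (law Z y) (nat_filt Z top) (\<lambda>\<omega>. \<omega>)"

lemma measurable_id_nat_filt: "(\<lambda>\<omega>. \<omega>) \<in> law Z y \<rightarrow>\<^sub>M nat_filt Z top"
  using nat_filt_sub_events[of top] by (intro measurableI) auto

lemma sets_path_kernel [simp, measurable_cong]: "sets (path_kernel y) = sets (nat_filt Z top)"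
  by (simp add: path_kernel_def)

lemma emeasure_path_kernel: "S \<in> sets (nat_filt Z top) \<Longrightarrow> emeasure (path_kernel y) S = emeasure (law Z y) S"
  unfolding path_kernel_def using sets.sets_into_space[of S "nat_filt Z top"]
  by (subst emeasure_distr[OF measurable_id_nat_filt]) (auto simp: Int_absorb2)

lemma path_kernel_measurable [measurable]: "path_kernel \<in> cem_borel \<rightarrow>\<^sub>M subprob_algebra (nat_filt Z top)"
proof (rule measurable_subprob_algebra_generated[OF sets_nat_filt_cyls Int_stable_cyls cyls_Pow])
  show "subprob_space (path_kernel y)" for y unfolding path_kernel_def
    by (rule prob_space_imp_subprob_space[OF prob_space.prob_space_distr[OF prob_law measurable_id_nat_filt]])
  show cy: "(\<lambda>y. emeasure (path_kernel y) A) \<in> borel_measurable cem_borel" if "A \<in> cyls" for A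
  proof -
    from that obtain I B where A: "A = cyl I B" "finite I" "\<And>i. B i \<in> sets cem_borel" by (auto simp: cyls_def)
    then have "emeasure (path_kernel y) A = emeasure (law Z y) A" for y
      by (simp add: emeasure_path_kernel cyl_in_nat_filt)
    then show ?thesis using cylinder_markov[of I B] A by simp
  qed
  show "(\<lambda>y. emeasure (path_kernel y) (paths Z)) \<in> borel_measurable cem_borel"
    by (rule cy[OF paths_in_cyls])
qed simp

text \<open>\<open>measure_of\<close> returns the intended values only if the set function is
  countably additive. The identification with a bind supplies this, together with the integral
  formula.\<close>

lemma law_from_eq_bind:
  assumes \<nu>: "initial_law \<nu>"
  shows "law_from Z \<nu> = \<nu> \<bind> path_kernel"
proof -
  have s\<nu>: "sets \<nu> = sets cem_borel" using \<nu> by (simp add: initial_law_def)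
  then have sp\<nu>: "space \<nu> \<noteq> {}" by (simp add: sets_eq_imp_space_eq[OF s\<nu>])
  have [measurable]: "path_kernel \<in> \<nu> \<rightarrow>\<^sub>M subprob_algebra (nat_filt Z top)"
    using path_kernel_measurable by (simp add: s\<nu> cong: measurable_cong_sets)
  have sb: "sets (\<nu> \<bind> path_kernel) = sets (nat_filt Z top)"
    by (rule sets_bind) (use sp\<nu> in auto)
  have spb: "space (\<nu> \<bind> path_kernel) = paths Z"
    using sets_eq_imp_space_eq[OF sb] by simp
  have "law_from Z \<nu> = measure_of (paths Z) (sets (nat_filt Z top)) (emeasure (\<nu> \<bind> path_kernel))"
    unfolding law_from_def infinity_ennreal_def
  proof (rule measure_of_eq)
    show "sets (nat_filt Z top) \<subseteq> Pow (paths Z)" using sets.space_closed[of "nat_filt Z top"] by simp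
    fix S assume "S \<in> sigma_sets (paths Z) (sets (nat_filt Z top))"
    then have S: "S \<in> sets (nat_filt Z top)" using sets.sigma_sets_eq[of "nat_filt Z top"] by simp
    show "(\<integral>\<^sup>+ x. emeasure (law Z x) S \<partial>\<nu>) = emeasure (\<nu> \<bind> path_kernel) S"
      using S sp\<nu> by (subst emeasure_bind[where N = "nat_filt Z top"]) (auto simp: emeasure_path_kernel)
  qed
  also have "\<dots> = \<nu> \<bind> path_kernel"
    using measure_of_of_measure[of "\<nu> \<bind> path_kernel"] by (simp add: sb spb)
  finally show ?thesis .
qed

lemma sets_law_from [simp, measurable_cong]: "sets (law_from Z \<nu>) = sets (nat_filt Z top)"
  unfolding law_from_def infinity_ennreal_def using sets.sigma_sets_eq[of "nat_filt Z top"] sets.space_closed[of "nat_filt Z top"] 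
  by (simp add: sets_measure_of)

lemma space_law_from [simp]: "space (law_from Z \<nu>) = paths Z"
  using sets_eq_imp_space_eq[OF sets_law_from] by simp

lemma path_kernel_measurable':
  "initial_law \<nu> \<Longrightarrow> path_kernel \<in> \<nu> \<rightarrow>\<^sub>M subprob_algebra (nat_filt Z top)"
  using path_kernel_measurable unfolding initial_law_def by (simp cong: measurable_cong_sets)

lemma nn_integral_path_kernel:
  "f \<in> borel_measurable (nat_filt Z top) \<Longrightarrow> (\<integral>\<^sup>+ \<omega>. f \<omega> \<partial>path_kernel y) = (\<integral>\<^sup>+ \<omega>. f \<omega> \<partial>law Z y)"
  unfolding path_kernel_def by (subst nn_integral_distr[OF measurable_id_nat_filt]) auto

lemma nn_integral_law_from:
  assumes \<nu>: "initial_law \<nu>" and f: "f \<in> borel_measurable (nat_filt Z top)"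
  shows "(\<integral>\<^sup>+ \<omega>. f \<omega> \<partial>law_from Z \<nu>) = (\<integral>\<^sup>+ y. (\<integral>\<^sup>+ \<omega>. f \<omega> \<partial>law Z y) \<partial>\<nu>)"
  unfolding law_from_eq_bind[OF \<nu>]
  by (subst nn_integral_bind[OF f path_kernel_measurable'[OF \<nu>]]) (simp add: nn_integral_path_kernel[OF f])

lemma law_nn_integral_measurable:
  assumes f [measurable]: "f \<in> borel_measurable (nat_filt Z top)"
  shows "(\<lambda>y. \<integral>\<^sup>+ \<omega>. f \<omega> \<partial>law Z y) \<in> borel_measurable cem_borel"
proof -
  have "(\<lambda>y. \<integral>\<^sup>+ \<omega>. f \<omega> \<partial>path_kernel y) \<in> borel_measurable cem_borel" by measurable
  then show ?thesis by (simp add: nn_integral_path_kernel)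
qed

lemma AE_law_from:
  assumes \<nu>: "initial_law \<nu>" and ae: "AE \<omega> in law_from Z \<nu>. P \<omega>"
  shows "AE y in \<nu>. AE \<omega> in law Z y. P \<omega>"
proof -
  from ae obtain N where N: "N \<in> sets (nat_filt Z top)" "emeasure (law_from Z \<nu>) N = 0" "{\<omega>\<in>paths Z. \<not> P \<omega>} \<subseteq> N"
    by (auto elim!: AE_E)
  have "(\<integral>\<^sup>+ y. (\<integral>\<^sup>+ \<omega>. indicator N \<omega> \<partial>law Z y) \<partial>\<nu>) = (\<integral>\<^sup>+ \<omega>. indicator N \<omega> \<partial>law_from Z \<nu>)"
    using N(1) by (subst nn_integral_law_from[OF \<nu>, of "indicator N"]) simp_all
  also have "\<dots> = 0" using N by simp
  finally have 0: "(\<integral>\<^sup>+ y. (\<integral>\<^sup>+ \<omega>. indicator N \<omega> \<partial>law Z y) \<partial>\<nu>) = 0" .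
  have "(\<lambda>y. (\<integral>\<^sup>+ \<omega>. indicator N \<omega> \<partial>law Z y)) \<in> borel_measurable \<nu>"
    using law_nn_integral_measurable[of "indicator N"] N \<nu>
    by (simp add: initial_law_def cong: measurable_cong_sets)
  from nn_integral_0_iff_AE[OF this] 0 have "AE y in \<nu>. (\<integral>\<^sup>+ \<omega>. indicator N \<omega> \<partial>law Z y) = 0" by simp
  then show ?thesis
  proof eventually_elim
    fix y assume "(\<integral>\<^sup>+ \<omega>. indicator N \<omega> \<partial>law Z y) = 0"
    then have "emeasure (law Z y) N = 0" using N nat_filt_sub_events[of top] by (subst (asm) nn_integral_indicator) auto
    then show "AE \<omega> in law Z y. P \<omega>" using N nat_filt_sub_events[of top] by (intro AE_I[where N = N]) auto
  qed
qed

lemma sets_part_law [simp, measurable_cong]: "sets (part_law T \<Gamma> x) = sets cem_borel"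
  by (simp add: part_law_def)

lemma initial_law_part_law:
  assumes T: "stopping_time (filt Z) T" and \<Gamma>: "\<Gamma> \<in> sets (pre_sigma T)"
  shows "initial_law (part_law T \<Gamma> x)"
proof -
  have "emeasure (part_law T \<Gamma> x) (space (part_law T \<Gamma> x)) = (\<integral>\<^sup>+ y. 1 \<partial>part_law T \<Gamma> x)" by simp
  also have "\<dots> = (\<integral>\<^sup>+ \<omega>. 1 * indicator \<Gamma> \<omega> \<partial>law Z x)"
    by (rule nn_integral_part_law[OF T \<Gamma>, of "\<lambda>_. 1"]) simp
  also have "\<dots> \<le> (\<integral>\<^sup>+ \<omega>. 1 \<partial>law Z x)" by (intro nn_integral_mono) (auto split: split_indicator)
  also have "\<dots> = 1" using prob_space.emeasure_space_1[OF prob_law] by simp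
  finally have "finite_measure (part_law T \<Gamma> x)" by (intro finite_measureI) (auto simp: top_unique)
  then show ?thesis by (simp add: initial_law_def)
qed

text \<open>The strong Markov property in distribution form: after T the path behaves as a fresh one
  whose initial law is that of X_T on \<Gamma>. Both sides are finite and agree on the cylinders, an
  intersection-stable generator.\<close>

lemma shift_law:
  assumes T: "stopping_time (filt Z) T" and \<Gamma>: "\<Gamma> \<in> sets (pre_sigma T)"
  shows "distr (density (law Z x) (indicator \<Gamma>)) (nat_filt Z top) (\<lambda>\<omega>. shift Z (T \<omega>) \<omega>) = law_from Z (part_law T \<Gamma> x)"
    (is "?L = ?R")
proof (rule measure_eqI_generator_eq[OF Int_stable_cyls cyls_Pow, where A = "\<lambda>_. paths Z"])
  have \<Gamma>e [measurable]: "\<Gamma> \<in> sets (events Z)" using pre_sigma_events[OF T] \<Gamma> by blast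
  note [measurable] = shift_measurable[OF T]
  have il: "initial_law (part_law T \<Gamma> x)" by (rule initial_law_part_law[OF T \<Gamma>])
  show *: "emeasure ?L X = emeasure ?R X" if "X \<in> cyls" for X
  proof -
    from that obtain I B where X: "X = cyl I B" "finite I" "\<And>i. B i \<in> sets cem_borel" by (auto simp: cyls_def)
    have Xm [measurable]: "X \<in> sets (nat_filt Z top)" using X by (simp add: cyl_in_nat_filt)
    have \<Gamma>sub: "\<Gamma> \<subseteq> paths Z" using sets.sets_into_space[OF \<Gamma>e] by simp
    have eq: "{\<omega>\<in>\<Gamma>. \<forall>i\<in>I. coord Z (T \<omega> + i) \<omega> \<in> B i} = \<Gamma> \<inter> ((\<lambda>\<omega>. shift Z (T \<omega>) \<omega>) -` X \<inter> space (events Z))"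
      using \<Gamma>sub by (auto simp: X cyl_def shift_paths coord_shift)
    have "emeasure ?L X = (\<integral>\<^sup>+ \<omega>. indicator (\<Gamma> \<inter> ((\<lambda>\<omega>. shift Z (T \<omega>) \<omega>) -` X \<inter> space (events Z))) \<omega> \<partial>law Z x)"
      apply (subst emeasure_distr, simp, simp)
      apply (subst emeasure_density, simp, simp)
      apply (intro nn_integral_cong) 
      apply (auto split: split_indicator)
      done
    also have "\<dots> = emeasure (law Z x) {\<omega>\<in>\<Gamma>. \<forall>i\<in>I. coord Z (T \<omega> + i) \<omega> \<in> B i}"
      unfolding eq by (rule nn_integral_indicator) measurable
    also have "\<dots> = (\<integral>\<^sup>+ \<omega>. emeasure (law Z (coord Z (T \<omega>) \<omega>)) X * indicator \<Gamma> \<omega> \<partial>law Z x)"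
      using cylinder_markov[of I B] X T \<Gamma> by simp
    also have "\<dots> = (\<integral>\<^sup>+ y. emeasure (law Z y) X \<partial>part_law T \<Gamma> x)"
      using cylinder_markov[of I B] X by (intro nn_integral_part_law[OF T \<Gamma>, symmetric]) auto
    also have "\<dots> = (\<integral>\<^sup>+ y. (\<integral>\<^sup>+ \<omega>. indicator X \<omega> \<partial>law Z y) \<partial>part_law T \<Gamma> x)"
      using Xm nat_filt_sub_events[of top] by (subst nn_integral_indicator) auto
    also have "\<dots> = (\<integral>\<^sup>+ \<omega>. indicator X \<omega> \<partial>?R)"
      by (rule nn_integral_law_from[OF il, symmetric]) simp
    also have "\<dots> = emeasure ?R X" by simp
    finally show ?thesis .
  qed
  show "emeasure ?L (paths Z) \<noteq> \<infinity>" for i :: nat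
  proof -
    have "emeasure ?R (paths Z) = (\<integral>\<^sup>+ \<omega>. 1 \<partial>?R)" by simp
    also have "\<dots> = (\<integral>\<^sup>+ y. (\<integral>\<^sup>+ \<omega>. 1 \<partial>law Z y) \<partial>part_law T \<Gamma> x)"
      by (rule nn_integral_law_from[OF il]) simp
    also have "\<dots> = emeasure (part_law T \<Gamma> x) (space (part_law T \<Gamma> x))"
      using prob_space.emeasure_space_1[OF prob_law] by simp
    also have "\<dots> \<noteq> \<infinity>" using il finite_measure.emeasure_finite unfolding initial_law_def infinity_ennreal_def by blast
    finally show ?thesis using *[OF paths_in_cyls] by simp
  qed
qed (auto simp: sets_nat_filt_cyls intro: paths_in_cyls)

section \<open>Functionals that are measurable after augmentation\<close>

lemma aug_filt_gen_Pow:
  "{\<Lambda>. \<forall>\<nu>. initial_law \<nu> \<longrightarrow>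
        (\<exists>\<Lambda>'\<in>sets (nat_filt Z t).
           (\<Lambda> - \<Lambda>') \<union> (\<Lambda>' - \<Lambda>) \<in> null_sets (completion (law_from Z \<nu>)))} \<subseteq> Pow (paths Z)"
proof (safe)
  fix \<Lambda> \<omega> assume *: "\<forall>\<nu>. initial_law \<nu> \<longrightarrow>
        (\<exists>\<Lambda>'\<in>sets (nat_filt Z t).
           (\<Lambda> - \<Lambda>') \<union> (\<Lambda>' - \<Lambda>) \<in> null_sets (completion (law_from Z \<nu>)))" and \<omega>: "\<omega> \<in> \<Lambda>"
  \<comment> \<open>Containment in \<open>paths Z\<close> is not written into the generators. It
    follows from their condition under any one initial law, since null sets of a completion lie in
    its space; the null measure serves as such a law.\<close>
  have "initial_law (null_measure (cem_borel :: 'a option measure))"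
    by (auto simp: initial_law_def intro!: finite_measureI)
  with * obtain \<Lambda>' where L: "\<Lambda>'\<in>sets (nat_filt Z t)" 
      "(\<Lambda> - \<Lambda>') \<union> (\<Lambda>' - \<Lambda>) \<in> null_sets (completion (law_from Z (null_measure cem_borel)))" by blast
  from L(2) have "(\<Lambda> - \<Lambda>') \<union> (\<Lambda>' - \<Lambda>) \<subseteq> paths Z"
    using sets.sets_into_space[of "(\<Lambda> - \<Lambda>') \<union> (\<Lambda>' - \<Lambda>)" "completion (law_from Z (null_measure cem_borel))"] by auto
  moreover have "\<Lambda>' \<subseteq> paths Z" using sets.sets_into_space[OF L(1)] by simp
  ultimately show "\<omega> \<in> paths Z" using \<omega> by blast
qed

lemma space_aug_filt [simp]: "space (aug_filt Z t) = paths Z"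
  unfolding aug_filt_def by (simp add: space_measure_of_conv)

lemma sets_aug_filt:
  "sets (aug_filt Z t) = sigma_sets (paths Z) {\<Lambda>. \<forall>\<nu>. initial_law \<nu> \<longrightarrow>
        (\<exists>\<Lambda>'\<in>sets (nat_filt Z t).
           (\<Lambda> - \<Lambda>') \<union> (\<Lambda>' - \<Lambda>) \<in> null_sets (completion (law_from Z \<nu>)))}"
  unfolding aug_filt_def by (rule sets_measure_of[OF aug_filt_gen_Pow])

lemma aug_filtI:
  "(\<And>\<nu>. initial_law \<nu> \<Longrightarrow> (\<exists>\<Lambda>'\<in>sets (nat_filt Z t).
           (\<Lambda> - \<Lambda>') \<union> (\<Lambda>' - \<Lambda>) \<in> null_sets (completion (law_from Z \<nu>)))) \<Longrightarrow> \<Lambda> \<in> sets (aug_filt Z t)"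
  unfolding sets_aug_filt by (rule sigma_sets.Basic) blast

lemma nat_filt_mono: "s \<le> t \<Longrightarrow> sets (nat_filt Z s) \<subseteq> sets (nat_filt Z t)"
  unfolding sets_nat_filt by (rule sigma_sets_mono') (blast intro: order_trans)

lemma aug_filt_mono: "s \<le> t \<Longrightarrow> sets (aug_filt Z s) \<subseteq> sets (aug_filt Z t)"
  unfolding sets_aug_filt using nat_filt_mono[of s t] by (intro sigma_sets_mono') blast

lemma nat_filt_sub_aug_filt: "sets (nat_filt Z t) \<subseteq> sets (aug_filt Z t)"
proof
  fix S assume "S \<in> sets (nat_filt Z t)"
  then show "S \<in> sets (aug_filt Z t)" by (intro aug_filtI bexI[of _ S]) auto
qed

lemma aug_filt_completion:
  assumes "initial_law \<nu>" shows "sets (aug_filt Z t) \<subseteq> sets (completion (law_from Z \<nu>))"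
proof -
  let ?C = "completion (law_from Z \<nu>)"
  have "{\<Lambda>. \<forall>\<nu>. initial_law \<nu> \<longrightarrow>
        (\<exists>\<Lambda>'\<in>sets (nat_filt Z t).
           (\<Lambda> - \<Lambda>') \<union> (\<Lambda>' - \<Lambda>) \<in> null_sets (completion (law_from Z \<nu>)))} \<subseteq> sets ?C"
  proof
    fix \<Lambda> assume "\<Lambda> \<in> {\<Lambda>. \<forall>\<nu>. initial_law \<nu> \<longrightarrow>
        (\<exists>\<Lambda>'\<in>sets (nat_filt Z t).
           (\<Lambda> - \<Lambda>') \<union> (\<Lambda>' - \<Lambda>) \<in> null_sets (completion (law_from Z \<nu>)))}"
    then obtain \<Lambda>' where L: "\<Lambda>' \<in> sets (nat_filt Z t)" "(\<Lambda> - \<Lambda>') \<union> (\<Lambda>' - \<Lambda>) \<in> null_sets ?C"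
      using assms by blast
    have 1: "\<Lambda>' \<in> sets ?C" using L(1) nat_filt_mono[of t top] by (intro sets_completionI_sets) auto
    have "\<Lambda> - \<Lambda>' \<in> null_sets ?C" "\<Lambda>' - \<Lambda> \<in> null_sets ?C"
      by (rule null_sets_completion_subset[OF _ L(2)]; blast)+
    note this[THEN null_setsD2]
    moreover have "\<Lambda> = (\<Lambda>' - (\<Lambda>' - \<Lambda>)) \<union> (\<Lambda> - \<Lambda>')" by auto
    ultimately show "\<Lambda> \<in> sets ?C" using 1 by (metis sets.Diff sets.Un)
  qed
  from sets.sigma_sets_subset[OF this] show ?thesis by (simp add: sets_aug_filt)
qed

lemma measurable_aug_filt_events: "f \<in> aug_filt Z t \<rightarrow>\<^sub>M N \<Longrightarrow> f \<in> events Z \<rightarrow>\<^sub>M N"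
  by (rule measurable_sub_algebra[OF _ _ order_trans[OF aug_filt_sub_filt[of t] filt_events[of t]]]) simp_all

lemma aug_functional_approx:
  fixes \<Phi> :: "'w \<Rightarrow> ennreal"
  assumes \<nu>: "initial_law \<nu>" and \<Phi>: "\<Phi> \<in> borel_measurable (aug_filt Z top)"
  obtains \<Phi>' where "\<Phi>' \<in> borel_measurable (nat_filt Z top)" "AE \<omega> in law_from Z \<nu>. \<Phi> \<omega> = \<Phi>' \<omega>"
proof -
  have "\<Phi> \<in> borel_measurable (completion (law_from Z \<nu>))"
    using measurable_sub_algebra[OF \<Phi> _ aug_filt_completion[OF \<nu>]] by simp
  from completion_ex_borel_measurable[OF this] obtain \<Phi>' where
    "\<Phi>' \<in> borel_measurable (law_from Z \<nu>)" "AE \<omega> in law_from Z \<nu>. \<Phi> \<omega> = \<Phi>' \<omega>" by blast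
  then show ?thesis by (intro that) (simp_all cong: measurable_cong_sets)
qed

text \<open>With T, \<Gamma> and x fixed, \<Phi> is replaced by a coordinate-measurable \<Phi>' that
  agrees with it almost surely under the initial law \<open>part_law T \<Gamma> x\<close>; this
  suffices because the shifted path has exactly that law. Measurability of g is a separate
  hypothesis: for augmented \<Phi> the mean E_y[\<Phi>] need not be Borel in y.\<close>

theorem strong_markov_aug:
  fixes \<Phi> :: "'w \<Rightarrow> ennreal"
  assumes T: "stopping_time (filt Z) T" and \<Gamma>: "\<Gamma> \<in> sets (pre_sigma T)"
    and \<Phi>: "\<Phi> \<in> borel_measurable (aug_filt Z top)"
    and g: "g \<in> borel_measurable cem_borel" and g_eq: "\<And>y. g y = (\<integral>\<^sup>+ \<omega>. \<Phi> \<omega> \<partial>law Z y)"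
  shows "(\<integral>\<^sup>+ \<omega>. \<Phi> (shift Z (T \<omega>) \<omega>) * indicator \<Gamma> \<omega> \<partial>law Z x) =
    (\<integral>\<^sup>+ \<omega>. g (coord Z (T \<omega>) \<omega>) * indicator \<Gamma> \<omega> \<partial>law Z x)"
proof -
  let ?\<nu> = "part_law T \<Gamma> x"
  have \<Gamma>e [measurable]: "\<Gamma> \<in> sets (events Z)" using pre_sigma_events[OF T] \<Gamma> by blast
  note [measurable] = shift_measurable[OF T]
  have il: "initial_law ?\<nu>" by (rule initial_law_part_law[OF T \<Gamma>])
  from aug_functional_approx[OF il \<Phi>] obtain \<Phi>' :: "'w \<Rightarrow> ennreal" where
    \<Phi>' [measurable]: "\<Phi>' \<in> borel_measurable (nat_filt Z top)" and ae: "AE \<omega> in law_from Z ?\<nu>. \<Phi> \<omega> = \<Phi>' \<omega>" .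
  let ?M = "density (law Z x) (indicator \<Gamma>)"
  have "AE \<omega> in distr ?M (nat_filt Z top) (\<lambda>\<omega>. shift Z (T \<omega>) \<omega>). \<Phi> \<omega> = \<Phi>' \<omega>"
    using ae unfolding shift_law[OF T \<Gamma>] .
  then have "AE \<omega> in ?M. \<Phi> (shift Z (T \<omega>) \<omega>) = \<Phi>' (shift Z (T \<omega>) \<omega>)"
    by (rule AE_distrD[rotated]) simp
  then have ae1: "AE \<omega> in law Z x. \<omega> \<in> \<Gamma> \<longrightarrow> \<Phi> (shift Z (T \<omega>) \<omega>) = \<Phi>' (shift Z (T \<omega>) \<omega>)"
    by (subst (asm) AE_density) (auto simp: indicator_def split: if_splits)
  have ae2: "AE y in ?\<nu>. g y = (\<integral>\<^sup>+ \<omega>. \<Phi>' \<omega> \<partial>law Z y)"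
    using AE_law_from[OF il ae] unfolding g_eq
    by (rule AE_mp) (auto intro!: AE_I2 nn_integral_cong_AE)
  have "(\<integral>\<^sup>+ \<omega>. \<Phi> (shift Z (T \<omega>) \<omega>) * indicator \<Gamma> \<omega> \<partial>law Z x) = (\<integral>\<^sup>+ \<omega>. \<Phi>' (shift Z (T \<omega>) \<omega>) * indicator \<Gamma> \<omega> \<partial>law Z x)"
    using ae1 by (intro nn_integral_cong_AE) (auto elim!: AE_mp simp: indicator_def)
  also have "\<dots> = (\<integral>\<^sup>+ \<omega>. \<Phi>' \<omega> \<partial>law_from Z ?\<nu>)"
    unfolding shift_law[OF T \<Gamma>, symmetric]
    apply (subst nn_integral_distr, simp, simp)
    apply (subst nn_integral_density, simp, simp)
    apply (simp add: mult.commute)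
    done
  also have "\<dots> = (\<integral>\<^sup>+ y. g y \<partial>?\<nu>)"
    unfolding nn_integral_law_from[OF il \<Phi>'] using ae2 by (intro nn_integral_cong_AE) (auto elim!: AE_mp)
  also have "\<dots> = (\<integral>\<^sup>+ \<omega>. g (coord Z (T \<omega>) \<omega>) * indicator \<Gamma> \<omega> \<partial>law Z x)"
    by (rule nn_integral_part_law[OF T \<Gamma> g])
  finally show ?thesis .
qed

lemma paths_pre_sigma: "paths Z \<in> sets (pre_sigma T)"
  using sets.top[of "pre_sigma T"] by (simp add: space_pre_sigma)

text \<open>P_y(S) is not known to be Borel in y and cannot be integrated over \<nu> directly. A
  coordinate-measurable version of the indicator of S under P_\<nu> can, and its P_y-mean vanishes
  for \<nu>-almost every y.\<close>

lemma AE_law_fromI: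
  assumes il: "initial_law \<nu>" and S: "S \<in> sets (aug_filt Z top)"
    and ae: "\<And>y. AE \<omega> in law Z y. \<omega> \<notin> S"
  shows "AE \<omega> in law_from Z \<nu>. \<omega> \<notin> S"
proof -
  have "(indicator S :: 'w \<Rightarrow> ennreal) \<in> borel_measurable (aug_filt Z top)" using S by simp
  from aug_functional_approx[OF il this] obtain \<Phi>' :: "'w \<Rightarrow> ennreal" where
    \<Phi>' [measurable]: "\<Phi>' \<in> borel_measurable (nat_filt Z top)" and ae': "AE \<omega> in law_from Z \<nu>. indicator S \<omega> = \<Phi>' \<omega>" .
  have "(\<integral>\<^sup>+ \<omega>. \<Phi>' \<omega> \<partial>law_from Z \<nu>) = (\<integral>\<^sup>+ y. (\<integral>\<^sup>+ \<omega>. \<Phi>' \<omega> \<partial>law Z y) \<partial>\<nu>)"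
    by (rule nn_integral_law_from[OF il]) simp
  also have "\<dots> = (\<integral>\<^sup>+ y. 0 \<partial>\<nu>)"
  proof (rule nn_integral_cong_AE, rule AE_mp[OF AE_law_from[OF il ae']], intro AE_I2 impI)
    fix y assume "AE \<omega> in law Z y. indicator S \<omega> = \<Phi>' \<omega>"
    with ae[of y] have "AE \<omega> in law Z y. \<Phi>' \<omega> = 0" by eventually_elim (auto simp: indicator_def)
    then show "(\<integral>\<^sup>+ \<omega>. \<Phi>' \<omega> \<partial>law Z y) = 0"
      by (subst nn_integral_0_iff_AE) (use measurable_nat_filt_events[OF \<Phi>'] in \<open>simp_all cong: measurable_cong_sets\<close>)
  qed
  finally have "(\<integral>\<^sup>+ \<omega>. \<Phi>' \<omega> \<partial>law_from Z \<nu>) = 0" by simp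
  then have "AE \<omega> in law_from Z \<nu>. \<Phi>' \<omega> = 0" by (subst (asm) nn_integral_0_iff_AE) simp_all
  with ae' show ?thesis by eventually_elim (auto simp: indicator_def)
qed

lemma strong_markov_AE:
  assumes T: "stopping_time (filt Z) T" and S: "S \<in> sets (aug_filt Z top)"
    and ae: "\<And>y. AE \<omega> in law Z y. \<omega> \<notin> S"
  shows "AE \<omega> in law Z x. shift Z (T \<omega>) \<omega> \<notin> S"
proof -
  note \<Gamma> = paths_pre_sigma[of T]
  have "AE \<omega> in distr (density (law Z x) (indicator (paths Z))) (nat_filt Z top) (\<lambda>\<omega>. shift Z (T \<omega>) \<omega>). \<omega> \<notin> S"
    unfolding shift_law[OF T \<Gamma>] by (rule AE_law_fromI[OF initial_law_part_law[OF T \<Gamma>] S ae])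
  then have "AE \<omega> in density (law Z x) (indicator (paths Z)). shift Z (T \<omega>) \<omega> \<notin> S"
    by (rule AE_distrD[rotated]) (use shift_measurable[OF T] in simp)
  then have "AE \<omega> in law Z x. 0 < (indicator (paths Z) \<omega> :: ennreal) \<longrightarrow> shift Z (T \<omega>) \<omega> \<notin> S"
    by (subst (asm) AE_density) simp_all
  moreover have "AE \<omega> in law Z x. \<omega> \<in> paths Z" using AE_space[of "law Z x"] by simp
  ultimately show ?thesis by eventually_elim simp
qed

text \<open>Information about the path after T is carried back to the position at T. This will turn
  the pathwise equality of Y_0 and X_0 after a shift by \<tau>_t into a property of the points
  Y_t.\<close>

lemma strong_markov_AE_converse:
  assumes T: "stopping_time (filt Z) T" and S: "S \<in> sets (aug_filt Z top)"
    and ae: "AE \<omega> in law Z x. shift Z (T \<omega>) \<omega> \<notin> S"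
  shows "AE y in part_law T (paths Z) x. AE \<omega> in law Z y. \<omega> \<notin> S"
proof -
  let ?\<nu> = "part_law T (paths Z) x"
  note \<Gamma> = paths_pre_sigma[of T]
  note [measurable] = shift_measurable[OF T]
  have il: "initial_law ?\<nu>" by (rule initial_law_part_law[OF T \<Gamma>])
  have "(indicator S :: 'w \<Rightarrow> ennreal) \<in> borel_measurable (aug_filt Z top)" using S by simp
  from aug_functional_approx[OF il this] obtain \<Phi>' :: "'w \<Rightarrow> ennreal" where
    \<Phi>' [measurable]: "\<Phi>' \<in> borel_measurable (nat_filt Z top)" and ae': "AE \<omega> in law_from Z ?\<nu>. indicator S \<omega> = \<Phi>' \<omega>" .
  let ?M = "density (law Z x) (indicator (paths Z))"
  have [measurable]: "paths Z \<in> sets (events Z)" by simp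
  have "AE \<omega> in distr ?M (nat_filt Z top) (\<lambda>\<omega>. shift Z (T \<omega>) \<omega>). indicator S \<omega> = \<Phi>' \<omega>"
    using ae' unfolding shift_law[OF T \<Gamma>] .
  then have "AE \<omega> in ?M. indicator S (shift Z (T \<omega>) \<omega>) = \<Phi>' (shift Z (T \<omega>) \<omega>)"
    by (rule AE_distrD[rotated]) simp
  moreover have "AE \<omega> in ?M. shift Z (T \<omega>) \<omega> \<notin> S"
    using ae by (subst AE_density) (auto elim!: AE_mp)
  ultimately have "AE \<omega> in ?M. \<Phi>' (shift Z (T \<omega>) \<omega>) = 0"
    by eventually_elim auto
  then have "AE \<omega> in distr ?M (nat_filt Z top) (\<lambda>\<omega>. shift Z (T \<omega>) \<omega>). \<Phi>' \<omega> = 0"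
    by (subst AE_distr_iff) (use borel_measurable_eq[OF \<Phi>' measurable_const[of 0]] in \<open>simp_all\<close>)
  then have "AE \<omega> in law_from Z ?\<nu>. \<Phi>' \<omega> = 0" unfolding shift_law[OF T \<Gamma>] .
  with ae' have "AE \<omega> in law_from Z ?\<nu>. \<omega> \<notin> S" by eventually_elim (auto simp: indicator_def split: if_splits)
  then show ?thesis by (rule AE_law_from[OF il])
qed

lemma AE_part_law_iff:
  assumes T: "stopping_time (filt Z) T" and P: "{y. P y} \<in> sets cem_borel"
  shows "(AE y in part_law T (paths Z) x. P y) \<longleftrightarrow> (AE \<omega> in law Z x. P (coord Z (T \<omega>) \<omega>))"
proof -
  note [measurable] = coord_stop_measurable[OF T]
  have [measurable]: "paths Z \<in> sets (events Z)" by simp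
  have "(AE y in part_law T (paths Z) x. P y) \<longleftrightarrow> (AE \<omega> in density (law Z x) (indicator (paths Z)). P (coord Z (T \<omega>) \<omega>))"
    unfolding part_law_def by (rule AE_distr_iff) (use P in auto)
  also have "\<dots> \<longleftrightarrow> (AE \<omega> in law Z x. P (coord Z (T \<omega>) \<omega>))"
    by (subst AE_density) (auto intro!: AE_cong)
  finally show ?thesis .
qed

text \<open>The set is compared with the empty set, which lies in \<open>nat_filt Z t\<close> for
  every t. So exceptional sets described by the whole path are available already at time 0.\<close>

lemma null_sub_aug_filt:
  assumes N: "N \<in> sets (aug_filt Z top)" and ae: "\<And>y. AE \<omega> in law Z y. \<omega> \<notin> N" and sub: "N0 \<subseteq> N"
  shows "N0 \<in> sets (aug_filt Z t)"
proof (rule aug_filtI)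
  fix \<nu> :: "'a option measure" assume il: "initial_law \<nu>"
  have "AE \<omega> in completion (law_from Z \<nu>). \<omega> \<notin> N" by (rule AE_completion[OF AE_law_fromI[OF il N ae]])
  moreover have "N \<in> sets (completion (law_from Z \<nu>))" using aug_filt_completion[OF il] N by blast
  ultimately have "N \<in> null_sets (completion (law_from Z \<nu>))"
    using AE_iff_null_sets by blast
  then have "N0 \<in> null_sets (completion (law_from Z \<nu>))" using sub by (rule null_sets_completion_subset[rotated])
  then show "\<exists>\<Lambda>'\<in>sets (nat_filt Z t). (N0 - \<Lambda>') \<union> (\<Lambda>' - N0) \<in> null_sets (completion (law_from Z \<nu>))"
    by (intro bexI[of _ "{}"]) auto
qed

section \<open>The time change\<close>

text \<open>Right continuity of the filtration: {T \<le> t} is the intersection of the sets {T < t +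
  e n}, and these lie in \<open>filt Z s\<close> for every s > t.\<close>

lemma stopping_timeI_less:
  assumes "\<And>t. t < top \<Longrightarrow> {\<omega>\<in>paths Z. T \<omega> < t} \<in> sets (filt Z t)"
  shows "stopping_time (filt Z) T"
proof (rule stopping_timeI)
  fix t
  show "Measurable.pred (filt Z t) (\<lambda>\<omega>. T \<omega> \<le> t)"
  proof (cases "t = top")
    case False
    then have t: "t < top" by (simp add: less_top)
    have "{\<omega>\<in>paths Z. T \<omega> \<le> t} \<in> sets (filt Z s)" if "t < s" for s
    proof -
      \<comment> \<open>Here s may be infinite. The finite u between t and s makes u - t a positive
        real number, which bounds all the e n.\<close>
      from t that obtain u where u: "t < u" "u < s" by (meson dense)
      obtain r :: real where r: "0 < r" "t + ennreal r \<le> u"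
      proof -
        have "u \<noteq> top" using u by auto
        have "0 < u - t" using u t by (simp add: diff_gr0_ennreal)
        moreover have "u - t < top" using \<open>u \<noteq> top\<close> le_less_trans[OF diff_le_self_ennreal, of u top t]
          by (simp add: less_top)
        ultimately have "0 < enn2real (u - t)" "ennreal (enn2real (u - t)) = u - t"
          by (simp_all add: enn2real_positive_iff)
        moreover have "t + (u - t) = u" using u by (simp add: add_diff_inverse_ennreal less_imp_le)
        ultimately show ?thesis by (intro that[of "enn2real (u - t)"]) (simp_all only: order_refl)
      qed
      define e where "e n = r / real (Suc n)" for n
      have epos: "0 < e n" for n using r by (simp add: e_def)
      have ele: "e n \<le> r" for n using r by (simp add: e_def field_simps)
      have "e \<longlonglongrightarrow> 0"
        unfolding e_def using LIMSEQ_Suc[OF lim_const_over_n[of r]] by simp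
      then have "(\<lambda>n. t + ennreal (e n)) \<longlonglongrightarrow> t + ennreal 0"
        by (intro tendsto_add tendsto_const tendsto_ennrealI)
      then have lim: "(\<lambda>n. t + ennreal (e n)) \<longlonglongrightarrow> t" by simp
      have "{\<omega>\<in>paths Z. T \<omega> \<le> t} = (\<Inter>n. {\<omega>\<in>paths Z. T \<omega> < t + ennreal (e n)})"
      proof (intro equalityI subsetI)
        fix \<omega> assume "\<omega> \<in> {\<omega>\<in>paths Z. T \<omega> \<le> t}"
        moreover have "t < t + ennreal (e n)" for n using epos[of n] t
          by (simp add: ennreal_add_left_cancel_less)
        ultimately show "\<omega> \<in> (\<Inter>n. {\<omega>\<in>paths Z. T \<omega> < t + ennreal (e n)})"
          by (auto intro: le_less_trans)
      next
        fix \<omega> assume *: "\<omega> \<in> (\<Inter>n. {\<omega>\<in>paths Z. T \<omega> < t + ennreal (e n)})"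
        then have "T \<omega> \<le> t + ennreal (e n)" for n by (auto intro: less_imp_le)
        then have "T \<omega> \<le> t" by (intro LIMSEQ_le_const[OF lim]) auto
        with * show "\<omega> \<in> {\<omega>\<in>paths Z. T \<omega> \<le> t}" by auto
      qed
      also have "\<dots> \<in> sets (filt Z s)"
      proof (rule sets.countable_INT)
        have "{\<omega>\<in>paths Z. T \<omega> < t + ennreal (e n)} \<in> sets (filt Z s)" for n
        proof -
        have le: "t + ennreal (e n) \<le> s"
          using ele[of n] epos[of n] r(2) u by (meson add_left_mono ennreal_leI le_less less_le_trans order.trans)
        have "t + ennreal (e n) < top" using t by simp
        from assms[OF this] show ?thesis using sets_F_mono[OF le] by blast
        qed
        then show "range (\<lambda>n. {\<omega>\<in>paths Z. T \<omega> < t + ennreal (e n)}) \<subseteq> sets (filt Z s)" by blast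
      qed simp
      finally show ?thesis .
    qed
    then have "{\<omega>\<in>paths Z. T \<omega> \<le> t} \<in> sets (filt Z t)"
      using t by (subst filt_right_cont) auto
    then show ?thesis by (simp add: Measurable.pred_def space_F)
  qed simp
qed

text \<open>f need not vanish at infinity, so \<open>ext0 f\<close> may be discontinuous at the
  cemetery. That point is absorbing, so the function stays 0 once the path is there; at a point of X
  it is enough that open sets of X are open in the compactification.\<close>

lemma ext0_coord_right_cont:
  assumes \<omega>: "\<omega> \<in> paths Z" and f: "continuous_on UNIV (f :: 'a \<Rightarrow> real)" and a: "a < top"
  shows "((\<lambda>s. ext0 f (coord Z s \<omega>)) \<longlongrightarrow> ext0 f (coord Z a \<omega>)) (at_right a)"
proof (cases "coord Z a \<omega>")
  case None
  have "ext0 f (coord Z s \<omega>) = 0" if "s > a" for s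
    using coord_None_mono[OF \<omega> _ None, of s] that by simp
  then have "eventually (\<lambda>s. ext0 f (coord Z s \<omega>) = 0) (at_right a)"
    by (auto simp: eventually_at_filter)
  then show ?thesis using None by (simp add: tendsto_eventually)
next
  case (Some x)
  show ?thesis
  proof (rule topological_tendstoI)
    fix W assume W: "open W" "ext0 f (coord Z a \<omega>) \<in> W"
    have "open (f -` W)" using f W(1) by (simp add: open_vimage)
    then have "openin cem_top (Some ` (f -` W))" by (rule openin_cem_Some)
    moreover have "coord Z a \<omega> \<in> Some ` (f -` W)" using W(2) Some by simp
    ultimately have "eventually (\<lambda>s. coord Z s \<omega> \<in> Some ` (f -` W)) (at_right a)"
      using coord_right_cont[OF \<omega>, of a] a unfolding limitin_def by auto
    then show "eventually (\<lambda>s. ext0 f (coord Z s \<omega>) \<in> W) (at_right a)"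
      by eventually_elim auto
  qed
qed

lemma coord_compose_tendsto:
  assumes \<omega>: "\<omega> \<in> paths Z" and f: "continuous_on UNIV (f :: 'a \<Rightarrow> real)" and a: "a < top"
    and \<theta>: "(\<theta> \<longlongrightarrow> a) G" and ge: "eventually (\<lambda>s. a \<le> \<theta> s) G"
  shows "((\<lambda>s. ext0 f (coord Z (\<theta> s) \<omega>)) \<longlongrightarrow> ext0 f (coord Z a \<omega>)) G"
proof (rule topological_tendstoI)
  fix W assume W: "open W" "ext0 f (coord Z a \<omega>) \<in> W"
  from topological_tendstoD[OF ext0_coord_right_cont[OF \<omega> f a] W]
  have "eventually (\<lambda>s. ext0 f (coord Z s \<omega>) \<in> W) (at_right a)" .
  then obtain b where b: "b > a" "\<And>s. s > a \<Longrightarrow> s < b \<Longrightarrow> ext0 f (coord Z s \<omega>) \<in> W"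
    using a by (subst (asm) eventually_at_right[of a top]) auto
  from order_tendstoD(2)[OF \<theta> b(1)] ge
  show "eventually (\<lambda>s. ext0 f (coord Z (\<theta> s) \<omega>) \<in> W) G"
  proof eventually_elim
    case (elim s)
    then show ?case using b W by (cases "\<theta> s = a") auto
  qed
qed

lemma coord_joint_measurable:
  assumes sp: "space M = paths Z" and sub: "sets (nat_filt Z top) \<subseteq> sets M"
  shows "(\<lambda>(t, \<omega>). coord Z (ennreal t) \<omega>) \<in> borel \<Otimes>\<^sub>M M \<rightarrow>\<^sub>M cem_borel"
proof (rule right_continuous_process_measurable)
  show "coord Z (ennreal t) \<in> M \<rightarrow>\<^sub>M cem_borel" for t
    by (rule measurable_sub_algebra[OF coord_nat_filt_top]) (auto simp: sp sub)
  show "((\<lambda>s. ext0 f (coord Z (ennreal s) \<omega>)) \<longlongrightarrow> ext0 f (coord Z (ennreal t) \<omega>)) (at_right t)"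
    if "\<omega> \<in> space M" "continuous_on UNIV (f :: 'a \<Rightarrow> real)" for \<omega> t f
  proof (rule coord_compose_tendsto)
    show "((\<lambda>s. ennreal s) \<longlongrightarrow> ennreal t) (at_right t)" by (intro tendsto_ennrealI tendsto_ident_at)
    show "eventually (\<lambda>s. ennreal t \<le> ennreal s) (at_right t)"
      by (auto simp: eventually_at_filter intro!: always_eventually ennreal_leI)
  qed (use that sp in auto)
qed

text \<open>Joint measurability is stated over real times; the value \<open>top\<close>, at which
  every path sits in the cemetery, is split off.\<close>

lemma coord_random_time_measurable:
  assumes sp: "space M = paths Z" and sub: "sets (nat_filt Z top) \<subseteq> sets M"
    and [measurable]: "\<sigma> \<in> borel_measurable M"
  shows "(\<lambda>\<omega>. coord Z (\<sigma> \<omega>) \<omega>) \<in> M \<rightarrow>\<^sub>M cem_borel"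
proof -
  note [measurable] = coord_joint_measurable[OF sp sub]
  have "(\<lambda>\<omega>. if \<sigma> \<omega> = top then None else (case (enn2real (\<sigma> \<omega>), \<omega>) of (t, \<omega>) \<Rightarrow> coord Z (ennreal t) \<omega>)) \<in> M \<rightarrow>\<^sub>M cem_borel"
  proof (rule measurable_If)
    show "(\<lambda>\<omega>. case (enn2real (\<sigma> \<omega>), \<omega>) of (t, \<omega>) \<Rightarrow> coord Z (ennreal t) \<omega>) \<in> M \<rightarrow>\<^sub>M cem_borel"
      by (rule measurable_compose[OF _ coord_joint_measurable[OF sp sub]]) measurable
  qed (auto intro!: measurable_const)
  then show ?thesis
    by (rule measurable_cong[THEN iffD1, rotated]) (auto simp: sp coord_top[unfolded infinity_ennreal_def] less_top)
qed

text \<open>The infimum that defines the lifetime is attained: the constant 1, extended by 0, is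
  right continuous along the path and equals 0 at all later times.\<close>

lemma lifetime_dead:
  assumes \<omega>: "\<omega> \<in> paths Z" and t: "t < top" "lifetime Z \<omega> \<le> t"
  shows "coord Z t \<omega> = None"
proof -
  let ?L = "lifetime Z \<omega>"
  have L: "?L < top" using t by (auto intro: le_less_trans)
  have "coord Z ?L \<omega> = None"
  proof (rule ccontr)
    assume "coord Z ?L \<omega> \<noteq> None"
    then have 1: "ext0 (\<lambda>_. 1 :: real) (coord Z ?L \<omega>) = 1" by auto
    have "coord Z r \<omega> = None" if "?L < r" for r
    proof -
      from that obtain s where "s < r" "coord Z s \<omega> = None"
        unfolding lifetime_def Inf_less_iff by auto
      then show ?thesis using coord_None_mono[OF \<omega>, of s r] by simp
    qed
    then have "eventually (\<lambda>r. ext0 (\<lambda>_. 1 :: real) (coord Z r \<omega>) = 0) (at_right ?L)"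
      by (auto simp: eventually_at_filter)
    then have "((\<lambda>r. ext0 (\<lambda>_. 1 :: real) (coord Z r \<omega>)) \<longlongrightarrow> 0) (at_right ?L)"
      by (simp add: tendsto_eventually)
    moreover have "((\<lambda>r. ext0 (\<lambda>_. 1 :: real) (coord Z r \<omega>)) \<longlongrightarrow> 1) (at_right ?L)"
      using ext0_coord_right_cont[OF \<omega> _ L, of "\<lambda>_. 1"] 1 by simp
    moreover have "at_right ?L \<noteq> bot"
    proof
      assume "at_right ?L = bot"
      then have "eventually (\<lambda>_. False) (at_right ?L)" by simp
      then obtain b where "?L < b" "\<And>y. ?L < y \<Longrightarrow> y < b \<Longrightarrow> False"
        using L by (subst (asm) eventually_at_right[of ?L top]) auto
      then show False using dense by blast
    qed
    ultimately show False using tendsto_unique by force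
  qed
  then show ?thesis using coord_None_mono[OF \<omega> t(2)] by simp
qed

end

locale time_change = std_process Z
  for Z :: "('w, 'a::{metric_space, second_countable_topology}) process" +
  fixes A :: "ennreal \<Rightarrow> 'w \<Rightarrow> ennreal" and \<Lambda> :: "'w set"
  assumes A_measurable: "t < top \<Longrightarrow> A t \<in> borel_measurable (aug_filt Z t)"
    and Lam_sets: "\<Lambda> \<in> sets (aug_filt Z top)"
    and Lam_AE: "AE \<omega> in law Z x. \<omega> \<in> \<Lambda>"
    and A_zero: "\<omega> \<in> \<Lambda> \<Longrightarrow> A 0 \<omega> = 0"
    and A_cont: "\<omega> \<in> \<Lambda> \<Longrightarrow> continuous_on {..<top} (\<lambda>t. A t \<omega>)"
    and A_fin: "\<omega> \<in> \<Lambda> \<Longrightarrow> t < lifetime Z \<omega> \<Longrightarrow> A t \<omega> < top"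
    and A_add: "\<omega> \<in> \<Lambda> \<Longrightarrow> s < top \<Longrightarrow> t < top \<Longrightarrow> A (t + s) \<omega> = A t \<omega> + A s (shift Z t \<omega>)"
begin

abbreviation tau :: "real \<Rightarrow> 'w \<Rightarrow> ennreal" where "tau \<equiv> inv_clock A"

definition Y :: "real \<Rightarrow> 'w \<Rightarrow> 'a option" where "Y t \<omega> = coord Z (tau t \<omega>) \<omega>"

lemma Lam_paths: "\<omega> \<in> \<Lambda> \<Longrightarrow> \<omega> \<in> paths Z"
  using sets.sets_into_space[OF Lam_sets] by auto

text \<open>Not postulated in \<open>pcaf\<close>: the increment is the value of A at the shifted
  path, and it is nonnegative because A takes values in \<open>ennreal\<close>.\<close>

lemma A_mono:
  assumes "\<omega> \<in> \<Lambda>" "s \<le> t" "t < top" shows "A s \<omega> \<le> A t \<omega>"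
proof -
  have "s < top" using assms by (auto intro: le_less_trans)
  have "A t \<omega> = A (s + (t - s)) \<omega>" using assms by (simp add: add_diff_inverse_ennreal)
  also have "\<dots> = A s \<omega> + A (t - s) (shift Z s \<omega>)"
    using assms \<open>s < top\<close> by (intro A_add) (auto intro: le_less_trans[OF diff_le_self_ennreal])
  finally show ?thesis by simp
qed

lemma tau_less_iff: "tau t \<omega> < s \<longleftrightarrow> (\<exists>r<s. r < top \<and> ennreal t < A r \<omega>)"
  unfolding inv_clock_def Inf_less_iff by (auto simp: less_top)

lemma tau_le: "r < top \<Longrightarrow> ennreal t < A r \<omega> \<Longrightarrow> tau t \<omega> \<le> r"
  unfolding inv_clock_def by (auto intro!: Inf_lower simp: less_top)

lemma tau_mono: "t \<le> t' \<Longrightarrow> tau t \<omega> \<le> tau t' \<omega>"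
  unfolding inv_clock_def by (rule Inf_superset_mono) (auto intro: le_less_trans ennreal_leI)

text \<open>The strict inequality in \<open>inv_clock\<close> is decisive: if A_r exceeds t, it
  exceeds every s slightly above t, so \<tau>_s \<le> r as well.\<close>

lemma tau_right_cont: "((\<lambda>s. tau s \<omega>) \<longlongrightarrow> tau t \<omega>) (at_right t)"
proof (rule order_tendstoI)
  fix b assume "b < tau t \<omega>"
  then have "b < tau s \<omega>" if "s > t" for s using tau_mono[of t s \<omega>] that by auto
  then show "eventually (\<lambda>s. b < tau s \<omega>) (at_right t)" by (auto simp: eventually_at_filter)
next
  fix b assume "tau t \<omega> < b"
  then obtain r where r: "r < b" "r < top" "ennreal t < A r \<omega>" by (auto simp: tau_less_iff)
  have "((\<lambda>s. ennreal s) \<longlongrightarrow> ennreal t) (at_right t)" by (intro tendsto_ennrealI tendsto_ident_at)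
  from order_tendstoD(2)[OF this r(3)] show "eventually (\<lambda>s. tau s \<omega> < b) (at_right t)"
    by eventually_elim (use r in \<open>auto simp: tau_less_iff\<close>)
qed

lemma Y_right_cont:
  assumes \<omega>: "\<omega> \<in> paths Z" and f: "continuous_on UNIV (f :: 'a \<Rightarrow> real)"
  shows "((\<lambda>s. ext0 f (Y s \<omega>)) \<longlongrightarrow> ext0 f (Y t \<omega>)) (at_right t)"
proof (cases "tau t \<omega> = top")
  case True
  then have "tau s \<omega> = top" if "s > t" for s using tau_mono[of t s \<omega>] that by (simp add: top_unique)
  then have "eventually (\<lambda>s. ext0 f (Y s \<omega>) = ext0 f (Y t \<omega>)) (at_right t)"
    using True by (auto simp: eventually_at_filter Y_def)
  then show ?thesis by (rule tendsto_eventually)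
next
  case False
  then show ?thesis unfolding Y_def
    by (intro coord_compose_tendsto[OF \<omega> f] tau_right_cont)
      (auto simp: less_top eventually_at_filter intro!: always_eventually tau_mono)
qed

text \<open>Nothing is known about \<open>A\<close> off \<open>\<Lambda>\<close>. The \<open>\<tau>\<^sub>t\<close> are stopping times all the same, because every
  subset of the complement of \<open>\<Lambda>\<close> belongs to the augmented filtration.\<close>

lemma off_Lam_aug: "S \<subseteq> paths Z - \<Lambda> \<Longrightarrow> S \<in> sets (aug_filt Z t)"
proof (rule null_sub_aug_filt[of "paths Z - \<Lambda>"])
  show "paths Z - \<Lambda> \<in> sets (aug_filt Z top)"
    using sets.compl_sets[OF Lam_sets] by simp
  show "AE \<omega> in law Z y. \<omega> \<notin> paths Z - \<Lambda>" for y
    using Lam_AE[of y] by eventually_elim simp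
qed

lemma Lam_aug: "\<Lambda> \<in> sets (aug_filt Z t)"
proof -
  have "\<Lambda> = space (aug_filt Z t) - (paths Z - \<Lambda>)" using Lam_paths by auto
  also have "\<dots> \<in> sets (aug_filt Z t)" by (intro sets.compl_sets off_Lam_aug) simp
  finally show ?thesis .
qed

lemma tau_less_aug: "{\<omega>\<in>paths Z. tau t \<omega> < s} \<in> sets (aug_filt Z s)"
proof -
  define Q where "Q = {q :: rat. ennreal (of_rat q) < s}"
  have "{\<omega>\<in>paths Z. tau t \<omega> < s} =
    (\<Lambda> \<inter> (\<Union>q\<in>Q. {\<omega>\<in>paths Z. ennreal t < A (ennreal (of_rat q)) \<omega>})) \<union> ({\<omega>\<in>paths Z. tau t \<omega> < s} - \<Lambda>)"
    (is "?L = ?R")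
  proof (intro equalityI subsetI)
    fix \<omega> assume \<omega>: "\<omega> \<in> ?L"
    show "\<omega> \<in> ?R"
    proof (cases "\<omega> \<in> \<Lambda>")
      case True
      from \<omega> obtain r where r: "r < s" "r < top" "ennreal t < A r \<omega>" by (auto simp: tau_less_iff)
      \<comment> \<open>Monotonicity of A moves the witness from r to a rational time below s, so
        that a countable union remains.\<close>
      obtain q where q: "r < ennreal (real_of_rat q)" "ennreal (real_of_rat q) < s"
        using ennreal_rat_dense[OF r(1)] by blast
      have "A r \<omega> \<le> A (ennreal (of_rat q)) \<omega>" using A_mono[OF True, of r "ennreal (of_rat q)"] q by auto
      then have "ennreal t < A (ennreal (of_rat q)) \<omega>" using r by (auto intro: less_le_trans)
      then show ?thesis using True \<omega> q by (auto simp: Q_def)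
    qed (use \<omega> in simp)
  next
    fix \<omega> assume "\<omega> \<in> ?R"
    then have "\<omega> \<in> ?L \<or> (\<exists>q\<in>Q. ennreal t < A (ennreal (of_rat q)) \<omega>)" "\<omega> \<in> paths Z" by auto
    moreover have "tau t \<omega> < s" if "q \<in> Q" "ennreal t < A (ennreal (of_rat q)) \<omega>" for q
      unfolding tau_less_iff using that by (intro exI[of _ "ennreal (of_rat q)"]) (simp add: Q_def)
    ultimately show "\<omega> \<in> ?L" by auto
  qed
  also have "\<dots> \<in> sets (aug_filt Z s)"
  proof -
    have "{\<omega> \<in> paths Z. ennreal t < A (ennreal (real_of_rat q)) \<omega>} \<in> sets (aug_filt Z s)" if "q \<in> Q" for q
    proof -
      from that have le: "ennreal (of_rat q) \<le> s" by (auto simp: Q_def)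
      have "A (ennreal (of_rat q)) -` {ennreal t<..} \<inter> space (aug_filt Z (ennreal (of_rat q))) \<in> sets (aug_filt Z (ennreal (of_rat q)))"
        by (rule measurable_sets[OF A_measurable]) auto
      then show ?thesis
        using aug_filt_mono[OF le] by (auto simp: vimage_def Int_def conj_commute)
    qed
    then have "(\<Union>q\<in>Q. {\<omega>\<in>paths Z. ennreal t < A (ennreal (of_rat q)) \<omega>}) \<in> sets (aug_filt Z s)"
      by (intro sets.countable_UN') auto
    then show ?thesis by (intro sets.Un[OF sets.Int[OF Lam_aug] off_Lam_aug]) auto
  qed
  finally show ?thesis .
qed

lemma tau_stopping: "stopping_time (filt Z) (tau t)"
  using tau_less_aug aug_filt_sub_filt by (intro stopping_timeI_less) blast

lemma tau_measurable: "tau t \<in> borel_measurable (aug_filt Z top)"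
proof (rule borel_measurableI_less)
  show "{\<omega> \<in> space (aug_filt Z top). tau t \<omega> < s} \<in> sets (aug_filt Z top)" for s
    using tau_less_aug[of t s] aug_filt_mono[of s top] by auto
qed

lemma Y_aug_measurable: "Y t \<in> aug_filt Z top \<rightarrow>\<^sub>M cem_borel"
  unfolding Y_def
  by (rule coord_random_time_measurable) (auto intro: tau_measurable nat_filt_sub_aug_filt[THEN subsetD])

lemma Y_measurable [measurable]: "Y t \<in> events Z \<rightarrow>\<^sub>M cem_borel"
  by (rule measurable_aug_filt_events[OF Y_aug_measurable])

lemma Y_joint_aug: "(\<lambda>(t, \<omega>). Y t \<omega>) \<in> borel \<Otimes>\<^sub>M aug_filt Z top \<rightarrow>\<^sub>M cem_borel"
  by (rule right_continuous_process_measurable) (auto intro: Y_aug_measurable Y_right_cont)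

lemma Y_joint: "(\<lambda>(t, \<omega>). Y t \<omega>) \<in> borel \<Otimes>\<^sub>M events Z \<rightarrow>\<^sub>M cem_borel"
  by (rule right_continuous_process_measurable) (auto intro: Y_right_cont)

lemma A_tau:
  assumes \<omega>: "\<omega> \<in> \<Lambda>" and fin: "tau t \<omega> < top"
  shows "A (tau t \<omega>) \<omega> = ennreal t"
proof (rule antisym)
  let ?a = "tau t \<omega>"
  have cont: "isCont (\<lambda>t. A t \<omega>) ?a"
    using A_cont[OF \<omega>] fin by (simp add: continuous_on_eq_continuous_at)
  show "A ?a \<omega> \<le> ennreal t"
  proof (rule ccontr)
    assume "\<not> A ?a \<omega> \<le> ennreal t"
    then have gt: "ennreal t < A ?a \<omega>" by simp
    \<comment> \<open>A_0 = 0 rules out \<tau>_t = 0 here, so there are times to the left of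
      \<tau>_t at which A still exceeds t.\<close>
    then have "0 < ?a" using A_zero[OF \<omega>] by (metis gr_zeroI not_less_zero)
    have "eventually (\<lambda>r. ennreal t < A r \<omega>) (nhds ?a)"
      using cont gt by (simp add: continuous_at eventually_nhds_conv_at order_tendstoD)
    then obtain S where S: "open S" "?a \<in> S" "\<And>r. r \<in> S \<Longrightarrow> ennreal t < A r \<omega>"
      by (auto simp: eventually_nhds)
    from open_left[OF S(1,2) \<open>0 < ?a\<close>] obtain b where b: "b < ?a" "{b <.. ?a} \<subseteq> S" by auto
    obtain r where r: "b < r" "r < ?a" using dense[OF b(1)] by auto
    then have "r \<in> {b <.. ?a}" by simp
    then have "ennreal t < A r \<omega>" using b(2) S(3) by blast
    moreover have "r < top" using r fin by auto
    ultimately have "?a \<le> r" by (rule tau_le[rotated])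
    with r show False by simp
  qed
  show "ennreal t \<le> A ?a \<omega>"
  proof (rule ccontr)
    assume "\<not> ennreal t \<le> A ?a \<omega>"
    then have gt: "A ?a \<omega> < ennreal t" by simp
    have "eventually (\<lambda>r. A r \<omega> < ennreal t) (nhds ?a)"
      using cont gt by (simp add: continuous_at eventually_nhds_conv_at order_tendstoD)
    then obtain S where S: "open S" "?a \<in> S" "\<And>r. r \<in> S \<Longrightarrow> A r \<omega> < ennreal t"
      by (auto simp: eventually_nhds)
    from open_right[OF S(1,2) fin] obtain b where b: "?a < b" "{?a ..< b} \<subseteq> S" by auto
    from b(1) obtain r where r: "r < b" "r < top" "ennreal t < A r \<omega>" by (auto simp: tau_less_iff)
    have "?a \<le> r" by (rule tau_le) (use r in auto)
    then have "A r \<omega> < ennreal t" using r b S by auto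
    with r show False by simp
  qed
qed

lemma A_below_tau:
  assumes "\<omega> \<in> \<Lambda>" "s < tau t \<omega>" shows "A s \<omega> \<le> ennreal t"
  using tau_le[of s t \<omega>] assms(2) less_le_trans[of s "tau t \<omega>" top] by force

lemma Y_shift_None: 
  assumes "\<omega> \<in> paths Z" "coord Z T \<omega> = None" shows "Y s (shift Z T \<omega>) = None"
  using assms coord_None_mono[OF assms(1) _ assms(2), of "T + tau s (shift Z T \<omega>)"]
  by (simp add: Y_def coord_shift)

lemma A_top_None:
  assumes \<omega>: "\<omega> \<in> \<Lambda>" and T: "T < top" "A T \<omega> = top" shows "coord Z T \<omega> = None"
proof -
  have "\<not> T < lifetime Z \<omega>" using A_fin[OF \<omega>, of T] T by auto
  then show ?thesis using lifetime_dead[OF Lam_paths[OF \<omega>] T(1)] by simp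
qed

text \<open>Additivity turns A_r > s for the shifted path into A_(T+r) > a + s for the original one.
  T is not restricted to the times \<tau>_t: the identity also serves arbitrary T in
  \<open>laplace_functional_shift_le\<close>, and times before \<tau>_0, where a = 0.\<close>

lemma tau_shift:
  assumes \<omega>: "\<omega> \<in> \<Lambda>" and T: "T < top" and a: "0 \<le> a" "A T \<omega> = ennreal a" and s: "0 \<le> s"
  shows "T + tau s (shift Z T \<omega>) = tau (a + s) \<omega>"
proof (rule antisym)
  have iff: "ennreal s < A r (shift Z T \<omega>) \<longleftrightarrow> ennreal (a + s) < A (T + r) \<omega>" if "r < top" for r
    using A_add[OF \<omega> that T] a s by (simp add: ennreal_add_left_cancel_less)
  show "T + tau s (shift Z T \<omega>) \<le> tau (a + s) \<omega>"
    unfolding inv_clock_def[of A "a + s" \<omega>]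
  proof (rule Inf_greatest)
    fix r assume "r \<in> {r. r < \<infinity> \<and> ennreal (a + s) < A r \<omega>}"
    then have r: "r < top" "ennreal (a + s) < A r \<omega>" by (auto simp: less_top)
    have "\<not> r < T"
    proof
      assume "r < T"
      then have "A r \<omega> \<le> ennreal a" using A_mono[OF \<omega>, of r T] T a by simp
      also have "\<dots> \<le> ennreal (a + s)" using s by (intro ennreal_leI) simp
      finally show False using r by simp
    qed
    then have Tr: "T + (r - T) = r" by (simp add: add_diff_inverse_ennreal)
    have "r - T < top" using r by (auto intro: le_less_trans[OF diff_le_self_ennreal])
    then have "tau s (shift Z T \<omega>) \<le> r - T" by (rule tau_le) (use iff[of "r - T"] Tr r \<open>r - T < top\<close> in simp)
    then have "T + tau s (shift Z T \<omega>) \<le> T + (r - T)" by (rule add_left_mono)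
    then show "T + tau s (shift Z T \<omega>) \<le> r" by (simp add: Tr)
  qed
  show "tau (a + s) \<omega> \<le> T + tau s (shift Z T \<omega>)"
  proof (rule ccontr)
    assume "\<not> tau (a + s) \<omega> \<le> T + tau s (shift Z T \<omega>)"
    then have lt: "T + tau s (shift Z T \<omega>) < tau (a + s) \<omega>" by simp
    have "tau s (shift Z T \<omega>) < tau (a + s) \<omega> - T"
      using lt T by (simp add: less_diff_eq_ennreal add.commute)
    then obtain r where r: "r < tau (a + s) \<omega> - T" "r < top" "ennreal s < A r (shift Z T \<omega>)"
      by (auto simp: tau_less_iff)
    then have "tau (a + s) \<omega> \<le> T + r" using iff[OF r(2)] T by (intro tau_le) auto
    moreover have "T + r < tau (a + s) \<omega>" using r T by (simp add: less_diff_eq_ennreal add.commute)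
    ultimately show False by simp
  qed
qed

lemma Y_shift:
  assumes \<omega>: "\<omega> \<in> \<Lambda>" and T: "T < top" and a: "0 \<le> a" "A T \<omega> = ennreal a" and s: "0 \<le> s"
  shows "Y s (shift Z T \<omega>) = Y (a + s) \<omega>"
  using tau_shift[OF assms] Lam_paths[OF \<omega>] by (simp add: Y_def coord_shift)

lemma Y_shift_tau:
  assumes \<omega>: "\<omega> \<in> \<Lambda>" and t: "0 \<le> t" and s: "0 \<le> s"
  shows "Y s (shift Z (tau t \<omega>) \<omega>) = Y (t + s) \<omega>"
proof (cases "tau t \<omega> = top")
  case True
  have "tau (t + s) \<omega> = top" using True tau_mono[of t "t + s" \<omega>] s by (simp add: top_unique)
  moreover have "coord Z top \<omega> = None" using coord_top[OF Lam_paths[OF \<omega>]] by simp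
  ultimately show ?thesis using Y_shift_None[OF Lam_paths[OF \<omega>], of top s] True by (simp add: Y_def)
next
  case False
  then show ?thesis using Y_shift[OF \<omega> _ t A_tau[OF \<omega>] s] by (simp add: less_top)
qed

lemma coord_tau: "coord Z (tau t \<omega>) \<omega> = Y t \<omega>"
  by (simp add: Y_def)

section \<open>Stieltjes integrals as occupation integrals of the time-changed process\<close>

lemma tau_pathwise_measurable: "(\<lambda>s. tau s \<omega>) \<in> borel_measurable borel"
proof (rule borel_measurableI_less)
  fix y
  have "{s \<in> space borel. tau s \<omega> < y} = (\<Union>r\<in>{r. r < y \<and> r < top}. {s. ennreal s < A r \<omega>})"
    by (auto simp: tau_less_iff)
  also have "open \<dots>"
    by (intro open_UN ballI open_Collect_less continuous_intros continuous_on_ennreal)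
  finally show "{s \<in> space borel. tau s \<omega> < y} \<in> sets borel" using borel_open by blast
qed

lemma coord_pathwise_measurable:
  assumes "\<omega> \<in> paths Z" shows "(\<lambda>t. coord Z (ennreal t) \<omega>) \<in> borel \<rightarrow>\<^sub>M cem_borel"
proof -
  have "(\<lambda>t. (t, \<omega>)) \<in> borel \<rightarrow>\<^sub>M borel \<Otimes>\<^sub>M events Z" using assms by simp
  from measurable_compose[OF this coord_joint_measurable[of "events Z"]] show ?thesis
    using nat_filt_sub_events by simp
qed

lemma Y_pathwise_measurable:
  assumes "\<omega> \<in> paths Z" shows "(\<lambda>t. Y t \<omega>) \<in> borel \<rightarrow>\<^sub>M cem_borel"
proof -
  have "(\<lambda>t. (t, \<omega>)) \<in> borel \<rightarrow>\<^sub>M borel \<Otimes>\<^sub>M events Z" using assms by simp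
  from measurable_compose[OF this Y_joint] show ?thesis by simp
qed

text \<open>Up to time b, the measure dA is the image of Lebesgue measure on [0, A_b) under the
  inverse clock. Both are finite Borel measures on the line, so it suffices to compare distribution
  functions.\<close>

lemma interval_measure_clock:
  assumes \<omega>: "\<omega> \<in> \<Lambda>" and b: "0 \<le> b" "A (ennreal b) \<omega> < top"
  shows "interval_measure (\<lambda>s. enn2real (A (ennreal (min s b)) \<omega>)) =
    distr (density lborel (indicator {0..<enn2real (A (ennreal b) \<omega>)})) borel (\<lambda>s. enn2real (tau s \<omega>))"
    (is "interval_measure ?F = ?D")
proof -
  let ?ab = "enn2real (A (ennreal b) \<omega>)"
  have [measurable]: "(\<lambda>s. tau s \<omega>) \<in> borel_measurable borel" by (rule tau_pathwise_measurable)
  have A_le: "A (ennreal (min x b)) \<omega> \<le> A (ennreal b) \<omega>" for x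
    by (rule A_mono[OF \<omega>]) (auto intro: ennreal_leI)
  then have A_fin': "A (ennreal (min x b)) \<omega> < top" for x using b by (auto intro: le_less_trans)
  have F_mono: "?F x \<le> ?F y" if "x \<le> y" for x y
    using that A_fin'[of y] by (intro enn2real_mono A_mono[OF \<omega>] ennreal_leI) auto
  have contA: "isCont (\<lambda>t. A t \<omega>) t" if "t < top" for t
    using A_cont[OF \<omega>] that by (simp add: continuous_on_eq_continuous_at)
  have F_cont: "continuous (at_right x) ?F" for x
  proof -
    have "((\<lambda>s. ennreal (min s b)) \<longlongrightarrow> ennreal (min x b)) (at_right x)"
      by (intro tendsto_ennrealI tendsto_min tendsto_ident_at tendsto_const)
    from isCont_tendsto_compose[OF contA this]
    have "((\<lambda>s. A (ennreal (min s b)) \<omega>) \<longlongrightarrow> A (ennreal (min x b)) \<omega>) (at_right x)" by simp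
    then show ?thesis unfolding continuous_within
      using A_fin'[of x] by (intro tendsto_enn2real) auto
  qed
  have F_neg: "?F x = 0" if "x < 0" for x
    using that b A_zero[OF \<omega>] by (simp add: ennreal_neg)
  have F_bot: "(?F \<longlongrightarrow> 0) at_bot"
    by (rule tendsto_eventually) (auto simp: eventually_at_bot_dense intro!: exI[of _ 0] F_neg)
  have F_top: "(?F \<longlongrightarrow> ?ab) at_top"
    by (rule tendsto_eventually) (auto simp: eventually_at_top_linorder min_def intro!: exI[of _ b])
  have D_fin: "finite_borel_measure ?D"
  proof -
    have "finite_measure (density lborel (indicator {0..<?ab}))"
      by (rule finite_measureI) (auto simp: emeasure_density)
    then have "finite_measure ?D" by (rule finite_measure.finite_measure_distr) simp
    then show ?thesis unfolding finite_borel_measure_def finite_borel_measure_axioms_def by simp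
  qed
  have cdfD: "cdf ?D x = ?F x" for x
  proof -
    let ?S = "{s\<in>{0..<?ab}. enn2real (tau s \<omega>) \<le> x}"
    have Sm: "?S \<in> sets borel" by measurable
    have "(\<lambda>s. enn2real (tau s \<omega>)) -` {..x} \<inter> space borel \<in> sets borel" by measurable
    then have vm: "(\<lambda>s. enn2real (tau s \<omega>)) -` {..x} \<in> sets borel" by simp
    have "emeasure ?D {..x} = emeasure lborel ?S"
      by (subst emeasure_distr; (subst emeasure_density)?)
        (use vm in \<open>auto simp flip: nn_integral_indicator intro!: nn_integral_cong split: split_indicator\<close>)
    also have "\<dots> = ennreal (?F x)"
    proof (cases "x < 0")
      case True
      have "0 \<le> enn2real (tau s \<omega>)" for s by simp
      then have "?S = {}" using True by (auto simp: not_le intro: less_le_trans)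
      then show ?thesis by (simp only: F_neg[OF True] emeasure_empty ennreal_0)
    next
      case False
      let ?c = "?F x"
      have c: "ennreal ?c = A (ennreal (min x b)) \<omega>" "0 \<le> ?c" using A_fin'[of x] by auto
      have c_le: "?c \<le> ?ab" using A_le b by (intro enn2real_mono) auto
      have tau_b: "tau s \<omega> \<le> ennreal b" if "s < ?ab" "0 \<le> s" for s
      proof (rule tau_le)
        show "ennreal s < A (ennreal b) \<omega>"
          using that b ennreal_less_iff[OF that(2), of ?ab] by simp
      qed simp
      \<comment> \<open>The set \<open>?S\<close> is squeezed between a half-open and a closed
        interval with the same ends. The right end depends on how A continues after x, but it has
        Lebesgue measure zero.\<close>
      have sub1: "{0..<?c} \<subseteq> ?S"
      proof
        fix s assume s: "s \<in> {0..<?c}"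
        then have "ennreal s < ennreal ?c" by (subst ennreal_less_iff) auto
        then have "ennreal s < A (ennreal (min x b)) \<omega>" unfolding c(1) .
        then have "tau s \<omega> \<le> ennreal (min x b)" by (intro tau_le) auto
        then have "enn2real (tau s \<omega>) \<le> enn2real (ennreal (min x b))" by (intro enn2real_mono) auto
        then show "s \<in> ?S" using s c_le False b by auto
      qed
      have sub2: "?S \<subseteq> {0..?c}"
      proof
        fix s assume s: "s \<in> ?S"
        then have tb: "tau s \<omega> \<le> ennreal b" using tau_b by auto
        then have fin: "tau s \<omega> < top" by (auto intro: le_less_trans)
        have "tau s \<omega> = ennreal (enn2real (tau s \<omega>))" using fin by simp
        also have "\<dots> \<le> ennreal x" using s by (intro ennreal_leI) auto
        finally have "tau s \<omega> \<le> ennreal (min x b)" using tb by (simp add: min_def)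
        then have "A (tau s \<omega>) \<omega> \<le> A (ennreal (min x b)) \<omega>" by (intro A_mono[OF \<omega>]) auto
        then have "ennreal s \<le> ennreal ?c" using A_tau[OF \<omega> fin] c by simp
        then show "s \<in> {0..?c}" using s c(2) by (auto simp: ennreal_le_iff)
      qed
      have "emeasure lborel {0..<?c} \<le> emeasure lborel ?S" by (rule emeasure_mono[OF sub1]) (use Sm in simp)
      moreover have "emeasure lborel ?S \<le> emeasure lborel {0..?c}" by (rule emeasure_mono[OF sub2]) simp
      ultimately show ?thesis using c(2) by (intro antisym) simp_all
    qed
    finally show ?thesis by (simp add: cdf_def measure_def)
  qed
  show ?thesis
  proof (rule cdf_unique'[OF finite_borel_measure_interval_measure D_fin])
    show "cdf (interval_measure ?F) = cdf ?D"
      using cdfD by (subst cdf_interval_measure[OF F_mono F_cont F_bot]) auto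
  qed (use F_mono F_cont F_bot F_top in auto)
qed

text \<open>Change of variables t = \<tau>_s. For s beyond the total mass of A the clock is infinite
  and Y_s is the cemetery, where f vanishes; so the integral over s may run over the whole
  half-line.\<close>

lemma stieltjes_eq_occupation:
  assumes \<omega>: "\<omega> \<in> \<Lambda>" and f [measurable]: "f \<in> borel_measurable cem_borel" and f0: "f None = 0"
  shows "stieltjes (\<lambda>s. A s \<omega>) (\<lambda>t. f (coord Z (ennreal t) \<omega>)) = (\<integral>\<^sup>+ s\<in>{0..}. f (Y s \<omega>) \<partial>lborel)"
proof -
  have \<omega>p: "\<omega> \<in> paths Z" by (rule Lam_paths[OF \<omega>])
  note [measurable] = tau_pathwise_measurable coord_pathwise_measurable[OF \<omega>p] Y_pathwise_measurable[OF \<omega>p]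
  define B where "B = {b. 0 \<le> b \<and> A (ennreal b) \<omega> < top}"
  define I where "I b = (\<integral>\<^sup>+ s. indicator {0..<enn2real (A (ennreal b) \<omega>)} s * f (Y s \<omega>) \<partial>lborel)" for b
  have eq: "(\<integral>\<^sup>+ t. f (coord Z (ennreal t) \<omega>) \<partial>interval_measure (\<lambda>s. enn2real (A (ennreal (min s b)) \<omega>))) = I b"
    if "b \<in> B" for b
  proof -
    have b: "0 \<le> b" "A (ennreal b) \<omega> < top" using that by (auto simp: B_def)
    have "(\<integral>\<^sup>+ t. f (coord Z (ennreal t) \<omega>) \<partial>interval_measure (\<lambda>s. enn2real (A (ennreal (min s b)) \<omega>)))
      = (\<integral>\<^sup>+ s. indicator {0..<enn2real (A (ennreal b) \<omega>)} s * f (coord Z (ennreal (enn2real (tau s \<omega>))) \<omega>) \<partial>lborel)"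
      unfolding interval_measure_clock[OF \<omega> b]
      by (subst nn_integral_distr, simp, simp, subst nn_integral_density, simp_all)
    also have "\<dots> = I b" unfolding I_def
    proof (rule nn_integral_cong)
      fix s
      show "indicator {0..<enn2real (A (ennreal b) \<omega>)} s * f (coord Z (ennreal (enn2real (tau s \<omega>))) \<omega>) =
         indicator {0..<enn2real (A (ennreal b) \<omega>)} s * f (Y s \<omega>)"
      proof (cases "s \<in> {0..<enn2real (A (ennreal b) \<omega>)}")
        case True
        then have "ennreal s < ennreal (enn2real (A (ennreal b) \<omega>))" by (simp add: ennreal_less_iff)
        then have "tau s \<omega> \<le> ennreal b" using b by (intro tau_le) auto
        then have "tau s \<omega> < top" by (auto intro: le_less_trans)
        then show ?thesis by (simp add: Y_def)
      qed simp
    qed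
    finally show ?thesis .
  qed
  have st: "stieltjes (\<lambda>s. A s \<omega>) (\<lambda>t. f (coord Z (ennreal t) \<omega>)) = (SUP b\<in>B. I b)"
    unfolding stieltjes_def B_def[symmetric] infinity_ennreal_def by (intro SUP_cong refl eq)
  let ?J = "\<integral>\<^sup>+ s\<in>{0..}. f (Y s \<omega>) \<partial>lborel"
  have le: "I b \<le> ?J" for b unfolding I_def
    by (intro nn_integral_mono) (auto split: split_indicator)
  \<comment> \<open>Freezing times that are finite, have A at most n, and increase with n. They
    exhaust the integral: if Y_s is alive, A exceeds s at some finite r, and for large n either r
    \<le> c n or A(c n) = n > s.\<close>
  define c where "c n = min (tau (real n) \<omega>) (of_nat n)" for n :: nat
  have c_fin: "c n < top" for n by (auto simp: c_def min_less_iff_disj of_nat_less_top)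
  define bb where "bb n = enn2real (c n)" for n
  have bb: "ennreal (bb n) = c n" for n using c_fin[of n] by (simp add: bb_def)
  have Ac: "A (c n) \<omega> \<le> ennreal (real n)" for n
  proof (cases "tau (real n) \<omega> = top")
    case True
    then show ?thesis using c_fin[of n] by (intro A_below_tau[OF \<omega>]) simp
  next
    case False
    then have "tau (real n) \<omega> < top" by (simp add: less_top)
    then have "A (c n) \<omega> \<le> A (tau (real n) \<omega>) \<omega>" by (intro A_mono[OF \<omega>]) (auto simp: c_def)
    then show ?thesis using A_tau[OF \<omega> \<open>tau (real n) \<omega> < top\<close>] by simp
  qed
  have bbB: "bb n \<in> B" for n
    using le_less_trans[OF Ac[of n]] by (simp add: B_def bb) (simp add: bb_def)
  have c_mono: "c n \<le> c m" if "n \<le> m" for n m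
    unfolding c_def using that by (intro min.mono tau_mono) auto
  have Ac_fin: "A (c n) \<omega> < top" for n using le_less_trans[OF Ac[of n]] by simp
  have Ac_mono: "A (c n) \<omega> \<le> A (c m) \<omega>" if "n \<le> m" for n m
    by (rule A_mono[OF \<omega> c_mono[OF that] c_fin])
  have ex: "\<exists>n. s < enn2real (A (c n) \<omega>)" if s: "0 \<le> s" "Y s \<omega> \<noteq> None" for s
  proof -
    have "tau s \<omega> \<noteq> top" using s(2) coord_top[OF \<omega>p] by (auto simp: Y_def)
    then have "tau s \<omega> < top" by (simp add: less_top)
    then obtain r where r: "r < top" "ennreal s < A r \<omega>" by (auto simp: tau_less_iff)
    obtain r' where r': "r = ennreal r'" "0 \<le> r'" using r(1) by (metis ennreal_cases top.not_eq_extremum)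
    obtain n where n: "max r' s < real n" using reals_Archimedean2 by blast
    have rn: "r \<le> of_nat n" using n r' by (simp add: ennreal_of_nat_eq_real_of_nat ennreal_leI)
    have "ennreal s < A (c n) \<omega>"
    proof (cases "r \<le> tau (real n) \<omega>")
      case True
      then have "r \<le> c n" using rn by (simp add: c_def)
      then show ?thesis using A_mono[OF \<omega> _ c_fin, of r n] r(2) by (auto intro: less_le_trans)
    next
      case False
      then have "tau (real n) \<omega> \<le> of_nat n" "tau (real n) \<omega> < top" using rn r(1) by auto
      then have "A (c n) \<omega> = ennreal (real n)" using A_tau[OF \<omega>] by (simp add: c_def min_def)
      then show ?thesis using n s by (simp add: ennreal_less_iff)
    qed
    then have "ennreal s < ennreal (enn2real (A (c n) \<omega>))" using Ac_fin[of n] by simp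
    then show ?thesis using s by (auto simp: ennreal_less_iff)
  qed
  let ?g = "\<lambda>n s. indicator {0..<enn2real (A (c n) \<omega>)} s * f (Y s \<omega>)"
  have inc: "incseq ?g"
  proof (intro monoI le_funI)
    fix n m :: nat and s assume "n \<le> m"
    then have "enn2real (A (c n) \<omega>) \<le> enn2real (A (c m) \<omega>)"
      using Ac_mono Ac_fin by (intro enn2real_mono) auto
    then show "?g n s \<le> ?g m s" by (auto split: split_indicator)
  qed
  have "?J = (\<integral>\<^sup>+ s. (SUP n. ?g n s) \<partial>lborel)"
  proof (rule nn_integral_cong)
    fix s
    show "f (Y s \<omega>) * indicator {0..} s = (SUP n. ?g n s)"
    proof (cases "0 \<le> s \<and> Y s \<omega> \<noteq> None")
      case True
      then obtain n where "s < enn2real (A (c n) \<omega>)" using ex by blast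
      then have "?g n s = f (Y s \<omega>)" using True by simp
      then have "f (Y s \<omega>) \<le> (SUP n. ?g n s)" by (intro SUP_upper2[of n UNIV]) auto
      moreover have "(SUP n. ?g n s) \<le> f (Y s \<omega>)" by (intro SUP_least) (auto split: split_indicator)
      ultimately show ?thesis using True by simp
    next
      case False
      then have "s < 0 \<or> f (Y s \<omega>) = 0" using f0 by force
      then have "f (Y s \<omega>) * indicator {0..} s = 0" "?g n s = 0" for n
        by (auto split: split_indicator)
      then show ?thesis by (simp only: SUP_const UNIV_not_empty simp_thms)
    qed
  qed
  also have "\<dots> = (SUP n. I (bb n))" unfolding I_def bb
    by (rule nn_integral_monotone_convergence_SUP[OF inc]) measurable
  also have "\<dots> \<le> (SUP b\<in>B. I b)" by (intro SUP_least SUP_upper bbB)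
  finally have "?J \<le> (SUP b\<in>B. I b)" .
  moreover have "(SUP b\<in>B. I b) \<le> ?J" by (intro SUP_least le)
  ultimately show ?thesis unfolding st by (rule antisym[rotated])
qed

end

section \<open>Semigroup and resolvent of the time-changed process\<close>

lemma bounded_borel_iff:
  "u \<in> bounded_borel \<longleftrightarrow> u \<in> borel_measurable borel \<and> (\<exists>c\<ge>0. \<forall>x. \<bar>u x\<bar> \<le> c)"
proof -
  have "bounded (range u) \<longleftrightarrow> (\<exists>c\<ge>0. \<forall>x. \<bar>u x\<bar> \<le> c)"
    by (auto simp: bounded_iff) (metis abs_ge_zero order_trans)
  then show ?thesis by (simp add: bounded_borel_def)
qed

lemma bounded_borelI:
  fixes u :: "'a::topological_space \<Rightarrow> real"
  assumes "u \<in> borel_measurable borel" "\<And>x. \<bar>u x\<bar> \<le> c"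
  shows "u \<in> bounded_borel"
  using assms abs_ge_zero order_trans unfolding bounded_borel_iff by blast

lemma bounded_borel_const: "(\<lambda>_. c) \<in> bounded_borel"
  by (rule bounded_borelI[where c = "\<bar>c\<bar>"]) auto

lemma bounded_borel_lin:
  fixes u v :: "'a::topological_space \<Rightarrow> real"
  assumes "u \<in> bounded_borel" "v \<in> bounded_borel"
  shows "(\<lambda>y. a * u y + b * v y) \<in> bounded_borel"
proof -
  from assms obtain c d where u: "u \<in> borel_measurable borel" "\<And>x. \<bar>u x\<bar> \<le> c"
    and v: "v \<in> borel_measurable borel" "\<And>x. \<bar>v x\<bar> \<le> d" unfolding bounded_borel_iff by blast
  show ?thesis
  proof (rule bounded_borelI)
    show "(\<lambda>y. a * u y + b * v y) \<in> borel_measurable borel" using u v by simp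
    show "\<bar>a * u x + b * v x\<bar> \<le> \<bar>a\<bar> * c + \<bar>b\<bar> * d" for x
      using u(2)[of x] v(2)[of x]
      by (intro order_trans[OF abs_triangle_ineq] add_mono) (auto simp: abs_mult intro!: mult_left_mono)
  qed
qed

lemma bounded_borel_add: "u \<in> bounded_borel \<Longrightarrow> v \<in> bounded_borel \<Longrightarrow> (\<lambda>y. u y + v y) \<in> bounded_borel"
  and bounded_borel_diff: "u \<in> bounded_borel \<Longrightarrow> v \<in> bounded_borel \<Longrightarrow> (\<lambda>y. u y - v y) \<in> bounded_borel"
  and bounded_borel_cmult: "u \<in> bounded_borel \<Longrightarrow> (\<lambda>y. a * u y) \<in> bounded_borel"
  for u v :: "'a::topological_space \<Rightarrow> real"
  using bounded_borel_lin[of u v 1 1] bounded_borel_lin[of u v 1 "-1"] bounded_borel_lin[of u u a 0] by simp_all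

lemma ext0_lin: "ext0 (\<lambda>y. a * u y + b * v y) z = a * ext0 u z + (b :: real) * ext0 v z"
  by (cases z) auto

lemma ext0_abs_le: "(\<And>x. \<bar>u x\<bar> \<le> c) \<Longrightarrow> \<bar>ext0 u z\<bar> \<le> c * ext0 (\<lambda>_. 1 :: real) z"
  by (cases z) auto

lemma ext0_nonneg: "(\<And>x. 0 \<le> u x) \<Longrightarrow> 0 \<le> ext0 (u :: _ \<Rightarrow> real) z"
  by (cases z) auto

lemma ennreal_ext0: "ennreal (ext0 u z) = ext0 (\<lambda>x. ennreal (u x)) z"
  by (cases z) auto

context time_change begin

lemma Y_comp:
  "f \<in> M \<rightarrow>\<^sub>M borel \<Longrightarrow> h \<in> M \<rightarrow>\<^sub>M events Z \<Longrightarrow> (\<lambda>z. Y (f z) (h z)) \<in> M \<rightarrow>\<^sub>M cem_borel"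
  using measurable_compose[OF measurable_Pair Y_joint] by auto

lemma Y_pair [measurable]: "(\<lambda>z. Y (fst z) (snd z)) \<in> lborel \<Otimes>\<^sub>M law Z x \<rightarrow>\<^sub>M cem_borel"
proof (rule Y_comp)
  show "snd \<in> lborel \<Otimes>\<^sub>M law Z x \<rightarrow>\<^sub>M events Z"
    using measurable_snd[of lborel "law Z x"] by (simp cong: measurable_cong_sets)
qed measurable

lemma pair_sigma_finite_law: "pair_sigma_finite lborel (law Z x)"
proof -
  interpret prob_space "law Z x" by (rule prob_law)
  show ?thesis by (rule pair_sigma_finite.intro) unfold_locales
qed

abbreviation P :: "real \<Rightarrow> ('a \<Rightarrow> real) \<Rightarrow> 'a \<Rightarrow> real" where "P \<equiv> tc_semigroup Z A"

lemma P_eq: "P t u x = (\<integral>\<omega>. ext0 u (Y t \<omega>) \<partial>law Z (Some x))"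
  by (simp add: tc_semigroup_def Y_def)

lemma integrable_ext0_Y:
  assumes "u \<in> bounded_borel" shows "integrable (law Z y) (\<lambda>\<omega>. ext0 u (Y t \<omega>))"
proof -
  interpret prob_space "law Z y" by (rule prob_law)
  from assms obtain c where u [measurable]: "u \<in> borel_measurable borel" and c: "0 \<le> c" "\<And>x. \<bar>u x\<bar> \<le> c"
    unfolding bounded_borel_iff by blast
  have "\<bar>ext0 u z\<bar> \<le> c" for z using c by (cases z) auto
  then show ?thesis by (intro integrable_const_bound[where B = c]) auto
qed

lemma P_lin:
  assumes "u \<in> bounded_borel" "v \<in> bounded_borel"
  shows "P t (\<lambda>y. a * u y + b * v y) x = a * P t u x + b * P t v x"
  unfolding P_eq ext0_lin using assms by (simp add: integrable_ext0_Y)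

lemma P_diff: "u \<in> bounded_borel \<Longrightarrow> v \<in> bounded_borel \<Longrightarrow> P t (\<lambda>y. u y - v y) x = P t u x - P t v x"
  using P_lin[of u v t 1 "-1" x] by simp

lemma P_nonneg: "(\<And>y. 0 \<le> u y) \<Longrightarrow> 0 \<le> P t u x"
  unfolding P_eq by (intro integral_nonneg_AE AE_I2 ext0_nonneg)

text \<open>The bound keeps the factor P_t 1 because it is integrable in t over the half-line; the
  cruder bound by c would not give \<open>integrable_P\<close>.\<close>

lemma P_abs_le_one:
  assumes "u \<in> borel_measurable borel" "\<And>y. \<bar>u y\<bar> \<le> c"
  shows "\<bar>P t u x\<bar> \<le> c * P t (\<lambda>_. 1) x"
proof -
  have u: "u \<in> bounded_borel" by (rule bounded_borelI[OF assms])
  have "\<bar>P t u x\<bar> \<le> (\<integral>\<omega>. \<bar>ext0 u (Y t \<omega>)\<bar> \<partial>law Z (Some x))" unfolding P_eq by (rule integral_abs_bound)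
  also have "\<dots> \<le> (\<integral>\<omega>. c * ext0 (\<lambda>_. 1) (Y t \<omega>) \<partial>law Z (Some x))"
    using u by (intro integral_mono integrable_abs integrable_mult_right integrable_ext0_Y bounded_borel_const ext0_abs_le assms)
  finally show ?thesis by (simp add: P_eq)
qed

lemma P_one_le: "P t (\<lambda>_. 1) x \<le> 1"
proof -
  interpret prob_space "law Z (Some x)" by (rule prob_law)
  have "P t (\<lambda>_. 1) x \<le> (\<integral>\<omega>. 1 \<partial>law Z (Some x))" unfolding P_eq
    by (intro integral_mono integrable_ext0_Y bounded_borel_const integrable_const)
      (auto simp: ext0_def split: option.splits)
  then show ?thesis using prob_space by simp
qed

lemma P_abs_le:
  assumes "u \<in> borel_measurable borel" "\<And>y. \<bar>u y\<bar> \<le> c" shows "\<bar>P t u x\<bar> \<le> c"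
proof -
  have "0 \<le> c" using assms(2)[of undefined] abs_ge_zero order_trans by blast
  then have "c * P t (\<lambda>_. 1) x \<le> c" using mult_left_mono[OF P_one_le[of t x], of c] by simp
  with P_abs_le_one[OF assms, of t x] show ?thesis by simp
qed

lemma ennreal_P:
  assumes "u \<in> bounded_borel" "\<And>y. 0 \<le> u y"
  shows "ennreal (P t u x) = (\<integral>\<^sup>+ \<omega>. ennreal (ext0 u (Y t \<omega>)) \<partial>law Z (Some x))"
  unfolding P_eq using assms by (intro nn_integral_eq_integral[symmetric] integrable_ext0_Y AE_I2 ext0_nonneg)

lemma P_time_measurable [measurable]:
  assumes [measurable]: "u \<in> borel_measurable borel"
  shows "(\<lambda>t. P t u x) \<in> borel_measurable borel"
proof -
  interpret pair_sigma_finite lborel "law Z (Some x)" by (rule pair_sigma_finite_law)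
  have "(\<lambda>(t, \<omega>). ext0 u (Y t \<omega>)) \<in> borel_measurable (lborel \<Otimes>\<^sub>M law Z (Some x))"
    unfolding case_prod_beta by measurable
  then have "(\<lambda>t. P t u x) \<in> borel_measurable lborel" unfolding P_eq
    by (rule M2.borel_measurable_lebesgue_integral)
  then show ?thesis by simp
qed

lemma nn_integral_P_swap:
  assumes u: "u \<in> bounded_borel" "\<And>y. 0 \<le> u y" and [measurable]: "h \<in> borel_measurable borel"
  shows "(\<integral>\<^sup>+ t. h t * ennreal (P (s + t) u x) \<partial>lborel) =
    (\<integral>\<^sup>+ \<omega>. (\<integral>\<^sup>+ t. h t * ennreal (ext0 u (Y (s + t) \<omega>)) \<partial>lborel) \<partial>law Z (Some x))"
proof -
  interpret pair_sigma_finite lborel "law Z (Some x)" by (rule pair_sigma_finite_law)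
  have [measurable]: "u \<in> borel_measurable borel" using u by (simp add: bounded_borel_def)
  have [measurable]: "(\<lambda>z. Y (s + fst z) (snd z)) \<in> lborel \<Otimes>\<^sub>M law Z (Some x) \<rightarrow>\<^sub>M cem_borel"
  proof (rule Y_comp)
    show "snd \<in> lborel \<Otimes>\<^sub>M law Z (Some x) \<rightarrow>\<^sub>M events Z"
      using measurable_snd[of lborel "law Z (Some x)"] by (simp cong: measurable_cong_sets)
  qed measurable
  have 1: "(\<lambda>(t, \<omega>). h t * ennreal (ext0 u (Y (s + t) \<omega>))) \<in> borel_measurable (lborel \<Otimes>\<^sub>M law Z (Some x))"
    unfolding case_prod_beta by measurable
  have 2: "(\<lambda>\<omega>. ennreal (ext0 u (Y (s + t) \<omega>))) \<in> borel_measurable (law Z (Some x))" for t by measurable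
  have "(\<integral>\<^sup>+ t. h t * ennreal (P (s + t) u x) \<partial>lborel) =
     (\<integral>\<^sup>+ t. (\<integral>\<^sup>+ \<omega>. h t * ennreal (ext0 u (Y (s + t) \<omega>)) \<partial>law Z (Some x)) \<partial>lborel)"
    by (intro nn_integral_cong) (simp add: ennreal_P[OF u] nn_integral_cmult[OF 2])
  also have "\<dots> = (\<integral>\<^sup>+ \<omega>. (\<integral>\<^sup>+ t. h t * ennreal (ext0 u (Y (s + t) \<omega>)) \<partial>lborel) \<partial>law Z (Some x))"
    by (rule Fubini'[OF 1, symmetric])
  finally show ?thesis .
qed

text \<open>The integral over the paths is the inner one, so R is the Laplace transform of t
  \<mapsto> P_t u(x). For a > 0 Fubini identifies it with \<open>tc_resolvent\<close>; a = 0 is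
  included and gives the Green potential.\<close>

definition R :: "real \<Rightarrow> ('a \<Rightarrow> real) \<Rightarrow> 'a \<Rightarrow> real" where
  "R a u x = (\<integral>t. indicator {0..} t * (exp (- a * t) * P t u x) \<partial>lborel)"

lemma integrable_exp_Ici: "0 < a \<Longrightarrow> integrable lborel (\<lambda>t. indicator {0..} t * exp (- a * t) :: real)"
  and integral_exp_Ici: "0 < a \<Longrightarrow> (\<integral>t. indicator {0..} t * exp (- a * t) \<partial>lborel) = 1 / (a :: real)"
proof -
  assume a: "0 < a"
  have "has_bochner_integral lborel (\<lambda>x. exp (- x * a) * indicator {0 ..} x) (1 / a)"
  proof -
    have "filterlim (\<lambda>x. - x * a) at_bot at_top"
      using filterlim_tendsto_pos_mult_at_top[OF tendsto_const a filterlim_ident]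
      by (simp add: filterlim_uminus_at_bot mult.commute)
    from filterlim_compose[OF exp_at_bot this]
    have "((\<lambda>x. - exp (- x * a) / a) \<longlongrightarrow> - 0 / a) at_top"
      using a by (intro tendsto_intros) auto
    then have lim: "((\<lambda>x. - exp (- x * a) / a) \<longlongrightarrow> 0) at_top" by simp
    have "(\<integral>\<^sup>+ x. ennreal (exp (- x * a)) * indicator {0..} x \<partial>lborel) = ennreal (0 - (- exp (- 0 * a) / a))"
      using a by (intro nn_integral_FTC_atLeast[OF _ _ _ lim]) (auto intro!: derivative_eq_intros)
    then have "(\<integral>\<^sup>+ x. ennreal (exp (- x * a) * indicator {0..} x) \<partial>lborel) = ennreal (1 / a)"
      by (simp add: ennreal_mult' ennreal_indicator)
    then show ?thesis using a by (intro has_bochner_integral_nn_integral) auto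
  qed
  then show "integrable lborel (\<lambda>t. indicator {0..} t * exp (- a * t) :: real)"
    "(\<integral>t. indicator {0..} t * exp (- a * t) \<partial>lborel) = 1 / (a :: real)"
    by (auto simp: has_bochner_integral_iff mult.commute)
qed

lemma tc_resolvent_eq:
  assumes u: "u \<in> bounded_borel" and a: "0 < a"
  shows "tc_resolvent Z A a u x = R a u x"
proof -
  interpret pair_sigma_finite lborel "law Z (Some x)" by (rule pair_sigma_finite_law)
  interpret L: prob_space "law Z (Some x)" by (rule prob_law)
  from u obtain c where um [measurable]: "u \<in> borel_measurable borel" and c: "0 \<le> c" "\<And>x. \<bar>u x\<bar> \<le> c"
    unfolding bounded_borel_iff by blast
  have c': "\<bar>ext0 u z\<bar> \<le> c" for z using c by (cases z) auto
  let ?f = "\<lambda>t \<omega>. indicator {0..} t * (exp (- a * t) * ext0 u (Y t \<omega>)) :: real"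
  have m: "case_prod ?f \<in> borel_measurable (lborel \<Otimes>\<^sub>M law Z (Some x))"
    unfolding case_prod_beta by measurable
  have "integrable (lborel \<Otimes>\<^sub>M law Z (Some x)) (\<lambda>z. c * (indicator {0..} (fst z) * exp (- a * fst z)) :: real)"
  proof (rule Fubini_integrable)
    have "(\<integral>\<omega>. norm (c * (indicator {0..} t * exp (- a * t)) :: real) \<partial>law Z (Some x)) = c * (indicator {0..} t * exp (- a * t))" for t
      using c L.prob_space by (simp add: abs_mult)
    then show "integrable lborel (\<lambda>t. \<integral>\<omega>. norm (c * (indicator {0..} (fst (t, \<omega>)) * exp (- a * fst (t, \<omega>))) :: real) \<partial>law Z (Some x))"
      using integrable_exp_Ici[OF a] by (simp add: integrable_mult_right)
  qed auto
  then have int: "integrable (lborel \<Otimes>\<^sub>M law Z (Some x)) (case_prod ?f)"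
    by (rule Bochner_Integration.integrable_bound[OF _ m])
      (use c' c in \<open>auto intro!: AE_I2 mult_mono simp: abs_mult split: split_indicator\<close>)
  have "tc_resolvent Z A a u x = (\<integral>\<omega>. (\<integral>t. ?f t \<omega> \<partial>lborel) \<partial>law Z (Some x))"
    unfolding tc_resolvent_def set_lebesgue_integral_def Y_def[symmetric] by simp
  also have "\<dots> = (\<integral>t. (\<integral>\<omega>. ?f t \<omega> \<partial>law Z (Some x)) \<partial>lborel)"
    by (rule Fubini_integral[OF int])
  also have "\<dots> = R a u x" unfolding R_def P_eq by simp
  finally show ?thesis .
qed

end

section \<open>Green potentials of the time-changed process: integrability and bounds\<close>

locale green_potential = time_change Z A \<Lambda>
  for Z :: "('w, 'a::{metric_space, second_countable_topology}) process" and A \<Lambda> +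
  fixes \<mu> :: "'a measure" and g :: "'a \<Rightarrow> 'a \<Rightarrow> ennreal"
  assumes mu_sets [measurable_cong]: "sets \<mu> = sets borel"
    and g_lsc: "open {(x, y). c < g x y}"
    and g_pos: "0 < g x y"
    and pot: "u \<in> bounded_borel \<Longrightarrow> (\<And>y. 0 \<le> u y) \<Longrightarrow>
      (\<integral>\<^sup>+ \<omega>. (\<integral>\<^sup>+ s\<in>{0..}. ennreal (ext0 u (Y s \<omega>)) \<partial>lborel) \<partial>law Z (Some x)) = (\<integral>\<^sup>+ y. g x y * ennreal (u y) \<partial>\<mu>)"
    and g_fin: "(\<integral>\<^sup>+ y. g x y \<partial>\<mu>) < top"
    and g_C0: "(\<lambda>x. enn2real (\<integral>\<^sup>+ y. g x y \<partial>\<mu>)) \<in> C0"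
begin

lemma nn_P_pot:
  assumes "u \<in> bounded_borel" "\<And>y. 0 \<le> u y"
  shows "(\<integral>\<^sup>+ t. indicator {0..} t * ennreal (P t u x) \<partial>lborel) = (\<integral>\<^sup>+ y. g x y * ennreal (u y) \<partial>\<mu>)"
  using nn_integral_P_swap[OF assms, of "indicator {0..}" 0 x] pot[OF assms, of x] by (simp add: mult.commute)

lemma integrable_P_one: "integrable lborel (\<lambda>t. indicator {0..} t * P t (\<lambda>_. 1) x)"
proof (rule integrableI_nonneg)
  show "AE t in lborel. 0 \<le> indicator {0..} t * P t (\<lambda>_. 1) x" by (simp add: P_nonneg)
  have "(\<integral>\<^sup>+ t. ennreal (indicator {0..} t * P t (\<lambda>_. 1) x) \<partial>lborel) = (\<integral>\<^sup>+ t. indicator {0..} t * ennreal (P t (\<lambda>_. 1) x) \<partial>lborel)"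
    by (intro nn_integral_cong) (auto split: split_indicator)
  also have "\<dots> < \<infinity>" using nn_P_pot[OF bounded_borel_const, of 1 x] g_fin[of x] by simp
  finally show "(\<integral>\<^sup>+ t. ennreal (indicator {0..} t * P t (\<lambda>_. 1) x) \<partial>lborel) < \<infinity>" .
qed measurable

lemma integrable_P:
  assumes "u \<in> bounded_borel" shows "integrable lborel (\<lambda>t. indicator {0..} t * P t u x)"
proof -
  from assms obtain c where um [measurable]: "u \<in> borel_measurable borel" and c: "0 \<le> c" "\<And>x. \<bar>u x\<bar> \<le> c"
    unfolding bounded_borel_iff by blast
  have "norm (indicator {0..} t * P t u x) \<le> norm (c * (indicator {0..} t * P t (\<lambda>_. 1) x))" for t
    using order_trans[OF P_abs_le_one[OF um c(2), of t x] abs_ge_self] by (auto simp: abs_mult split: split_indicator)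
  then show ?thesis
    by (intro Bochner_Integration.integrable_bound[OF integrable_mult_right[OF integrable_P_one, of c x]]) auto
qed

lemma integrable_exp_P:
  assumes "u \<in> bounded_borel" "0 \<le> a" shows "integrable lborel (\<lambda>t. indicator {0..} t * (exp (- a * t) * P t u x))"
proof (rule Bochner_Integration.integrable_bound[OF integrable_P[OF assms(1), of x]])
  have [measurable]: "u \<in> borel_measurable borel" using assms by (simp add: bounded_borel_def)
  show "(\<lambda>t. indicator {0..} t * (exp (- a * t) * P t u x)) \<in> borel_measurable lborel" by measurable
  show "AE t in lborel. norm (indicator {0..} t * (exp (- a * t) * P t u x)) \<le> norm (indicator {0..} t * P t u x)"
    using assms(2) by (auto simp: abs_mult intro!: mult_left_le_one_le AE_I2 split: split_indicator)
qed

lemma R_lin: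
  assumes "u \<in> bounded_borel" "v \<in> bounded_borel" "0 \<le> a"
  shows "R a (\<lambda>y. c * u y + d * v y) x = c * R a u x + d * R a v x"
proof -
  have "R a (\<lambda>y. c * u y + d * v y) x = (\<integral>t. c * (indicator {0..} t * (exp (- a * t) * P t u x)) + d * (indicator {0..} t * (exp (- a * t) * P t v x)) \<partial>lborel)"
    unfolding R_def P_lin[OF assms(1,2)] by (intro Bochner_Integration.integral_cong) (auto simp: algebra_simps)
  also have "\<dots> = c * R a u x + d * R a v x"
    unfolding R_def using assms
    by (subst Bochner_Integration.integral_add) (simp_all only: integrable_mult_right integrable_exp_P integral_mult_right_zero)
  finally show ?thesis .
qed

lemma R_add: "u \<in> bounded_borel \<Longrightarrow> v \<in> bounded_borel \<Longrightarrow> 0 \<le> a \<Longrightarrow> R a (\<lambda>y. u y + v y) x = R a u x + R a v x"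
  and R_diff: "u \<in> bounded_borel \<Longrightarrow> v \<in> bounded_borel \<Longrightarrow> 0 \<le> a \<Longrightarrow> R a (\<lambda>y. u y - v y) x = R a u x - R a v x"
  and R_cmult: "u \<in> bounded_borel \<Longrightarrow> 0 \<le> a \<Longrightarrow> R a (\<lambda>y. c * u y) x = c * R a u x"
  using R_lin[of u v a 1 1 x] R_lin[of u v a 1 "-1" x] R_lin[of u u a c 0 x] by simp_all

lemma R_nonneg: "(\<And>y. 0 \<le> u y) \<Longrightarrow> 0 \<le> R a u x"
  unfolding R_def by (intro integral_nonneg_AE AE_I2 mult_nonneg_nonneg P_nonneg) auto

lemma R_mono: "u \<in> bounded_borel \<Longrightarrow> v \<in> bounded_borel \<Longrightarrow> 0 \<le> a \<Longrightarrow> (\<And>y. u y \<le> v y) \<Longrightarrow> R a u x \<le> R a v x"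
  using R_nonneg[of "\<lambda>y. v y - u y" a x] by (simp add: R_diff)

lemma ennreal_R:
  assumes "u \<in> bounded_borel" "\<And>y. 0 \<le> u y" "0 \<le> a"
  shows "ennreal (R a u x) = (\<integral>\<^sup>+ t. (indicator {0..} t * ennreal (exp (- a * t))) * ennreal (P t u x) \<partial>lborel)"
proof -
  have "ennreal (R a u x) = (\<integral>\<^sup>+ t. ennreal (indicator {0..} t * (exp (- a * t) * P t u x)) \<partial>lborel)"
    unfolding R_def using assms
    by (intro nn_integral_eq_integral[symmetric] integrable_exp_P AE_I2 mult_nonneg_nonneg P_nonneg) auto
  also have "\<dots> = (\<integral>\<^sup>+ t. (indicator {0..} t * ennreal (exp (- a * t))) * ennreal (P t u x) \<partial>lborel)"
    by (intro nn_integral_cong) (auto simp: ennreal_mult' split: split_indicator)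
  finally show ?thesis .
qed

lemma ennreal_R0:
  assumes "u \<in> bounded_borel" "\<And>y. 0 \<le> u y"
  shows "ennreal (R 0 u x) = (\<integral>\<^sup>+ y. g x y * ennreal (u y) \<partial>\<mu>)"
  using ennreal_R[OF assms, of 0 x] nn_P_pot[OF assms, of x] by simp

lemma R_abs_le_one:
  assumes "u \<in> borel_measurable borel" "\<And>y. \<bar>u y\<bar> \<le> c" "0 \<le> a"
  shows "\<bar>R a u x\<bar> \<le> c * R a (\<lambda>_. 1) x"
proof -
  have u: "u \<in> bounded_borel" by (rule bounded_borelI[OF assms(1,2)])
  have "\<bar>R a u x\<bar> \<le> (\<integral>t. \<bar>indicator {0..} t * (exp (- a * t) * P t u x)\<bar> \<partial>lborel)"
    unfolding R_def by (rule integral_abs_bound)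
  also have "\<dots> \<le> (\<integral>t. c * (indicator {0..} t * (exp (- a * t) * P t (\<lambda>_. 1) x)) \<partial>lborel)"
  proof (intro integral_mono integrable_abs integrable_mult_right integrable_exp_P u bounded_borel_const assms)
    fix t show "\<bar>indicator {0..} t * (exp (- a * t) * P t u x)\<bar> \<le> c * (indicator {0..} t * (exp (- a * t) * P t (\<lambda>_. 1) x))"
      using P_abs_le_one[OF assms(1,2), of t x] by (auto simp: abs_mult algebra_simps split: split_indicator)
  qed
  finally show ?thesis by (simp add: R_def)
qed

lemma R_one_antimono:
  assumes "0 \<le> a" shows "R a (\<lambda>_. 1) x \<le> R 0 (\<lambda>_. 1) x"
  unfolding R_def
proof (intro integral_mono integrable_exp_P bounded_borel_const assms)
  fix t show "indicator {0..} t * (exp (- a * t) * P t (\<lambda>_. 1) x) \<le> indicator {0..} t * (exp (- 0 * t) * P t (\<lambda>_. 1) x)"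
    using assms P_nonneg[of "\<lambda>_. 1" t x] by (auto intro!: mult_left_le_one_le split: split_indicator)
qed simp

lemma R_one_le:
  assumes "0 < a" shows "a * R a (\<lambda>_. 1) x \<le> 1"
proof -
  have "R a (\<lambda>_. 1) x \<le> (\<integral>t. indicator {0..} t * exp (- a * t) \<partial>lborel)"
    unfolding R_def
  proof (intro integral_mono integrable_exp_P bounded_borel_const integrable_exp_Ici assms)
    show "0 \<le> a" using assms by simp
    fix t show "indicator {0..} t * (exp (- a * t) * P t (\<lambda>_. 1) x) \<le> indicator {0..} t * exp (- a * t)"
      using P_one_le[of t x] by (auto split: split_indicator)
  qed
  then show ?thesis unfolding integral_exp_Ici[OF assms] using assms by (simp add: field_simps)
qed

lemma R_abs_le:
  assumes "u \<in> borel_measurable borel" "\<And>y. \<bar>u y\<bar> \<le> c" "0 < a" shows "\<bar>a * R a u x\<bar> \<le> c"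
proof -
  have "0 \<le> c" using assms(2)[of undefined] abs_ge_zero order_trans by blast
  have "\<bar>a * R a u x\<bar> \<le> a * (c * R a (\<lambda>_. 1) x)"
    using R_abs_le_one[of u c a x] assms by (simp add: abs_mult)
  also have "\<dots> = c * (a * R a (\<lambda>_. 1) x)" by simp
  also have "\<dots> \<le> c" using mult_left_mono[OF R_one_le[OF assms(3), of x] \<open>0 \<le> c\<close>] by simp
  finally show ?thesis .
qed

end

section \<open>Continuity of potentials\<close>

lemma C0I:
  assumes "continuous_on UNIV u" "\<And>\<epsilon>. 0 < \<epsilon> \<Longrightarrow> \<exists>K. compact K \<and> (\<forall>x. x \<notin> K \<longrightarrow> \<bar>u x\<bar> < \<epsilon>)"
  shows "u \<in> C0"
  using assms by (simp add: C0_def)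

lemma C0_continuous: "u \<in> C0 \<Longrightarrow> continuous_on UNIV u"
  by (simp add: C0_def)

lemma C0_vanish:
  assumes "u \<in> C0" "0 < \<epsilon>" obtains K where "compact K" "\<And>x. x \<notin> K \<Longrightarrow> \<bar>u x\<bar> < \<epsilon>"
  using assms unfolding C0_def by blast

lemma C0_bounded:
  fixes u :: "'a::topological_space \<Rightarrow> real"
  assumes "u \<in> C0" obtains c where "0 \<le> c" "\<And>x. \<bar>u x\<bar> \<le> c"
proof -
  obtain K where K: "compact K" "\<And>x. x \<notin> K \<Longrightarrow> \<bar>u x\<bar> < 1" using C0_vanish[OF assms, of 1] by auto
  have "compact (u ` K)"
    by (intro compact_continuous_image K continuous_on_subset[OF C0_continuous[OF assms]]) auto
  then obtain b where "\<forall>y\<in>u ` K. norm y \<le> b" using compact_imp_bounded bounded_iff by metis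
  then have b: "\<bar>u x\<bar> \<le> b" if "x \<in> K" for x using that by simp
  have "\<bar>u x\<bar> \<le> max b 1" for x using b[of x] K(2)[of x] by (cases "x \<in> K") auto
  then show ?thesis using that[of "max b 1"] by auto
qed

lemma C0_bounded_borel:
  fixes u :: "'a::topological_space \<Rightarrow> real"
  assumes "u \<in> C0" shows "u \<in> bounded_borel"
  using C0_bounded[OF assms] borel_measurable_continuous_onI[OF C0_continuous[OF assms]] bounded_borelI by metis

lemma C0_dominated:
  fixes u w :: "'a::topological_space \<Rightarrow> real"
  assumes "continuous_on UNIV u" "w \<in> C0" "\<And>x. \<bar>u x\<bar> \<le> \<bar>w x\<bar>"
  shows "u \<in> C0"
proof (rule C0I[OF assms(1)])
  fix \<epsilon> :: real assume "0 < \<epsilon>"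
  with assms(2) obtain K where "compact K" "\<And>x. x \<notin> K \<Longrightarrow> \<bar>w x\<bar> < \<epsilon>" by (rule C0_vanish) blast
  then show "\<exists>K. compact K \<and> (\<forall>x. x \<notin> K \<longrightarrow> \<bar>u x\<bar> < \<epsilon>)"
    using assms(3) by (meson le_less_trans)
qed

lemma C0_abs_add:
  fixes u v :: "'a::topological_space \<Rightarrow> real"
  assumes "u \<in> C0" "v \<in> C0" shows "(\<lambda>x. \<bar>u x\<bar> + \<bar>v x\<bar>) \<in> C0"
proof (rule C0I)
  show "continuous_on UNIV (\<lambda>x. \<bar>u x\<bar> + \<bar>v x\<bar>)"
    using assms by (intro continuous_intros C0_continuous)
  fix \<epsilon> :: real assume e: "0 < \<epsilon>"
  obtain K where K: "compact K" "\<And>x. x \<notin> K \<Longrightarrow> \<bar>u x\<bar> < \<epsilon> / 2" using C0_vanish[OF assms(1), of "\<epsilon> / 2"] e by auto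
  obtain L where L: "compact L" "\<And>x. x \<notin> L \<Longrightarrow> \<bar>v x\<bar> < \<epsilon> / 2" using C0_vanish[OF assms(2), of "\<epsilon> / 2"] e by auto
  have "\<bar>\<bar>u x\<bar> + \<bar>v x\<bar>\<bar> < \<epsilon>" if "x \<notin> K \<union> L" for x
    using K(2)[of x] L(2)[of x] that by auto
  then show "\<exists>K. compact K \<and> (\<forall>x. x \<notin> K \<longrightarrow> \<bar>\<bar>u x\<bar> + \<bar>v x\<bar>\<bar> < \<epsilon>)"
    using compact_Un[OF K(1) L(1)] by blast
qed

lemma C0_cmult:
  fixes u :: "'a::topological_space \<Rightarrow> real"
  assumes "u \<in> C0" shows "(\<lambda>x. a * u x) \<in> C0"
proof (rule C0I)
  show "continuous_on UNIV (\<lambda>x. a * u x)" using assms by (intro continuous_intros C0_continuous)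
  fix \<epsilon> :: real assume e: "0 < \<epsilon>"
  obtain K where K: "compact K" "\<And>x. x \<notin> K \<Longrightarrow> \<bar>u x\<bar> < \<epsilon> / (\<bar>a\<bar> + 1)"
    using C0_vanish[OF assms, of "\<epsilon> / (\<bar>a\<bar> + 1)"] e by auto
  have "\<bar>a * u x\<bar> < \<epsilon>" if "x \<notin> K" for x
  proof -
    have "\<bar>a * u x\<bar> \<le> (\<bar>a\<bar> + 1) * \<bar>u x\<bar>" by (simp add: abs_mult algebra_simps)
    also have "\<dots> < \<epsilon>" using K(2)[OF that] by (simp add: pos_less_divide_eq mult.commute)
    finally show ?thesis .
  qed
  then show "\<exists>K. compact K \<and> (\<forall>x. x \<notin> K \<longrightarrow> \<bar>a * u x\<bar> < \<epsilon>)" using K(1) by blast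
qed

lemma C0_add:
  fixes u v :: "'a::topological_space \<Rightarrow> real"
  assumes "u \<in> C0" "v \<in> C0" shows "(\<lambda>x. u x + v x) \<in> C0"
  by (rule C0_dominated[OF _ C0_abs_add[OF assms]])
    (auto intro!: continuous_intros C0_continuous[OF assms(1)] C0_continuous[OF assms(2)])

lemma C0_diff:
  fixes u v :: "'a::topological_space \<Rightarrow> real"
  assumes "u \<in> C0" "v \<in> C0" shows "(\<lambda>x. u x - v x) \<in> C0"
  by (rule C0_dominated[OF _ C0_abs_add[OF assms]])
    (auto intro!: continuous_intros C0_continuous[OF assms(1)] C0_continuous[OF assms(2)])

lemma C0_min:
  fixes u v :: "'a::topological_space \<Rightarrow> real"
  assumes "u \<in> C0" "v \<in> C0" shows "(\<lambda>x. min (u x) (v x)) \<in> C0"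
proof (rule C0_dominated[OF _ C0_abs_add[OF assms]])
  show "continuous_on UNIV (\<lambda>x. min (u x) (v x))"
    by (intro continuous_on_min C0_continuous assms)
qed (auto simp: min_def)

lemma C0_zero: "(\<lambda>_. 0) \<in> C0"
  by (auto simp: C0_def)

lemma C0_uniform_closed:
  fixes u :: "'a::topological_space \<Rightarrow> real"
  assumes "\<And>\<epsilon>. 0 < \<epsilon> \<Longrightarrow> \<exists>g\<in>C0. \<forall>x. \<bar>u x - g x\<bar> \<le> \<epsilon>"
  shows "u \<in> C0"
proof (rule C0I)
  have "\<exists>G. \<forall>n. G n \<in> C0 \<and> (\<forall>x. \<bar>u x - G n x\<bar> \<le> 1 / real (Suc n))"
  proof (intro choice allI)
    fix n
    have "0 < 1 / real (Suc n)" by simp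
    from assms[OF this] show "\<exists>g. g \<in> C0 \<and> (\<forall>x. \<bar>u x - g x\<bar> \<le> 1 / real (Suc n))" by blast
  qed
  then obtain G where G: "\<And>n. G n \<in> C0" "\<And>n x. \<bar>u x - G n x\<bar> \<le> 1 / real (Suc n)" by blast
  have "uniform_limit UNIV G u sequentially"
  proof (rule uniform_limitI)
    fix e :: real assume "0 < e"
    then obtain N where N: "1 / real (Suc N) < e" using nat_approx_posE by blast
    have "dist (G n x) (u x) < e" if "n \<ge> N" for n x
    proof -
      have "1 / real (Suc n) \<le> 1 / real (Suc N)" using that by (simp add: frac_le)
      then show ?thesis using G(2)[of x n] N by (simp add: dist_real_def abs_minus_commute)
    qed
    then show "\<forall>\<^sub>F n in sequentially. \<forall>x\<in>UNIV. dist (G n x) (u x) < e"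
      by (auto simp: eventually_sequentially)
  qed
  then show "continuous_on UNIV u"
    by (rule uniform_limit_theorem[rotated]) (auto intro!: always_eventually C0_continuous G(1))
  fix \<epsilon> :: real assume e: "0 < \<epsilon>"
  then obtain g where g: "g \<in> C0" "\<And>x. \<bar>u x - g x\<bar> \<le> \<epsilon> / 2" using assms[of "\<epsilon> / 2"] by auto
  obtain K where K: "compact K" "\<And>x. x \<notin> K \<Longrightarrow> \<bar>g x\<bar> < \<epsilon> / 2" using C0_vanish[OF g(1), of "\<epsilon> / 2"] e by auto
  have "\<bar>u x\<bar> < \<epsilon>" if "x \<notin> K" for x using K(2)[OF that] g(2)[of x] by linarith
  then show "\<exists>K. compact K \<and> (\<forall>x. x \<notin> K \<longrightarrow> \<bar>u x\<bar> < \<epsilon>)" using K(1) by blast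
qed

text \<open>The resolvent equation for a single function of time. With r = t + s, the integral over
  0 \<le> t \<le> r of exp (- b t) exp (- a (r - t)) equals (exp (- b r) - exp (- a r)) / (a -
  b).\<close>

lemma laplace_iterated:
  fixes q :: "real \<Rightarrow> real"
  assumes q: "integrable lborel (\<lambda>t. indicator {0..} t * q t)" and [measurable]: "q \<in> borel_measurable borel"
    and a: "0 \<le> a" and b: "0 \<le> b" and ab: "a \<noteq> b"
  shows "(a - b) * (\<integral>t. indicator {0..} t * (exp (- b * t) * (\<integral>s. indicator {0..} s * (exp (- a * s) * q (t + s)) \<partial>lborel)) \<partial>lborel)
    = (\<integral>t. indicator {0..} t * (exp (- b * t) * q t) \<partial>lborel) - (\<integral>t. indicator {0..} t * (exp (- a * t) * q t) \<partial>lborel)"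
proof -
  define E where "E r t = indicator {0..r} t * (exp (- b * t) * exp (- a * (r - t)))" for r t :: real
  have [measurable]: "case_prod E \<in> borel_measurable (lborel \<Otimes>\<^sub>M lborel)"
  proof -
    have "case_prod E = (\<lambda>z. if 0 \<le> snd z \<and> snd z \<le> fst z then exp (- b * snd z) * exp (- a * (fst z - snd z)) else 0)"
      by (auto simp: E_def)
    then show ?thesis by simp
  qed
  have E_int: "has_bochner_integral lborel (E r) ((exp (- b * r) - exp (- a * r)) / (a - b))" if r: "0 \<le> r" for r
  proof -
    have "has_bochner_integral lborel (\<lambda>t. exp (- b * t) * exp (- a * (r - t)) * indicator {0..r} t)
      (exp (- b * r) * exp (- a * (r - r)) / (a - b) - exp (- b * 0) * exp (- a * (r - 0)) / (a - b))"
    proof (rule has_bochner_integral_FTC_Icc_real[OF r])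
      fix t
      have "DERIV (\<lambda>t. exp (- b * t) * exp (- a * (r - t)) / (a - b)) t :>
         (exp (- b * t) * (exp (- a * (r - t)) * a) + exp (- b * t) * - b * exp (- a * (r - t))) / (a - b)"
        using ab by (auto intro!: derivative_eq_intros)
      also have "(exp (- b * t) * (exp (- a * (r - t)) * a) + exp (- b * t) * - b * exp (- a * (r - t))) / (a - b)
        = exp (- b * t) * exp (- a * (r - t))"
      proof -
        have "exp (- b * t) * (exp (- a * (r - t)) * a) + exp (- b * t) * - b * exp (- a * (r - t))
          = (a - b) * (exp (- b * t) * exp (- a * (r - t)))" by (simp add: left_diff_distrib)
        then show ?thesis using ab by (simp del: mult_exp_exp exp_le_one_iff)
      qed
      finally show "DERIV (\<lambda>t. exp (- b * t) * exp (- a * (r - t)) / (a - b)) t :> exp (- b * t) * exp (- a * (r - t))" .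
    qed (auto intro!: continuous_intros)
    then show ?thesis unfolding E_def by (simp add: mult.commute diff_divide_distrib)
  qed
  have E_nonneg: "0 \<le> E r t" for r t by (simp add: E_def)
  have E_neg: "E r t = 0" if "r < 0" for r t using that by (auto simp: E_def)
  define F where "F r t = E r t * q r" for r t
  have F_r: "(\<integral>t. F r t \<partial>lborel) = indicator {0..} r * ((exp (- b * r) - exp (- a * r)) / (a - b) * q r)" for r
    using E_int[of r] E_neg[of r] by (cases "0 \<le> r") (auto simp: F_def has_bochner_integral_iff)
  have F_abs: "(\<integral>t. norm (F r t) \<partial>lborel) = indicator {0..} r * ((exp (- b * r) - exp (- a * r)) / (a - b) * \<bar>q r\<bar>)" for r
    using E_int[of r] E_neg[of r] by (cases "0 \<le> r") (auto simp: F_def abs_mult E_nonneg has_bochner_integral_iff)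
  have int: "integrable (lborel \<Otimes>\<^sub>M lborel) (case_prod F)"
  proof (rule lborel_pair.Fubini_integrable)
    show "case_prod F \<in> borel_measurable (lborel \<Otimes>\<^sub>M lborel)"
    proof -
      have "(\<lambda>z. case_prod E z * q (fst z)) \<in> borel_measurable (lborel \<Otimes>\<^sub>M lborel)" by measurable
      moreover have "case_prod F = (\<lambda>z. case_prod E z * q (fst z))" by (auto simp: F_def)
      ultimately show ?thesis by (simp only:)
    qed
    show "integrable lborel (\<lambda>x. \<integral>y. norm (case (x, y) of (x, y) \<Rightarrow> F x y) \<partial>lborel)"
      unfolding prod.case F_abs
    \<comment> \<open>The difference of two exponentials in (0, 1] is at most 1 in absolute value.
      So integrability of q itself carries the estimate, and a or b may be 0.\<close>
    proof (rule Bochner_Integration.integrable_bound[OF integrable_mult_right[OF q, of "1 / (a - b)"]])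
      show "AE r in lborel. norm (indicator {0..} r * ((exp (- b * r) - exp (- a * r)) / (a - b) * \<bar>q r\<bar>))
         \<le> norm (1 / (a - b) * (indicator {0..} r * q r))"
      proof (rule AE_I2)
        fix r
        have "\<bar>exp (- b * r) - exp (- a * r)\<bar> \<le> 1" if "0 \<le> r"
        proof -
          have "exp (- b * r) \<le> 1" "exp (- a * r) \<le> 1" "0 < exp (- b * r)" "0 < exp (- a * r)"
            using a b that by auto
          then show ?thesis by linarith
        qed
        then show "norm (indicator {0..} r * ((exp (- b * r) - exp (- a * r)) / (a - b) * \<bar>q r\<bar>))
         \<le> norm (1 / (a - b) * (indicator {0..} r * q r))"
          by (auto simp: abs_mult abs_divide intro!: divide_right_mono mult_left_le_one_le split: split_indicator)
      qed
    qed measurable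
    show "AE x in lborel. integrable lborel (\<lambda>y. case (x, y) of (x, y) \<Rightarrow> F x y)"
    proof (rule AE_I2)
      fix r show "integrable lborel (\<lambda>y. case (r, y) of (x, y) \<Rightarrow> F x y)"
        using E_int[of r] E_neg[of r] by (cases "0 \<le> r") (auto simp: F_def has_bochner_integral_iff)
    qed
  qed
  have inner: "(\<integral>s. indicator {0..} s * (exp (- a * s) * q (t + s)) \<partial>lborel) = (\<integral>r. indicator {t..} r * (exp (- a * (r - t)) * q r) \<partial>lborel)" for t
    by (subst lborel_integral_real_affine[where c = 1 and t = t])
      (auto intro!: Bochner_Integration.integral_cong simp: indicator_def)
  have "(\<integral>t. indicator {0..} t * (exp (- b * t) * (\<integral>s. indicator {0..} s * (exp (- a * s) * q (t + s)) \<partial>lborel)) \<partial>lborel)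
    = (\<integral>t. (\<integral>r. F r t \<partial>lborel) \<partial>lborel)"
    unfolding inner integral_mult_right_zero[symmetric]
    by (intro Bochner_Integration.integral_cong refl) (auto simp: F_def E_def split: split_indicator)
  also have "\<dots> = (\<integral>r. (\<integral>t. F r t \<partial>lborel) \<partial>lborel)" by (rule lborel_pair.Fubini_integral[OF int])
  also have "\<dots> = (\<integral>r. (indicator {0..} r * (exp (- b * r) * q r) - indicator {0..} r * (exp (- a * r) * q r)) / (a - b) \<partial>lborel)"
    unfolding F_r by (intro Bochner_Integration.integral_cong refl) (auto simp: algebra_simps diff_divide_distrib split: split_indicator)
  also have "\<dots> = ((\<integral>t. indicator {0..} t * (exp (- b * t) * q t) \<partial>lborel) - (\<integral>t. indicator {0..} t * (exp (- a * t) * q t) \<partial>lborel)) / (a - b)"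
  proof -
    have "integrable lborel (\<lambda>t. indicator {0..} t * (exp (- c * t) * q t))" if "0 \<le> c" for c
      by (rule Bochner_Integration.integrable_bound[OF q])
        (use that in \<open>auto simp: abs_mult intro!: mult_left_le_one_le AE_I2 split: split_indicator\<close>)
    then show ?thesis using a b by simp
  qed
  finally show ?thesis using ab by simp
qed

section \<open>Continuity of Green potentials\<close>

context green_potential begin

lemma g_measurable [measurable]: "g x \<in> borel_measurable borel"
proof (rule borel_measurableI_greater)
  fix c
  have "{y. c < g x y} = (\<lambda>y. (x, y)) -` {(x, y). c < g x y}" by auto
  also have "open \<dots>" by (rule open_vimage[OF g_lsc]) (intro continuous_intros)
  finally show "{y \<in> space borel. c < g x y} \<in> sets borel" by simp
qed

lemma potential_lsc:
  assumes X: "X \<longlonglongrightarrow> x" and u [measurable]: "u \<in> borel_measurable borel"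
  shows "(\<integral>\<^sup>+ y. g x y * ennreal (u y) \<partial>\<mu>) \<le> liminf (\<lambda>n. \<integral>\<^sup>+ y. g (X n) y * ennreal (u y) \<partial>\<mu>)"
proof -
  \<comment> \<open>Moving u into the measure leaves the kernel alone under Fatou's lemma, where
    lower semicontinuity applies pointwise.\<close>
  let ?D = "density \<mu> (\<lambda>y. ennreal (u y))"
  have D: "(\<integral>\<^sup>+ y. g z y * ennreal (u y) \<partial>\<mu>) = (\<integral>\<^sup>+ y. g z y \<partial>?D)" for z
    by (subst nn_integral_density) (simp_all add: mult.commute)
  have "(\<integral>\<^sup>+ y. g x y \<partial>?D) \<le> (\<integral>\<^sup>+ y. liminf (\<lambda>n. g (X n) y) \<partial>?D)"
  proof (rule nn_integral_mono)
    fix y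
    show "g x y \<le> liminf (\<lambda>n. g (X n) y)"
      unfolding le_Liminf_iff
    proof (intro allI impI)
      fix c assume c: "c < g x y"
      have "((\<lambda>n. (X n, y)) \<longlonglongrightarrow> (x, y))" by (intro tendsto_intros X)
      from topological_tendstoD[OF this g_lsc[of c]] c
      show "eventually (\<lambda>n. c < g (X n) y) sequentially" by simp
    qed
  qed
  also have "\<dots> \<le> liminf (\<lambda>n. \<integral>\<^sup>+ y. g (X n) y \<partial>?D)"
    by (rule nn_integral_liminf) measurable
  finally show ?thesis by (simp add: D)
qed

lemma R0_one_C0: "R 0 (\<lambda>_. 1) \<in> C0"
proof -
  have "R 0 (\<lambda>_. 1) x = enn2real (\<integral>\<^sup>+ y. g x y \<partial>\<mu>)" for x
  proof -
    have "ennreal (R 0 (\<lambda>_. 1) x) = (\<integral>\<^sup>+ y. g x y \<partial>\<mu>)"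
      using ennreal_R0[OF bounded_borel_const, of 1 x] by simp
    then show ?thesis using R_nonneg[of "\<lambda>_. 1" 0 x] by (metis enn2real_ennreal zero_le_one)
  qed
  then have "R 0 (\<lambda>_. 1) = (\<lambda>x. enn2real (\<integral>\<^sup>+ y. g x y \<partial>\<mu>))" by blast
  then show ?thesis using g_C0 by simp
qed

lemma R0_unit_C0:
  assumes u: "u \<in> borel_measurable borel" "\<And>x. 0 \<le> u x" "\<And>x. u x \<le> 1"
  shows "R 0 u \<in> C0"
proof -
  have ub: "u \<in> bounded_borel" by (rule bounded_borelI[where c = 1]) (use u in auto)
  let ?v = "\<lambda>x. 1 - u x"
  have vb: "?v \<in> bounded_borel" by (intro bounded_borel_diff bounded_borel_const ub)
  have lsc: "eventually (\<lambda>n. R 0 w x - e < R 0 w (X n)) sequentially"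
    if w: "w \<in> bounded_borel" "\<And>x. 0 \<le> w x" and X: "X \<longlonglongrightarrow> x" and e: "0 < e" for w x X e
  proof (cases "R 0 w x - e < 0")
    case True
    have "R 0 w x - e < R 0 w (X n)" for n using True R_nonneg[of w 0 "X n"] w by (simp add: less_le_trans)
    then show ?thesis by simp
  next
    case False
    have "ennreal (R 0 w x) \<le> liminf (\<lambda>n. ennreal (R 0 w (X n)))"
      unfolding ennreal_R0[OF w] by (rule potential_lsc[OF X]) (use w in \<open>simp add: bounded_borel_def\<close>)
    moreover have "ennreal (R 0 w x - e) < ennreal (R 0 w x)" using False e by (simp add: ennreal_less_iff)
    ultimately have "eventually (\<lambda>n. ennreal (R 0 w x - e) < ennreal (R 0 w (X n))) sequentially"
      unfolding le_Liminf_iff by blast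
    then show ?thesis by eventually_elim (use False in \<open>simp add: ennreal_less_iff\<close>)
  qed
  have sum: "R 0 u x + R 0 ?v x = R 0 (\<lambda>_. 1) x" for x
    using R_add[OF ub vb, of 0 x] by simp
  have "continuous (at x) (R 0 u)" for x
    unfolding continuous_at_sequentially
  proof (intro allI impI)
    fix X assume X: "X \<longlonglongrightarrow> x"
    have w: "(\<lambda>n. R 0 (\<lambda>_. 1) (X n)) \<longlonglongrightarrow> R 0 (\<lambda>_. 1) x"
      using C0_continuous[OF R0_one_C0] X by (auto simp: continuous_on_eq_continuous_at continuous_at_sequentially o_def)
    show "(R 0 u \<circ> X) \<longlonglongrightarrow> R 0 u x"
      unfolding o_def
    proof (rule tendstoI)
      fix e :: real assume e: "0 < e"
      have 1: "eventually (\<lambda>n. R 0 u x - e < R 0 u (X n)) sequentially" by (rule lsc[OF ub u(2) X e])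
      \<comment> \<open>This yields the upper estimate for the potential of u, which is the
        potential of 1 minus that of 1 - u; each of the two contributes an error of e / 2.\<close>
      have 2: "eventually (\<lambda>n. R 0 ?v x - e / 2 < R 0 ?v (X n)) sequentially"
        by (rule lsc[OF vb _ X]) (use u e in auto)
      have 3: "eventually (\<lambda>n. R 0 (\<lambda>_. 1) (X n) < R 0 (\<lambda>_. 1) x + e / 2) sequentially"
        using e by (intro order_tendstoD(2)[OF w]) simp
      from 1 2 3 show "eventually (\<lambda>n. dist (R 0 u (X n)) (R 0 u x) < e) sequentially"
      proof eventually_elim
        case (elim n)
        then show ?case using sum[of x] sum[of "X n"] unfolding dist_real_def by linarith
      qed
    qed
  qed
  then have cont: "continuous_on UNIV (R 0 u)" by (simp add: continuous_on_eq_continuous_at)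
  show ?thesis
  proof (rule C0_dominated[OF cont R0_one_C0])
    fix x
    show "\<bar>R 0 u x\<bar> \<le> \<bar>R 0 (\<lambda>_. 1) x\<bar>"
      using sum[of x] R_nonneg[of u 0 x] R_nonneg[of ?v 0 x] u by simp
  qed
qed

lemma R0_C0:
  assumes "u \<in> bounded_borel" shows "R 0 u \<in> C0"
proof -
  from assms obtain c' where um [measurable]: "u \<in> borel_measurable borel" and c': "\<And>x. \<bar>u x\<bar> \<le> c'"
    unfolding bounded_borel_iff by blast
  define c where "c = \<bar>c'\<bar> + 1"
  have c: "0 < c" "\<bar>u x\<bar> \<le> c" for x using c'[of x] by (auto simp: c_def)
  \<comment> \<open>Affine rescaling into [0, 1]; the summand 1 in c excludes division by 0.\<close>
  define v where "v x = (u x + c) / (2 * c)" for x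
  have v: "0 \<le> v x" "v x \<le> 1" for x using c(1) c(2)[of x] by (auto simp: v_def divide_simps abs_le_iff)
  have vm [measurable]: "v \<in> borel_measurable borel" unfolding v_def by measurable
  have vb: "v \<in> bounded_borel" by (rule bounded_borelI[where c = 1]) (use v in auto)
  have "u = (\<lambda>x. (2 * c) * v x + (- c) * 1)" using c(1) by (auto simp: v_def field_simps)
  then have "R 0 u x = (2 * c) * R 0 v x + (- c) * R 0 (\<lambda>_. 1) x" for x
    using R_lin[OF vb bounded_borel_const, of 0 "2 * c" "- c" 1 x] by simp
  then have "R 0 u = (\<lambda>x. (2 * c) * R 0 v x + (- c) * R 0 (\<lambda>_. 1) x)" by blast
  then show ?thesis using C0_add[OF C0_cmult C0_cmult, of "R 0 v" "R 0 (\<lambda>_. 1)" "2 * c" "- c"]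
    R0_unit_C0[OF vm v] R0_one_C0 by simp
qed

section \<open>The resolvent equation and the passage from a = 0 to all a\<close>

lemma law_None_Y: "AE \<omega> in law Z None. \<forall>t. Y t \<omega> = None"
  using AE_coord_0[of None] AE_space[of "law Z None"]
proof eventually_elim
  case (elim \<omega>)
  then show ?case by (auto simp: Y_def intro: coord_None_mono[of \<omega> 0])
qed

text \<open>A nonnegative functional of the whole path, in the form that
  \<open>strong_markov_aug\<close> accepts. For u \<ge> 0 its P_x-mean is R_a u(x); after a shift by
  \<tau>_t it sees Y from time t on.\<close>

definition laplace_functional :: "real \<Rightarrow> ('a \<Rightarrow> real) \<Rightarrow> 'w \<Rightarrow> ennreal" where
  "laplace_functional a u \<omega> = (\<integral>\<^sup>+ s. (indicator {0..} s * ennreal (exp (- a * s))) * ennreal (ext0 u (Y s \<omega>)) \<partial>lborel)"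

lemma laplace_functional_measurable:
  assumes [measurable]: "u \<in> borel_measurable borel"
  shows "laplace_functional a u \<in> borel_measurable (aug_filt Z top)"
proof -
  have [measurable]: "(\<lambda>z. Y (snd z) (fst z)) \<in> aug_filt Z top \<Otimes>\<^sub>M lborel \<rightarrow>\<^sub>M cem_borel"
    using measurable_compose[OF measurable_Pair[OF measurable_compose[OF measurable_snd, of "\<lambda>x. x" lborel borel "aug_filt Z top"] measurable_fst] Y_joint_aug] by simp
  have "(\<lambda>\<omega>. \<integral>\<^sup>+ s. (indicator {0..} s * ennreal (exp (- a * s))) * ennreal (ext0 u (Y s \<omega>)) \<partial>lborel)
    \<in> borel_measurable (aug_filt Z top)"
    by (rule lborel.borel_measurable_nn_integral) (unfold case_prod_beta, measurable)
  then show ?thesis by (simp add: laplace_functional_def[abs_def])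
qed

lemma laplace_functional_kernel:
  assumes u: "u \<in> bounded_borel" "\<And>y. 0 \<le> u y" and a: "0 \<le> a"
  shows "ext0 (\<lambda>x. ennreal (R a u x)) y = (\<integral>\<^sup>+ \<omega>. laplace_functional a u \<omega> \<partial>law Z y)"
proof (cases y)
  case None
  have "(\<integral>\<^sup>+ \<omega>. laplace_functional a u \<omega> \<partial>law Z None) = (\<integral>\<^sup>+ \<omega>. 0 \<partial>law Z None)"
    by (rule nn_integral_cong_AE, rule eventually_mono[OF law_None_Y]) (simp add: laplace_functional_def)
  then show ?thesis using None by simp
next
  case (Some x)
  have "ennreal (R a u x) = (\<integral>\<^sup>+ \<omega>. laplace_functional a u \<omega> \<partial>law Z (Some x))"
    unfolding ennreal_R[OF u a] laplace_functional_def
    using nn_integral_P_swap[OF u, of "\<lambda>s. indicator {0..} s * ennreal (exp (- a * s))" 0 x] by simp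
  then show ?thesis using Some by simp
qed

lemma P_R_nonneg:
  assumes Rm: "R a u \<in> bounded_borel" and u: "u \<in> bounded_borel" "\<And>y. 0 \<le> u y" and a: "0 \<le> a" and t: "0 \<le> t"
  shows "has_bochner_integral lborel (\<lambda>s. indicator {0..} s * (exp (- a * s) * P (t + s) u x)) (P t (R a u) x)"
proof -
  have um [measurable]: "u \<in> borel_measurable borel" and [measurable]: "R a u \<in> borel_measurable borel"
    using u Rm by (auto simp: bounded_borel_def)
  define h where "h s = indicator {0..} s * ennreal (exp (- a * s))" for s
  have [measurable]: "h \<in> borel_measurable borel" unfolding h_def by measurable
  have "(\<integral>\<^sup>+ s. ennreal (indicator {0..} s * (exp (- a * s) * P (t + s) u x)) \<partial>lborel)
    = (\<integral>\<^sup>+ s. h s * ennreal (P (t + s) u x) \<partial>lborel)"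
    by (intro nn_integral_cong) (auto simp: h_def ennreal_mult' split: split_indicator)
  also have "\<dots> = (\<integral>\<^sup>+ \<omega>. (\<integral>\<^sup>+ s. h s * ennreal (ext0 u (Y (t + s) \<omega>)) \<partial>lborel) \<partial>law Z (Some x))"
    by (rule nn_integral_P_swap[OF u]) simp
  also have "\<dots> = (\<integral>\<^sup>+ \<omega>. laplace_functional a u (shift Z (tau t \<omega>) \<omega>) * indicator (paths Z) \<omega> \<partial>law Z (Some x))"
  proof (rule nn_integral_cong_AE, rule eventually_mono[OF Lam_AE])
    fix \<omega> assume \<omega>: "\<omega> \<in> \<Lambda>"
    have "laplace_functional a u (shift Z (tau t \<omega>) \<omega>) = (\<integral>\<^sup>+ s. h s * ennreal (ext0 u (Y (t + s) \<omega>)) \<partial>lborel)"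
      unfolding laplace_functional_def by (intro nn_integral_cong) (auto simp: h_def Y_shift_tau[OF \<omega> t] split: split_indicator)
    then show "(\<integral>\<^sup>+ s. h s * ennreal (ext0 u (Y (t + s) \<omega>)) \<partial>lborel) = laplace_functional a u (shift Z (tau t \<omega>) \<omega>) * indicator (paths Z) \<omega>"
      using Lam_paths[OF \<omega>] by simp
  qed
  also have "\<dots> = (\<integral>\<^sup>+ \<omega>. ext0 (\<lambda>x. ennreal (R a u x)) (coord Z (tau t \<omega>) \<omega>) * indicator (paths Z) \<omega> \<partial>law Z (Some x))"
    by (rule strong_markov_aug[OF tau_stopping paths_pre_sigma laplace_functional_measurable[OF um] _ laplace_functional_kernel[OF u a]]) measurable
  also have "\<dots> = (\<integral>\<^sup>+ \<omega>. ennreal (ext0 (R a u) (Y t \<omega>)) \<partial>law Z (Some x))"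
    by (intro nn_integral_cong) (simp add: ennreal_ext0 Y_def)
  also have "\<dots> = ennreal (P t (R a u) x)"
    by (rule ennreal_P[symmetric, OF Rm]) (rule R_nonneg[OF u(2)])
  finally have "(\<integral>\<^sup>+ s. ennreal (indicator {0..} s * (exp (- a * s) * P (t + s) u x)) \<partial>lborel) = ennreal (P t (R a u) x)" .
  then show ?thesis
    by (intro has_bochner_integral_nn_integral)
      (auto intro!: P_nonneg[OF R_nonneg[OF u(2)]] AE_I2 mult_nonneg_nonneg P_nonneg[OF u(2)])
qed

lemma P_R:
  assumes Rm: "\<And>u. u \<in> bounded_borel \<Longrightarrow> R a u \<in> bounded_borel" and u: "u \<in> bounded_borel" and a: "0 \<le> a" and t: "0 \<le> t"
  shows "P t (R a u) x = (\<integral>s. indicator {0..} s * (exp (- a * s) * P (t + s) u x) \<partial>lborel)"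
proof -
  from u obtain c where c: "0 \<le> c" "\<And>x. \<bar>u x\<bar> \<le> c" unfolding bounded_borel_iff by blast
  let ?v = "\<lambda>x. u x + c" and ?c = "\<lambda>_ :: 'a. c"
  have v: "?v \<in> bounded_borel" by (intro bounded_borel_add u bounded_borel_const)
  have v0: "0 \<le> ?v y" for y using c(2)[of y] by (simp add: abs_le_iff)
  have 1: "has_bochner_integral lborel (\<lambda>s. indicator {0..} s * (exp (- a * s) * P (t + s) ?v x)) (P t (R a ?v) x)"
    by (rule P_R_nonneg[OF Rm[OF v] v v0 a t])
  have 2: "has_bochner_integral lborel (\<lambda>s. indicator {0..} s * (exp (- a * s) * P (t + s) ?c x)) (P t (R a ?c) x)"
    by (rule P_R_nonneg[OF Rm bounded_borel_const _ a t]) (use c in \<open>auto intro: bounded_borel_const\<close>)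
  have Pu: "P r u x = P r ?v x - P r ?c x" for r
    using P_diff[OF v bounded_borel_const, of r c x] by simp
  have Ru: "R a u = (\<lambda>y. R a ?v y - R a ?c y)"
    using R_diff[OF v bounded_borel_const a, of c] by auto
  have "P t (R a u) x = P t (R a ?v) x - P t (R a ?c) x"
    unfolding Ru by (rule P_diff[OF Rm[OF v] Rm[OF bounded_borel_const]])
  moreover have "has_bochner_integral lborel (\<lambda>s. indicator {0..} s * (exp (- a * s) * P (t + s) u x)) (P t (R a ?v) x - P t (R a ?c) x)"
    using has_bochner_integral_diff[OF 1 2] by (simp add: Pu algebra_simps)
  ultimately show ?thesis by (simp add: has_bochner_integral_iff)
qed

text \<open>Boundedness and measurability of R_a u stand as a hypothesis because at first they are
  known for a = 0 only. They are required for a and not for b; this asymmetry lets the C0 property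
  spread from a to neighbouring b.\<close>

lemma resolvent_equation_aux:
  assumes Rm: "\<And>u. u \<in> bounded_borel \<Longrightarrow> R a u \<in> bounded_borel" and u: "u \<in> bounded_borel" and a: "0 \<le> a" and b: "0 \<le> b"
  shows "R b u x = R a u x + (a - b) * R b (R a u) x"
proof (cases "a = b")
  case False
  have um: "u \<in> borel_measurable borel" using u by (simp add: bounded_borel_def)
  have "R b (R a u) x = (\<integral>t. indicator {0..} t * (exp (- b * t) * (\<integral>s. indicator {0..} s * (exp (- a * s) * P (t + s) u x) \<partial>lborel)) \<partial>lborel)"
    unfolding R_def[of b "R a u"]
    by (intro Bochner_Integration.integral_cong refl) (auto simp: P_R[OF Rm u a] split: split_indicator)
  with laplace_iterated[OF integrable_P[OF u, of x] P_time_measurable[OF um] a b False]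
  show ?thesis by (simp add: R_def[of b u] R_def[of a u])
qed simp

lemma R0_one_bound: obtains M where "0 < M" "\<And>x. R 0 (\<lambda>_. 1) x \<le> M"
proof -
  obtain c where "0 \<le> c" "\<And>x. \<bar>R 0 (\<lambda>_. 1) x\<bar> \<le> c" using C0_bounded[OF R0_one_C0] by blast
  then show ?thesis using that[of "c + 1"] by (smt (verit))
qed

text \<open>A contraction argument with the resolvent equation; the admissible step width does not depend
  on \<open>a\<close>.\<close>

lemma R_C0_step:
  assumes M: "0 < M" "\<And>x. R 0 (\<lambda>_. 1) x \<le> M"
    and RC: "\<And>u. u \<in> bounded_borel \<Longrightarrow> R a u \<in> C0" and a: "0 \<le> a" and b: "0 \<le> b" and ab: "\<bar>a - b\<bar> * M \<le> 1 / 2"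
    and u: "u \<in> bounded_borel"
  shows "R b u \<in> C0"
proof -
  have RM: "\<bar>R d u x\<bar> \<le> c * M" if "u \<in> borel_measurable borel" "\<And>y. \<bar>u y\<bar> \<le> c" "0 \<le> d" for u c d x
  proof -
    have "0 \<le> c" using that(2)[of undefined] abs_ge_zero order_trans by blast
    have "\<bar>R d u x\<bar> \<le> c * R d (\<lambda>_. 1) x" by (rule R_abs_le_one[OF that])
    also have "\<dots> \<le> c * M" using R_one_antimono[OF that(3), of x] M(2)[of x] \<open>0 \<le> c\<close> by (intro mult_left_mono) auto
    finally show ?thesis .
  qed
  \<comment> \<open>Iterates R_b u = R_a u + R_b ((a - b) R_a u). The new argument has at most half
    the old bound, so after n rounds an element of C0 is within c M / 2^n of R_b u; about R_b only
    the bound by M is used.\<close>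
  have approx: "\<exists>f\<in>C0. \<forall>x. \<bar>R b u x - f x\<bar> \<le> c * M * (1/2) ^ n"
    if "u \<in> borel_measurable borel" "\<And>y. \<bar>u y\<bar> \<le> c" for u c n
    using that
  proof (induction n arbitrary: u c)
    case 0
    then show ?case using RM[OF 0 b] by (intro bexI[OF _ C0_zero]) simp
  next
    case (Suc n)
    have ub: "u \<in> bounded_borel" by (rule bounded_borelI[OF Suc.prems])
    let ?v = "\<lambda>x. (a - b) * R a u x"
    have vb: "?v \<in> bounded_borel" by (intro bounded_borel_cmult C0_bounded_borel RC ub)
    then have vm: "?v \<in> borel_measurable borel" by (simp add: bounded_borel_def)
    have "0 \<le> c" using Suc.prems(2)[of undefined] abs_ge_zero order_trans by blast
    have v: "\<bar>?v y\<bar> \<le> c / 2" for y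
    proof -
      have "\<bar>?v y\<bar> \<le> \<bar>a - b\<bar> * (c * M)" unfolding abs_mult by (intro mult_left_mono RM Suc.prems a) simp
      also have "\<dots> = c * (\<bar>a - b\<bar> * M)" by simp
      also have "\<dots> \<le> c * (1 / 2)" using ab \<open>0 \<le> c\<close> by (rule mult_left_mono)
      finally show ?thesis by simp
    qed
    from Suc.IH[OF vm v] obtain f where f: "f \<in> C0" "\<And>x. \<bar>R b ?v x - f x\<bar> \<le> c / 2 * M * (1/2) ^ n" by blast
    have "R b u x = R a u x + R b ?v x" for x
      using resolvent_equation_aux[OF C0_bounded_borel[OF RC] ub a b, of x]
        R_cmult[OF C0_bounded_borel[OF RC[OF ub]] b, of "a - b" x] by simp
    then have "\<bar>R b u x - (R a u x + f x)\<bar> \<le> c * M * (1/2) ^ Suc n" for x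
      using f(2)[of x] by simp
    then show ?case by (intro bexI[OF _ C0_add[OF RC[OF ub] f(1)]] allI)
  qed
  from u obtain c where um: "u \<in> borel_measurable borel" and c: "0 \<le> c" "\<And>x. \<bar>u x\<bar> \<le> c" unfolding bounded_borel_iff by blast
  show ?thesis
  proof (rule C0_uniform_closed)
    fix \<epsilon> :: real assume e: "0 < \<epsilon>"
    have "(\<lambda>n. c * M * (1/2) ^ n) \<longlonglongrightarrow> c * M * 0"
      by (intro tendsto_intros LIMSEQ_realpow_zero) auto
    then have "eventually (\<lambda>n. c * M * (1/2) ^ n < \<epsilon>) sequentially" using e by (intro order_tendstoD) auto
    then obtain n where n: "c * M * (1/2) ^ n < \<epsilon>" by (auto simp: eventually_sequentially)
    from approx[OF um c(2), of n] obtain f where "f \<in> C0" "\<And>x. \<bar>R b u x - f x\<bar> \<le> c * M * (1/2) ^ n" by blast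
    then show "\<exists>g\<in>C0. \<forall>x. \<bar>R b u x - g x\<bar> \<le> \<epsilon>" using n by (intro bexI[of _ f]) (auto intro: order_trans less_imp_le)
  qed
qed

theorem R_C0:
  assumes "u \<in> bounded_borel" "0 \<le> a" shows "R a u \<in> C0"
proof -
  obtain M where M: "0 < M" "\<And>x. R 0 (\<lambda>_. 1) x \<le> M" using R0_one_bound by metis
  define \<delta> where "\<delta> = 1 / (2 * M)"
  have \<delta>: "0 < \<delta>" "\<delta> * M = 1 / 2" using M by (auto simp: \<delta>_def)
  have "\<forall>a u. 0 \<le> a \<longrightarrow> a \<le> real n * \<delta> \<longrightarrow> u \<in> bounded_borel \<longrightarrow> R a u \<in> C0" for n
  proof (induction n)
    case 0
    then show ?case using R0_C0 by auto
  next
    case (Suc n)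
    show ?case
    proof (intro allI impI)
      fix a and u :: "'a \<Rightarrow> real" assume a: "0 \<le> a" "a \<le> real (Suc n) * \<delta>" and u: "u \<in> bounded_borel"
      \<comment> \<open>M bounds R_d 1 for every d \<ge> 0, so the step \<delta> is the same at each
        stage and every a is reached after finitely many.\<close>
      define a' where "a' = max 0 (a - \<delta>)"
      have a': "0 \<le> a'" "a' \<le> real n * \<delta>" "\<bar>a' - a\<bar> \<le> \<delta>"
        using a \<delta> by (auto simp: a'_def algebra_simps max_def)
      have "\<bar>a' - a\<bar> * M \<le> 1 / 2" using mult_right_mono[OF a'(3), of M] M(1) \<delta>(2) by simp
      moreover have "R a' w \<in> C0" if "w \<in> bounded_borel" for w using Suc a'(1,2) that by blast
      ultimately show "R a u \<in> C0" using a'(1) a(1) u by (intro R_C0_step[OF M, of a' a u])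
    qed
  qed
  moreover obtain n where "a / \<delta> \<le> real n" using real_arch_simple by blast
  then have "a \<le> real n * \<delta>" using \<delta>(1) by (simp add: pos_divide_le_eq)
  ultimately show ?thesis using assms by blast
qed

lemma R_bounded_borel: "u \<in> bounded_borel \<Longrightarrow> 0 \<le> a \<Longrightarrow> R a u \<in> bounded_borel"
  by (rule C0_bounded_borel[OF R_C0])

lemma resolvent_equation:
  "u \<in> bounded_borel \<Longrightarrow> 0 \<le> a \<Longrightarrow> 0 \<le> b \<Longrightarrow> R b u x = R a u x + (a - b) * R b (R a u) x"
  by (rule resolvent_equation_aux[OF R_bounded_borel])

lemma P_R_eq:
  "u \<in> bounded_borel \<Longrightarrow> 0 \<le> a \<Longrightarrow> 0 \<le> t \<Longrightarrow>
    P t (R a u) x = (\<integral>s. indicator {0..} s * (exp (- a * s) * P (t + s) u x) \<partial>lborel)"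
  by (rule P_R[OF R_bounded_borel])

end

section \<open>Consequences of the full fine support\<close>

context std_process begin

lemma nearly_borel_borel: "B \<in> sets borel \<Longrightarrow> nearly_borel Z B"
  unfolding nearly_borel_def by (auto intro!: bexI[of _ B])

text \<open>Avoidance of D before time \<epsilon> bounds the hitting time of D below by \<epsilon>.
  In \<open>P0_supermedian\<close> the set D is larger than B, so that the avoidance can be read off
  from level sets.\<close>

lemma thin_atI:
  assumes D: "D \<in> sets borel" "B \<subseteq> D"
    and ae: "AE \<omega> in law Z (Some x). \<exists>\<epsilon>>0. \<forall>t. 0 < t \<and> t < \<epsilon> \<longrightarrow> coord Z t \<omega> \<notin> Some ` D"
  shows "thin_at Z B x"
  unfolding thin_at_def
proof (intro exI conjI)
  show "nearly_borel Z D" "B \<subseteq> D" using D by (auto intro: nearly_borel_borel)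
  show "AE \<omega> in law Z (Some x). 0 < hitting_time Z D \<omega>"
    using ae
  proof eventually_elim
    case (elim \<omega>)
    then obtain \<epsilon> where e: "\<epsilon> > 0" "\<And>t. 0 < t \<Longrightarrow> t < \<epsilon> \<Longrightarrow> coord Z t \<omega> \<notin> Some ` D" by blast
    have "\<epsilon> \<le> hitting_time Z D \<omega>" unfolding hitting_time_def
      by (rule Inf_greatest) (use e(2) in \<open>auto simp: not_less[symmetric]\<close>)
    then show ?case using e(1) by (auto intro: less_le_trans)
  qed
qed

lemma eventually_at_right_ennreal:
  "(a :: ennreal) < top \<Longrightarrow> eventually P (at_right a) \<longleftrightarrow> (\<exists>b>a. \<forall>y>a. y < b \<longrightarrow> P y)"
  using eventually_at_right[of a top P] by auto

text \<open>A property that persists for a moment after a holds at a rational time just after a.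
  This reduces entrance events to countably many coordinates.\<close>

lemma eventually_coord_rational:
  assumes a: "a < (top :: ennreal)" and ev: "eventually Q (at_right a)" and ab: "a < b"
  obtains q :: rat where "a < ennreal (of_rat q)" "ennreal (of_rat q) < b" "Q (ennreal (of_rat q))"
proof -
  from ev obtain c where c: "c > a" "\<And>y. y > a \<Longrightarrow> y < c \<Longrightarrow> Q y"
    unfolding eventually_at_right_ennreal[OF a] by blast
  obtain q :: rat where "a < ennreal (of_rat q)" "ennreal (of_rat q) < min b c"
    using ennreal_rat_dense[of a "min b c"] ab c(1) by auto
  then show ?thesis using that c(2) by auto
qed

end

section \<open>A maximal inequality for increasing limits of potentials\<close>

context green_potential begin

text \<open>Shifting by T discards the part of the occupation integral before the clock value A_T. A
  dead path contributes 0, and for a live one A_T is finite, so \<open>Y_shift\<close>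
  applies.\<close>

lemma laplace_functional_shift_le:
  assumes \<omega>: "\<omega> \<in> \<Lambda>" and u [measurable]: "u \<in> borel_measurable borel"
  shows "laplace_functional 0 u (shift Z T \<omega>) \<le> laplace_functional 0 u \<omega>"
proof (cases "coord Z T \<omega> = None")
  case True
  then show ?thesis using Y_shift_None[OF Lam_paths[OF \<omega>] True] by (simp add: laplace_functional_def)
next
  case False
  then have "T \<noteq> top" using coord_top[OF Lam_paths[OF \<omega>]] by auto
  then have T: "T < top" by (simp add: less_top)
  then have "A T \<omega> < top" using A_top_None[OF \<omega> T] False by (metis less_top)
  define a where "a = enn2real (A T \<omega>)"
  have a: "0 \<le> a" "A T \<omega> = ennreal a" using \<open>A T \<omega> < top\<close> by (auto simp: a_def)
  note [measurable] = Y_pathwise_measurable[OF Lam_paths[OF \<omega>]]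
  let ?f = "\<lambda>r. indicator {a..} r * ennreal (ext0 u (Y r \<omega>))"
  have "laplace_functional 0 u (shift Z T \<omega>) = (\<integral>\<^sup>+ s. ?f (a + 1 * s) \<partial>lborel)"
    unfolding laplace_functional_def
    by (intro nn_integral_cong) (auto simp: Y_shift[OF \<omega> T a] split: split_indicator)
  also have "\<dots> = (\<integral>\<^sup>+ r. ?f r \<partial>lborel)"
    by (subst (2) nn_integral_real_affine[where c = 1 and t = a]) auto
  also have "\<dots> \<le> laplace_functional 0 u \<omega>" unfolding laplace_functional_def
    using a(1) by (intro nn_integral_mono) (auto split: split_indicator)
  finally show ?thesis .
qed

text \<open>\<open>shift Z 0\<close> is not postulated to be the identity map; the equality comes
  from A_0 = 0.\<close>

lemma laplace_functional_shift_0: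
  assumes \<omega>: "\<omega> \<in> \<Lambda>" shows "laplace_functional 0 u (shift Z 0 \<omega>) = laplace_functional 0 u \<omega>"
  unfolding laplace_functional_def
  by (intro nn_integral_cong) (auto simp: Y_shift[OF \<omega> _ order_refl] A_zero[OF \<omega>] split: split_indicator)

lemma filt_0_pre_sigma:
  assumes T: "stopping_time (filt Z) T" shows "sets (filt Z 0) \<subseteq> sets (pre_sigma T)"
proof
  fix \<Gamma> assume \<Gamma>: "\<Gamma> \<in> sets (filt Z 0)"
  show "\<Gamma> \<in> sets (pre_sigma T)"
  proof (rule sets_pre_sigmaI[OF T])
    fix t
    have 1: "\<Gamma> \<in> sets (filt Z t)" using sets_F_mono[of 0 t] \<Gamma> by auto
    then have "\<Gamma> \<subseteq> paths Z" using sets.sets_into_space by (force simp: space_F)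
    then have "{\<omega>\<in>\<Gamma>. T \<omega> \<le> t} = \<Gamma> \<inter> {\<omega>\<in>space (filt Z t). T \<omega> \<le> t}" by (auto simp: space_F)
    also have "\<dots> \<in> sets (filt Z t)"
      using 1 stopping_timeD[OF T, of t] by (auto simp: Measurable.pred_def)
    finally show "{\<omega>\<in>\<Gamma>. T \<omega> \<le> t} \<in> sets (filt Z t)" .
  qed
qed

text \<open>Optional stopping, which \<open>laplace_functional_shift_le\<close> provides already
  path by path. The restriction to an event \<Gamma> known at time 0 lets the maximal inequality
  work without a zero-one law.\<close>

lemma potential_supermartingale:
  assumes T: "stopping_time (filt Z) T" and \<Gamma>: "\<Gamma> \<in> sets (filt Z 0)"
    and f: "f \<in> bounded_borel" "\<And>y. 0 \<le> f y"
  shows "(\<integral>\<^sup>+ \<omega>. ennreal (ext0 (R 0 f) (coord Z (T \<omega>) \<omega>)) * indicator \<Gamma> \<omega> \<partial>law Z (Some x))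
    \<le> ennreal (R 0 f x) * emeasure (law Z (Some x)) \<Gamma>"
proof -
  have fm: "f \<in> borel_measurable borel" using f by (simp add: bounded_borel_def)
  have Rm [measurable]: "R 0 f \<in> borel_measurable borel" using R_bounded_borel[OF f(1), of 0] by (simp add: bounded_borel_def)
  have m: "ext0 (\<lambda>x. ennreal (R 0 f x)) \<in> borel_measurable cem_borel" by measurable
  note sm = strong_markov_aug[OF _ _ laplace_functional_measurable[OF fm] m laplace_functional_kernel[OF f order_refl]]
  have \<Gamma>T: "\<Gamma> \<in> sets (pre_sigma T)" "\<Gamma> \<in> sets (pre_sigma (\<lambda>_. 0))"
    using filt_0_pre_sigma[OF T] filt_0_pre_sigma[OF stopping_time_const] \<Gamma> by auto
  have \<Gamma>e: "\<Gamma> \<in> sets (events Z)" using filt_events \<Gamma> by blast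
  have "(\<integral>\<^sup>+ \<omega>. ennreal (ext0 (R 0 f) (coord Z (T \<omega>) \<omega>)) * indicator \<Gamma> \<omega> \<partial>law Z (Some x))
    = (\<integral>\<^sup>+ \<omega>. laplace_functional 0 f (shift Z (T \<omega>) \<omega>) * indicator \<Gamma> \<omega> \<partial>law Z (Some x))"
    unfolding ennreal_ext0 by (rule sm[OF T \<Gamma>T(1), symmetric])
  also have "\<dots> \<le> (\<integral>\<^sup>+ \<omega>. laplace_functional 0 f (shift Z 0 \<omega>) * indicator \<Gamma> \<omega> \<partial>law Z (Some x))"
    by (rule nn_integral_mono_AE, rule eventually_mono[OF Lam_AE])
      (auto simp: laplace_functional_shift_0 intro!: mult_right_mono laplace_functional_shift_le[OF _ fm])
  also have "\<dots> = (\<integral>\<^sup>+ \<omega>. ext0 (\<lambda>x. ennreal (R 0 f x)) (coord Z 0 \<omega>) * indicator \<Gamma> \<omega> \<partial>law Z (Some x))"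
    by (rule sm[OF stopping_time_const \<Gamma>T(2)])
  also have "\<dots> = (\<integral>\<^sup>+ \<omega>. ennreal (R 0 f x) * indicator \<Gamma> \<omega> \<partial>law Z (Some x))"
    by (rule nn_integral_cong_AE, rule eventually_mono[OF AE_coord_0]) simp
  also have "\<dots> = ennreal (R 0 f x) * emeasure (law Z (Some x)) \<Gamma>"
    using \<Gamma>e by (simp add: nn_integral_cmult)
  finally show ?thesis .
qed

text \<open>Let h_n = R_0 (f n), let T_n be the entrance time of {h_n > c}, and let \<Gamma> be the
  event that the union of these sets is visited at arbitrarily small positive times. Then c
  P(\<Gamma>, T_n < \<infinity>) \<le> E[h_n(X at T_n); \<Gamma>] \<le> d P(\<Gamma>). Letting n
  grow gives c P(\<Gamma>) \<le> d P(\<Gamma>), and d < c forces P(\<Gamma>) = 0.\<close>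

lemma open_hitting_never_immediate:
  assumes f: "\<And>n. f n \<in> bounded_borel" "\<And>n y. 0 \<le> f n y"
    and inc: "\<And>y. incseq (\<lambda>n. R 0 (f n) y)"
    and d: "\<And>n. R 0 (f n) x \<le> d" and cd: "d < c"
  shows "AE \<omega> in law Z (Some x). \<exists>\<epsilon>>0. \<forall>t. 0 < t \<and> t < \<epsilon> \<longrightarrow> coord Z t \<omega> \<notin> Some ` {y. \<exists>n. c < R 0 (f n) y}"
proof -
  interpret L: prob_space "law Z (Some x)" by (rule prob_law)
  let ?h = "\<lambda>n. R 0 (f n)"
  define H where "H n z = ext0 (?h n) z" for n z
  have d0: "0 \<le> d" using d[of 0] R_nonneg[of "f 0" 0 x] f(2) by (meson order_trans)
  then have c0: "0 < c" using cd by simp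
  have hcont: "continuous_on UNIV (?h n)" for n by (rule C0_continuous[OF R_C0[OF f(1)]]) simp
  have [measurable]: "?h n \<in> borel_measurable borel" for n
    by (rule borel_measurable_continuous_onI[OF hcont])
  have [measurable]: "H n \<in> borel_measurable cem_borel" for n unfolding H_def by measurable
  have inU: "z \<in> Some ` {y. \<exists>n. c < ?h n y} \<longleftrightarrow> (\<exists>n. c < H n z)" for z
    using c0 by (cases z) (auto simp: H_def)
  have H_inc: "H n z \<le> H m z" if "n \<le> m" for n m z
    using incseqD[OF inc that] by (cases z) (auto simp: H_def)
  have H_rc: "((\<lambda>s. H n (coord Z s \<omega>)) \<longlongrightarrow> H n (coord Z a \<omega>)) (at_right a)"
    if "\<omega> \<in> paths Z" "a < top" for n \<omega> a
    unfolding H_def by (rule ext0_coord_right_cont[OF that(1) hcont that(2)])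
  define T where "T n \<omega> = Inf {t. c < H n (coord Z t \<omega>)}" for n \<omega>
  have T_less: "T n \<omega> < s \<longleftrightarrow> (\<exists>q :: rat. ennreal (of_rat q) < s \<and> c < H n (coord Z (ennreal (of_rat q)) \<omega>))"
    if \<omega>: "\<omega> \<in> paths Z" for n \<omega> s
  proof
    assume "T n \<omega> < s"
    then obtain r where r: "r < s" "c < H n (coord Z r \<omega>)" unfolding T_def Inf_less_iff by auto
    then have "r < top" by (auto intro: less_le_trans)
    from order_tendstoD(1)[OF H_rc[OF \<omega> this] r(2)]
    show "\<exists>q :: rat. ennreal (of_rat q) < s \<and> c < H n (coord Z (ennreal (of_rat q)) \<omega>)"
      using eventually_coord_rational[OF \<open>r < top\<close> _ r(1)] by metis
  next
    assume "\<exists>q :: rat. ennreal (of_rat q) < s \<and> c < H n (coord Z (ennreal (of_rat q)) \<omega>)"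
    then show "T n \<omega> < s" unfolding T_def Inf_less_iff by auto
  qed
  have coord_set: "{\<omega>\<in>paths Z. c < H n (coord Z r \<omega>)} \<in> sets (filt Z s)" if "r \<le> s" for n r s
  proof -
    have "coord Z r -` {z. c < H n z} \<inter> space (filt Z r) \<in> sets (filt Z r)"
    proof (rule measurable_sets[OF coord_filt])
      have "{z \<in> space cem_borel. c < H n z} \<in> sets cem_borel" by measurable
      then show "{z. c < H n z} \<in> sets cem_borel" by simp
    qed
    then have "coord Z r -` {z. c < H n z} \<inter> space (filt Z r) \<in> sets (filt Z s)"
      using sets_F_mono[OF that] by blast
    then show ?thesis by (simp add: space_F vimage_def Int_def conj_commute)
  qed
  have T_stop: "stopping_time (filt Z) (T n)" for n
  proof (rule stopping_timeI_less)
    fix t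
    have "{\<omega>\<in>paths Z. T n \<omega> < t} = (\<Union>q\<in>{q :: rat. ennreal (of_rat q) < t}. {\<omega>\<in>paths Z. c < H n (coord Z (ennreal (of_rat q)) \<omega>)})"
      using T_less by auto
    also have "\<dots> \<in> sets (filt Z t)"
    proof (rule sets.countable_UN')
      have "{\<omega>\<in>paths Z. c < H n (coord Z (ennreal (of_rat q)) \<omega>)} \<in> sets (filt Z t)"
        if "ennreal (of_rat q) < t" for q :: rat
        using that by (intro coord_set less_imp_le)
      then show "(\<lambda>q. {\<omega>\<in>paths Z. c < H n (coord Z (ennreal (of_rat q)) \<omega>)}) ` {q. ennreal (of_rat q) < t} \<subseteq> sets (filt Z t)"
        by blast
    qed simp
    finally show "{\<omega>\<in>paths Z. T n \<omega> < t} \<in> sets (filt Z t)" .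
  qed
  \<comment> \<open>At T_n only the weak inequality survives: values above c occur at T_n itself or
    at times decreasing to it.\<close>
  have H_T: "c \<le> H n (coord Z (T n \<omega>) \<omega>)" if \<omega>: "\<omega> \<in> paths Z" and fin: "T n \<omega> < top" for n \<omega>
  proof (rule ccontr)
    assume "\<not> c \<le> H n (coord Z (T n \<omega>) \<omega>)"
    then have lt: "H n (coord Z (T n \<omega>) \<omega>) < c" by simp
    from order_tendstoD(2)[OF H_rc[OF \<omega> fin] lt] obtain b where
      b: "b > T n \<omega>" "\<And>y. y > T n \<omega> \<Longrightarrow> y < b \<Longrightarrow> H n (coord Z y \<omega>) < c"
      unfolding eventually_at_right_ennreal[OF fin] by blast
    from b(1) obtain r where r: "r < b" "c < H n (coord Z r \<omega>)" unfolding T_def Inf_less_iff by auto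
    have "T n \<omega> \<le> r" unfolding T_def by (rule Inf_lower) (use r in simp)
    then consider "T n \<omega> < r" | "T n \<omega> = r" by (auto simp: le_less)
    then show False using b(2)[of r] r lt by cases auto
  qed
  \<comment> \<open>Visits at rational times in (0, 1/(N+1)). The sets decrease in N, so their
    intersection is known at every s > 0, hence at time 0 by right continuity of the
    filtration.\<close>
  define V where "V N = (\<Union>q\<in>{q :: rat. 0 < ennreal (of_rat q) \<and> ennreal (of_rat q) < ennreal (1 / real (Suc N))}.
      \<Union>n. {\<omega>\<in>paths Z. c < H n (coord Z (ennreal (of_rat q)) \<omega>)})" for N
  define \<Gamma> where "\<Gamma> = (\<Inter>N. V N)"
  have V_mono: "V M \<subseteq> V N" if "N \<le> M" for N M
  proof -
    have "1 / real (Suc M) \<le> 1 / real (Suc N)" using that by (simp add: frac_le)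
    then have "ennreal (1 / real (Suc M)) \<le> ennreal (1 / real (Suc N))" by (rule ennreal_leI)
    note le = less_le_trans[OF _ this]
    show ?thesis unfolding V_def by (intro UN_mono subset_refl) (blast intro: le)
  qed
  have \<Gamma>_filt: "\<Gamma> \<in> sets (filt Z 0)"
  proof -
    have "\<Gamma> \<in> sets (filt Z s)" if s: "0 < s" for s
    proof -
      obtain M where M: "ennreal (1 / real (Suc M)) \<le> s"
      proof (cases "s = top")
        case False
        then have "0 < enn2real s" using s by (simp add: enn2real_positive_iff less_top)
        then obtain M where "1 / real (Suc M) < enn2real s" using nat_approx_posE by blast
        then have "ennreal (1 / real (Suc M)) \<le> ennreal (enn2real s)" by (intro ennreal_leI) simp
        also have "\<dots> = s" using False by (simp add: less_top)
        finally show ?thesis by (rule that)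
      qed (use that[of 0] in simp)
      have "\<Gamma> = (\<Inter>N\<in>{M..}. V N)"
      proof (intro equalityI subsetI)
        fix \<omega> assume *: "\<omega> \<in> (\<Inter>N\<in>{M..}. V N)"
        have "\<omega> \<in> V N" for N
          using * V_mono[of N "max N M"] by (auto simp: subset_eq)
        then show "\<omega> \<in> \<Gamma>" by (simp add: \<Gamma>_def)
      qed (auto simp: \<Gamma>_def)
      also have "\<dots> \<in> sets (filt Z s)"
      proof (intro sets.countable_INT')
        have "V N \<in> sets (filt Z s)" if N: "M \<le> N" for N
          unfolding V_def
        proof (intro sets.countable_UN')
          have "1 / real (Suc N) \<le> 1 / real (Suc M)" using N by (simp add: frac_le)
          then have "ennreal (1 / real (Suc N)) \<le> s" using M by (meson ennreal_leI order_trans)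
          then have sub: "{\<omega>\<in>paths Z. c < H n (coord Z (ennreal (of_rat q)) \<omega>)} \<in> sets (filt Z s)"
            if "ennreal (of_rat q) < ennreal (1 / real (Suc N))" for n and q :: rat
            using that by (intro coord_set) auto
          then show "(\<lambda>q. \<Union>n. {\<omega>\<in>paths Z. c < H n (coord Z (ennreal (of_rat q)) \<omega>)}) `
             {q :: rat. 0 < ennreal (of_rat q) \<and> ennreal (of_rat q) < ennreal (1 / real (Suc N))} \<subseteq> sets (filt Z s)"
            by (auto intro!: sets.countable_UN)
        qed auto
        then show "V ` {M..} \<subseteq> sets (filt Z s)" by auto
      qed auto
      finally show ?thesis .
    qed
    then show ?thesis by (subst filt_right_cont) auto
  qed
  have \<Gamma>e [measurable]: "\<Gamma> \<in> sets (events Z)" using filt_events \<Gamma>_filt by blast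
  have \<Gamma>sub: "\<Gamma> \<subseteq> paths Z" using sets.sets_into_space[OF \<Gamma>e] by simp
  define G where "G n = {\<omega>\<in>\<Gamma>. T n \<omega> < top}" for n
  have G_eq: "G n = \<Gamma> \<inter> (\<Union>q :: rat. {\<omega>\<in>paths Z. c < H n (coord Z (ennreal (of_rat q)) \<omega>)})" for n
    unfolding G_def using T_less[of _ n top] \<Gamma>sub by auto
  have Ge: "G n \<in> sets (events Z)" for n
  proof -
    have "{\<omega>\<in>paths Z. c < H n (coord Z (ennreal (of_rat q)) \<omega>)} \<in> sets (events Z)" for q :: rat
      using coord_set[of "ennreal (of_rat q)" top n] filt_events[of top] by auto
    then show ?thesis unfolding G_eq by (intro sets.Int \<Gamma>e sets.countable_UN) blast
  qed
  have G_inc: "incseq G"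
    unfolding incseq_def G_eq
  proof (intro allI impI)
    fix n m :: nat assume "n \<le> m"
    note le = less_le_trans[OF _ H_inc[OF this]]
    show "\<Gamma> \<inter> (\<Union>q :: rat. {\<omega>\<in>paths Z. c < H n (coord Z (ennreal (of_rat q)) \<omega>)})
      \<subseteq> \<Gamma> \<inter> (\<Union>q :: rat. {\<omega>\<in>paths Z. c < H m (coord Z (ennreal (of_rat q)) \<omega>)})"
      by (blast intro: le)
  qed
  \<comment> \<open>A path in \<Gamma> has h_n > c at some time for some n, so T_n is finite for
    this n.\<close>
  have G_UN: "(\<Union>n. G n) = \<Gamma>"
  proof (intro equalityI subsetI)
    fix \<omega> assume \<omega>: "\<omega> \<in> \<Gamma>"
    then have "\<omega> \<in> V 0" by (auto simp: \<Gamma>_def)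
    then obtain n and q :: rat where "\<omega> \<in> paths Z" "c < H n (coord Z (ennreal (of_rat q)) \<omega>)" by (auto simp: V_def)
    then show "\<omega> \<in> (\<Union>n. G n)" using \<omega> unfolding G_eq by blast
  qed (auto simp: G_def)
  have bound: "c * L.prob (G n) \<le> d * L.prob \<Gamma>" for n
  proof -
    have "ennreal c * emeasure (law Z (Some x)) (G n) = (\<integral>\<^sup>+ \<omega>. ennreal c * indicator (G n) \<omega> \<partial>law Z (Some x))"
      using Ge[of n] by (simp add: nn_integral_cmult)
    also have "\<dots> \<le> (\<integral>\<^sup>+ \<omega>. ennreal (ext0 (?h n) (coord Z (T n \<omega>) \<omega>)) * indicator \<Gamma> \<omega> \<partial>law Z (Some x))"
    proof (rule nn_integral_mono)
      fix \<omega>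
      show "ennreal c * indicator (G n) \<omega> \<le> ennreal (ext0 (?h n) (coord Z (T n \<omega>) \<omega>)) * indicator \<Gamma> \<omega>"
        using H_T[of \<omega> n] \<Gamma>sub by (auto simp: G_def H_def ennreal_leI split: split_indicator)
    qed
    also have "\<dots> \<le> ennreal (?h n x) * emeasure (law Z (Some x)) \<Gamma>"
      by (rule potential_supermartingale[OF T_stop \<Gamma>_filt f])
    also have "\<dots> \<le> ennreal d * emeasure (law Z (Some x)) \<Gamma>"
      by (intro mult_right_mono ennreal_leI d) simp
    finally have "ennreal (c * L.prob (G n)) \<le> ennreal (d * L.prob \<Gamma>)"
      using c0 d0 by (simp add: L.emeasure_eq_measure ennreal_mult')
    then show ?thesis using d0 by (simp add: ennreal_le_iff)
  qed
  have "(\<lambda>n. L.prob (G n)) \<longlonglongrightarrow> L.prob (\<Union>n. G n)"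
    by (rule L.finite_Lim_measure_incseq[OF _ G_inc]) (use Ge in auto)
  then have "(\<lambda>n. c * L.prob (G n)) \<longlonglongrightarrow> c * L.prob \<Gamma>" unfolding G_UN by (rule tendsto_mult_left)
  then have "c * L.prob \<Gamma> \<le> d * L.prob \<Gamma>" by (rule LIMSEQ_le_const2) (use bound in auto)
  then have "(c - d) * L.prob \<Gamma> \<le> 0" by (simp add: algebra_simps)
  then have "L.prob \<Gamma> \<le> 0" using cd by (simp add: mult_le_0_iff)
  then have "L.prob \<Gamma> = 0" using measure_nonneg[of "law Z (Some x)" \<Gamma>] by linarith
  then have "AE \<omega> in law Z (Some x). \<omega> \<notin> \<Gamma>"
    by (intro AE_not_in) (simp add: null_sets_def L.emeasure_eq_measure)
  moreover have "AE \<omega> in law Z (Some x). \<omega> \<in> paths Z" using AE_space[of "law Z (Some x)"] by simp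
  ultimately show ?thesis
  proof eventually_elim
    case (elim \<omega>)
    then obtain N where N: "\<omega> \<notin> V N" by (auto simp: \<Gamma>_def)
    show ?case
    proof (intro exI conjI allI impI)
      show "0 < ennreal (1 / real (Suc N))" by simp
      fix t assume t: "0 < t \<and> t < ennreal (1 / real (Suc N))"
      show "coord Z t \<omega> \<notin> Some ` {y. \<exists>n. c < ?h n y}"
      proof
        assume "coord Z t \<omega> \<in> Some ` {y. \<exists>n. c < ?h n y}"
        then obtain n where n: "c < H n (coord Z t \<omega>)" by (auto simp only: inU)
        have tt: "t < top" using t by (auto intro: less_le_trans)
        obtain q :: rat where q: "t < ennreal (of_rat q)" "ennreal (of_rat q) < ennreal (1 / real (Suc N))"
            "c < H n (coord Z (ennreal (of_rat q)) \<omega>)"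
          using eventually_coord_rational[OF tt order_tendstoD(1)[OF H_rc[OF elim(2) tt] n]] t by metis
        have "0 < ennreal (of_rat q)" by (rule le_less_trans[OF zero_le q(1)])
        then have "\<omega> \<in> V N" unfolding V_def using q elim(2) by blast
        with N show False by simp
      qed
    qed
  qed
qed

section \<open>Behaviour at time 0 and sets that carry \<mu>\<close>

lemma P_right_cont:
  assumes f: "f \<in> bounded_borel" "continuous_on UNIV f" and X: "filterlim X (at_right t) sequentially"
  shows "(\<lambda>n. P (X n) f x) \<longlonglongrightarrow> P t f x"
proof -
  interpret L: prob_space "law Z (Some x)" by (rule prob_law)
  from f obtain c where um [measurable]: "f \<in> borel_measurable borel" and c: "0 \<le> c" "\<And>x. \<bar>f x\<bar> \<le> c"
    unfolding bounded_borel_iff by blast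
  have c': "\<bar>ext0 f z\<bar> \<le> c" for z using c by (cases z) auto
  show ?thesis unfolding P_eq
  proof (rule integral_dominated_convergence[where w = "\<lambda>_. c"])
    have "(\<lambda>n. ext0 f (Y (X n) \<omega>)) \<longlonglongrightarrow> ext0 f (Y t \<omega>)" if "\<omega> \<in> paths Z" for \<omega>
      by (rule filterlim_compose[OF Y_right_cont[OF that f(2)] X])
    then show "AE \<omega> in law Z (Some x). (\<lambda>n. ext0 f (Y (X n) \<omega>)) \<longlonglongrightarrow> ext0 f (Y t \<omega>)"
      by (intro AE_I2) simp
  qed (use c' in \<open>auto intro!: AE_I2\<close>)
qed

text \<open>Substitution writes a R_a f as the mean of P_(s/a) f over an exponentially distributed
  s, and dominated convergence applies. The limit is P_0 f because Y_0 may differ from the starting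
  point when \<tau>_0 > 0.\<close>

lemma R_limit:
  assumes f: "f \<in> bounded_borel" "continuous_on UNIV f"
  shows "(\<lambda>n. real (Suc n) * R (real (Suc n)) f x) \<longlonglongrightarrow> P 0 f x"
proof -
  from f obtain c where um [measurable]: "f \<in> borel_measurable borel" and c: "0 \<le> c" "\<And>x. \<bar>f x\<bar> \<le> c"
    unfolding bounded_borel_iff by blast
  have eq: "a * R a f x = (\<integral>s. indicator {0..} s * exp (- 1 * s) * P (s / a) f x \<partial>lborel)" if a: "0 < a" for a
  proof -
    have "R a f x = \<bar>1 / a\<bar> *\<^sub>R (\<integral>s. indicator {0..} (0 + 1 / a * s) * (exp (- a * (0 + 1 / a * s)) * P (0 + 1 / a * s) f x) \<partial>lborel)"
      unfolding R_def by (rule lborel_integral_real_affine) (use a in simp)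
    also have "\<dots> = 1 / a * (\<integral>s. indicator {0..} s * exp (- 1 * s) * P (s / a) f x \<partial>lborel)"
    proof -
      have "indicator {0..} (0 + 1 / a * s) * (exp (- a * (0 + 1 / a * s)) * P (0 + 1 / a * s) f x)
        = indicator {0..} s * exp (- 1 * s) * P (s / a) f x" for s
        using a by (auto simp: zero_le_divide_iff split: split_indicator)
      then show ?thesis using a by (simp only: abs_of_pos zero_less_divide_1_iff real_scaleR_def)
    qed
    finally show ?thesis using a by simp
  qed
  have "(\<lambda>n. \<integral>s. indicator {0..} s * exp (- 1 * s) * P (s / real (Suc n)) f x \<partial>lborel)
    \<longlonglongrightarrow> (\<integral>s. indicator {0..} s * exp (- 1 * s) * P 0 f x \<partial>lborel)"
  proof (rule integral_dominated_convergence[where w = "\<lambda>s. c * (indicator {0..} s * exp (- 1 * s))"])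
    show "integrable lborel (\<lambda>s. c * (indicator {0..} s * exp (- 1 * s) :: real))"
      by (intro integrable_mult_right integrable_exp_Ici) simp
    show "AE s in lborel. (\<lambda>n. indicator {0..} s * exp (- 1 * s) * P (s / real (Suc n)) f x) \<longlonglongrightarrow> indicator {0..} s * exp (- 1 * s) * P 0 f x"
    proof (rule AE_I2)
      fix s :: real
      show "(\<lambda>n. indicator {0..} s * exp (- 1 * s) * P (s / real (Suc n)) f x) \<longlonglongrightarrow> indicator {0..} s * exp (- 1 * s) * P 0 f x"
      proof (cases "0 < s")
        case True
        have "(\<lambda>n. s / real (Suc n)) \<longlonglongrightarrow> 0" by (rule LIMSEQ_Suc[OF lim_const_over_n])
        then have "filterlim (\<lambda>n. s / real (Suc n)) (at_right 0) sequentially"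
          using True by (auto simp: filterlim_at)
        from P_right_cont[OF f this, of x] show ?thesis by (rule tendsto_mult_left)
      next
        case False
        then show ?thesis by (cases "s = 0") auto
      qed
    qed
    show "AE s in lborel. norm (indicator {0..} s * exp (- 1 * s) * P (s / real (Suc n)) f x) \<le> c * (indicator {0..} s * exp (- 1 * s))" for n
      using P_abs_le[OF um c(2), of "s / real (Suc n)" x for s]
      by (intro AE_I2) (auto simp: abs_mult mult.commute intro!: mult_left_mono split: split_indicator)
  qed measurable
  also have "(\<integral>s. indicator {0..} s * exp (- 1 * s) * P 0 f x \<partial>lborel) = P 0 f x"
    using integral_exp_Ici[of 1] by simp
  finally show ?thesis by (simp add: eq)
qed

lemma P0_measurable:
  assumes f: "f \<in> bounded_borel" "continuous_on UNIV f" shows "P 0 f \<in> borel_measurable borel"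
proof (rule borel_measurable_LIMSEQ_real[OF R_limit[OF f]])
  show "(\<lambda>x. real (Suc n) * R (real (Suc n)) f x) \<in> borel_measurable borel" for n
  proof -
    have [measurable]: "R (real (Suc n)) f \<in> borel_measurable borel"
      using R_bounded_borel[OF f(1), of "real (Suc n)"] unfolding bounded_borel_def by simp
    show ?thesis by measurable
  qed
qed

text \<open>After a shift by \<tau>_t, both Y_0 and X_0 equal Y_t of the original path. By
  \<open>strong_markov_AE_converse\<close>, almost every position z of Y_t in X satisfies f(Y_0) =
  f(z) under P_z, and taking means gives P_0 f(z) = f(z).\<close>

lemma Y_normal_AE:
  assumes f: "f \<in> bounded_borel" "continuous_on UNIV f" and t: "0 \<le> t"
  shows "AE \<omega> in law Z x. ext0 (P 0 f) (Y t \<omega>) = ext0 f (Y t \<omega>)"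
proof -
  have fm [measurable]: "f \<in> borel_measurable borel" using f by (simp add: bounded_borel_def)
  note [measurable] = P0_measurable[OF f]
  define S where "S = {\<omega>\<in>paths Z. ext0 f (coord Z 0 \<omega>) \<noteq> ext0 f (Y 0 \<omega>)}"
  have "S = {\<omega>\<in>space (aug_filt Z top). ext0 f (coord Z 0 \<omega>) \<noteq> ext0 f (Y 0 \<omega>)}" by (simp add: S_def)
  also have "\<dots> \<in> sets (aug_filt Z top)"
  proof -
    have [measurable]: "coord Z 0 \<in> aug_filt Z top \<rightarrow>\<^sub>M cem_borel"
      by (rule measurable_sub_algebra[OF coord_nat_filt_top]) (simp_all add: nat_filt_sub_aug_filt)
    note [measurable] = Y_aug_measurable[of 0]
    show ?thesis by measurable
  qed
  finally have S: "S \<in> sets (aug_filt Z top)" .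
  have "AE \<omega> in law Z x. shift Z (tau t \<omega>) \<omega> \<notin> S"
    by (rule eventually_mono[OF Lam_AE])
      (auto simp: S_def Y_shift_tau t coord_shift Lam_paths coord_tau)
  from strong_markov_AE_converse[OF tau_stopping S this]
  have "AE y in part_law (tau t) (paths Z) x. ext0 (P 0 f) y = ext0 f y"
  proof eventually_elim
    case (elim y)
    show ?case
    proof (cases y)
      case (Some z)
      interpret L: prob_space "law Z (Some z)" by (rule prob_law)
      have "AE \<omega> in law Z (Some z). ext0 f (Y 0 \<omega>) = f z"
        using elim[unfolded Some] AE_coord_0[of "Some z"] AE_space[of "law Z (Some z)"]
        by eventually_elim (auto simp: S_def)
      then have "P 0 f z = (\<integral>\<omega>. f z \<partial>law Z (Some z))"
        unfolding P_eq by (intro integral_cong_AE) auto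
      then show ?thesis using Some L.prob_space by simp
    qed simp
  qed
  moreover have "{y \<in> space cem_borel. ext0 (P 0 f) y = ext0 f y} \<in> sets cem_borel" by measurable
  ultimately show ?thesis
    by (subst (asm) AE_part_law_iff[OF tau_stopping]) (simp_all add: coord_tau)
qed

text \<open>By \<open>Y_normal_AE\<close> the mean occupation time of the exceptional set vanishes
  from an arbitrary point x0. The potential formula turns this into a vanishing \<mu>-integral of
  \<open>g x0\<close> over the set, and \<open>g x0\<close> is strictly positive.\<close>

lemma abnormal_null:
  assumes f: "f \<in> bounded_borel" "continuous_on UNIV f"
  shows "{z. P 0 f z \<noteq> f z} \<in> null_sets \<mu>"
proof -
  have fm [measurable]: "f \<in> borel_measurable borel" using f by (simp add: bounded_borel_def)
  note [measurable] = P0_measurable[OF f]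
  let ?B = "{z. P 0 f z \<noteq> f z}"
  have "{z \<in> space borel. P 0 f z \<noteq> f z} \<in> sets borel" by measurable
  then have B [measurable]: "?B \<in> sets borel" by simp
  let ?u = "indicator ?B :: 'a \<Rightarrow> real"
  have u: "?u \<in> bounded_borel" by (rule bounded_borelI[where c = 1]) (auto simp: indicator_def)
  obtain x0 :: 'a where True by simp
  have "P t ?u x0 = 0" if "0 \<le> t" for t
  proof -
    have "P t ?u x0 = (\<integral>\<omega>. 0 \<partial>law Z (Some x0))" unfolding P_eq[of t ?u]
    proof (rule integral_cong_AE)
      show "AE \<omega> in law Z (Some x0). ext0 ?u (Y t \<omega>) = 0"
        using Y_normal_AE[OF f that, of "Some x0"]
      proof eventually_elim
        case (elim \<omega>)
        then show ?case by (cases "Y t \<omega>") auto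
      qed
    qed auto
    then show ?thesis by simp
  qed
  then have "indicator {0..} t * (exp (- 0 * t) * P t ?u x0) = 0" for t by (auto split: split_indicator)
  then have "R 0 ?u x0 = 0" unfolding R_def[of 0 ?u] by (simp only: integral_zero)
  then have "(\<integral>\<^sup>+ y. g x0 y * ennreal (?u y) \<partial>\<mu>) = 0"
    using ennreal_R0[OF u, of x0] by simp
  then have "AE y in \<mu>. g x0 y * ennreal (?u y) = 0"
    by (subst (asm) nn_integral_0_iff_AE) measurable
  then have "AE y in \<mu>. y \<notin> ?B"
    using g_pos[of x0] by (auto elim!: eventually_mono simp: indicator_def less_imp_neq[symmetric] split: if_splits)
  then show ?thesis using AE_iff_null_sets[of ?B \<mu>] B by (simp add: mu_sets)
qed

end

text \<open>\<open>fine_full\<close> is minimality of the fine support in the form in which it is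
  applied: a property holds at every point once a Borel, finely closed set of points with it is
  found that carries \<mu>.\<close>

locale full_fine_support = green_potential Z A \<Lambda> \<mu> g
  for Z :: "('w, 'a::{metric_space, second_countable_topology}) process" and A \<Lambda> \<mu> g +
  assumes fine_full: "B \<in> sets borel \<Longrightarrow> finely_closed Z B \<Longrightarrow> - B \<in> null_sets \<mu> \<Longrightarrow> B = UNIV"
begin

text \<open>The resolvent equation gives b R_b k - a R_a k = (b - a) R_a (k - b R_b k), and the
  function in the last bracket is nonnegative by the hypothesis at b.\<close>

lemma R_increasing:
  assumes k: "k \<in> bounded_borel" and a: "0 \<le> a" "a \<le> b" and sup: "\<And>x. b * R b k x \<le> k x"
  shows "a * R a k x \<le> b * R b k x"
proof -
  have b: "0 \<le> b" using a by simp
  have Rb: "R b k \<in> bounded_borel" by (rule R_bounded_borel[OF k b])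
  have "R a k x = R b k x + (b - a) * R a (R b k) x" by (rule resolvent_equation[OF k b a(1)])
  then have eq: "R b k x = R a k x - (b - a) * R a (R b k) x" by simp
  have "b * R b k x - a * R a k x = (b - a) * (R a k x - b * R a (R b k) x)"
    unfolding eq by (simp add: algebra_simps)
  also have "R a k x - b * R a (R b k) x = R a (\<lambda>y. k y - b * R b k y) x"
    using R_diff[OF k bounded_borel_cmult[OF Rb, of b] a(1), of x] R_cmult[OF Rb a(1), of b x] by simp
  also have "0 \<le> (b - a) * R a (\<lambda>y. k y - b * R b k y) x"
    using a sup by (intro mult_nonneg_nonneg R_nonneg) auto
  finally show ?thesis by simp
qed

text \<open>For supermedian k and a > 0 the charge k - a R_a k is nonnegative, so a R_a k is a
  potential to which the maximal inequality applies.\<close>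

lemma R_as_potential:
  assumes k: "k \<in> bounded_borel" and a: "0 \<le> a"
  shows "R a k x = R 0 (\<lambda>y. k y - a * R a k y) x"
  using resolvent_equation[OF k a order_refl, of x] R_diff[OF k bounded_borel_cmult[OF R_bounded_borel[OF k a], of a] order_refl, of x]
    R_cmult[OF R_bounded_borel[OF k a] order_refl, of a x] by simp

lemma AE_coord_near_start:
  assumes f: "continuous_on UNIV (f :: 'a \<Rightarrow> real)" and W: "open W" "f x \<in> W"
  shows "AE \<omega> in law Z (Some x). \<exists>\<epsilon>>0. \<forall>t. 0 < t \<and> t < \<epsilon> \<longrightarrow> ext0 f (coord Z t \<omega>) \<in> W"
  using AE_coord_0[of "Some x"] AE_space[of "law Z (Some x)"]
proof eventually_elim
  case (elim \<omega>)
  then have "eventually (\<lambda>t. ext0 f (coord Z t \<omega>) \<in> W) (at_right 0)"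
    using W by (intro topological_tendstoD[OF ext0_coord_right_cont[OF _ f]]) auto
  moreover have "(0 :: ennreal) < top" by simp
  ultimately show ?case unfolding eventually_at_right_ennreal[OF \<open>0 < top\<close>] by blast
qed

text \<open>Suppose P_0 k(x) < c < k(x). A point y with P_0 k(y) = k(y) lies in {P_0 k > c} or in {k
  \<le> c}. For a short time the path from x avoids the first set by the maximal inequality and the
  second by right continuity, so {P_0 k = k} is thin at x.\<close>

lemma P0_supermedian:
  assumes k: "k \<in> C0" "\<And>x. 0 \<le> k x" and sup: "\<And>a x. 0 < a \<Longrightarrow> a * R a k x \<le> k x"
  shows "P 0 k x = k x"
proof -
  have kb: "k \<in> bounded_borel" and kc: "continuous_on UNIV k"
    using k by (auto intro: C0_bounded_borel C0_continuous)
  note [measurable] = P0_measurable[OF kb kc]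
  have km [measurable]: "k \<in> borel_measurable borel" using kb by (simp add: bounded_borel_def)
  let ?a = "\<lambda>n. real (Suc n)"
  \<comment> \<open>Charges with R_0 (f n) = a R_a k for a = n + 1; these potentials increase by
    \<open>R_increasing\<close> and tend to P_0 k by \<open>R_limit\<close>.\<close>
  define f where "f n y = ?a n * (k y - ?a n * R (?a n) k y)" for n y
  have fb: "f n \<in> bounded_borel" for n
    unfolding f_def by (intro bounded_borel_cmult bounded_borel_diff kb R_bounded_borel) simp
  have f0: "0 \<le> f n y" for n y
    unfolding f_def using sup[of "?a n" y] by (intro mult_nonneg_nonneg) auto
  have Rf: "R 0 (f n) y = ?a n * R (?a n) k y" for n y
  proof -
    have "R 0 (f n) y = ?a n * R 0 (\<lambda>y. k y - ?a n * R (?a n) k y) y"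
      unfolding f_def by (rule R_cmult) (auto intro!: bounded_borel_diff bounded_borel_cmult kb R_bounded_borel)
    also have "\<dots> = ?a n * R (?a n) k y" using R_as_potential[OF kb, of "?a n" y] by simp
    finally show ?thesis .
  qed
  have inc: "incseq (\<lambda>n. R 0 (f n) y)" for y
    unfolding incseq_def Rf by (intro allI impI R_increasing kb sup) auto
  have lim: "(\<lambda>n. R 0 (f n) y) \<longlonglongrightarrow> P 0 k y" for y unfolding Rf by (rule R_limit[OF kb kc])
  have le: "R 0 (f n) y \<le> P 0 k y" for n y by (rule incseq_le[OF inc lim])
  have P_le: "P 0 k y \<le> k y" for y
    by (rule LIMSEQ_le_const2[OF lim]) (auto simp: Rf intro!: sup)
  define B where "B = {y. P 0 k y = k y}"
  have "{y \<in> space borel. P 0 k y = k y} \<in> sets borel" by measurable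
  then have Bm: "B \<in> sets borel" by (simp add: B_def)
  have Bn: "- B \<in> null_sets \<mu>" using abnormal_null[OF kb kc] by (simp add: B_def Collect_neg_eq)
  have "finely_closed Z B"
    unfolding finely_closed_def
  proof (intro allI impI)
    fix x assume "x \<notin> B"
    then have "P 0 k x < k x" using P_le[of x] by (simp add: B_def)
    then obtain c where c: "P 0 k x < c" "c < k x" using dense by blast
    let ?U = "{y. \<exists>n. c < R 0 (f n) y}"
    have U: "open ?U"
    proof -
      have "?U = (\<Union>n. {y. c < R 0 (f n) y})" by auto
      also have "open \<dots>" by (intro open_UN ballI open_Collect_less continuous_on_const C0_continuous R_C0 fb) simp
      finally show ?thesis .
    qed
    have K: "closed {y. k y \<le> c}" by (intro closed_Collect_le kc continuous_on_const)
    show "thin_at Z B x"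
    proof (rule thin_atI[where D = "?U \<union> {y. k y \<le> c}"])
      show "?U \<union> {y. k y \<le> c} \<in> sets borel" using U K by (intro sets.Un borel_open borel_closed)
      show "B \<subseteq> ?U \<union> {y. k y \<le> c}"
      proof
        fix y assume y: "y \<in> B"
        show "y \<in> ?U \<union> {y. k y \<le> c}"
        proof (cases "k y \<le> c")
          case False
          then have "c < P 0 k y" using y by (simp add: B_def)
          from order_tendstoD(1)[OF lim this] show ?thesis by (auto simp: eventually_sequentially)
        qed simp
      qed
      have 1: "AE \<omega> in law Z (Some x). \<exists>\<epsilon>>0. \<forall>t. 0 < t \<and> t < \<epsilon> \<longrightarrow> coord Z t \<omega> \<notin> Some ` ?U"
        by (rule open_hitting_never_immediate[OF fb f0 inc le c(1)])
      have 2: "AE \<omega> in law Z (Some x). \<exists>\<epsilon>>0. \<forall>t. 0 < t \<and> t < \<epsilon> \<longrightarrow> ext0 k (coord Z t \<omega>) \<in> {c<..}"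
        by (rule AE_coord_near_start[OF kc]) (use c in auto)
      from 1 2 show "AE \<omega> in law Z (Some x). \<exists>\<epsilon>>0. \<forall>t. 0 < t \<and> t < \<epsilon> \<longrightarrow> coord Z t \<omega> \<notin> Some ` (?U \<union> {y. k y \<le> c})"
      proof eventually_elim
        case (elim \<omega>)
        then obtain e1 e2 where e: "e1 > 0" "\<And>t. 0 < t \<Longrightarrow> t < e1 \<Longrightarrow> coord Z t \<omega> \<notin> Some ` ?U"
          "e2 > 0" "\<And>t. 0 < t \<Longrightarrow> t < e2 \<Longrightarrow> c < ext0 k (coord Z t \<omega>)" by auto
        show ?case
        proof (intro exI[of _ "min e1 e2"] conjI allI impI)
          show "0 < min e1 e2" using e by simp
          fix t assume "0 < t \<and> t < min e1 e2"
          then show "coord Z t \<omega> \<notin> Some ` (?U \<union> {y. k y \<le> c})" using e(2)[of t] e(4)[of t]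
            by (cases "coord Z t \<omega>") auto
        qed
      qed
    qed
  qed
  from fine_full[OF Bm this Bn] show ?thesis by (auto simp: B_def)
qed

text \<open>Truncate h = R_0 f at its value c = h(x). The minimum k is supermedian, so E_x[k(Y_0)] =
  c although k \<le> c, whence h(Y_0) \<ge> c almost surely. Since also E_x[h(Y_0)] = P_0 R_0 f(x) =
  c, equality holds.\<close>

lemma potential_at_Y0_nonneg:
  assumes f: "f \<in> bounded_borel" "\<And>y. 0 \<le> f y"
  shows "AE \<omega> in law Z (Some x). ext0 (R 0 f) (Y 0 \<omega>) = R 0 f x"
proof -
  interpret L: prob_space "law Z (Some x)" by (rule prob_law)
  let ?h = "R 0 f"
  define c where "c = ?h x"
  have h: "?h \<in> C0" "\<And>y. 0 \<le> ?h y" using R_C0[OF f(1)] R_nonneg[of f 0] f(2) by auto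
  have hb: "?h \<in> bounded_borel" by (rule C0_bounded_borel[OF h(1)])
  have c0: "0 \<le> c" using h by (simp add: c_def)
  define k where "k y = min (?h y) c" for y
  have k0: "0 \<le> k y" for y using h c0 by (simp add: k_def)
  have kC0: "k \<in> C0" unfolding k_def
  proof (rule C0_dominated[OF _ h(1)])
    show "continuous_on UNIV (\<lambda>y. min (?h y) c)"
      by (intro continuous_on_min continuous_on_const C0_continuous[OF h(1)])
  qed (use h c0 in auto)
  have kb: "k \<in> bounded_borel" by (rule C0_bounded_borel[OF kC0])
  have "a * R a k y \<le> k y" if a: "0 < a" for a y
  proof -
    have "R a k y \<le> R a ?h y" using a by (intro R_mono kb hb) (auto simp: k_def)
    moreover have "a * R a ?h y \<le> ?h y"
      using resolvent_equation[OF f(1) order_refl less_imp_le[OF a], of y] R_nonneg[of f a y] f(2) by simp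
    ultimately have 1: "a * R a k y \<le> ?h y" using a by (meson mult_left_mono less_imp_le order_trans)
    have "\<bar>a * R a k y\<bar> \<le> c"
      by (rule R_abs_le) (use kb a k0 in \<open>auto simp: bounded_borel_def k_def\<close>)
    with 1 show ?thesis by (simp add: k_def)
  qed
  from P0_supermedian[OF kC0 k0 this] have "P 0 k x = k x" .
  then have Pk: "P 0 k x = c" by (simp add: k_def c_def)
  have k_le: "ext0 k z \<le> c" for z using c0 by (cases z) (auto simp: k_def)
  have "(\<integral>\<omega>. c - ext0 k (Y 0 \<omega>) \<partial>law Z (Some x)) = 0"
    using Pk integrable_ext0_Y[OF kb, of "Some x" 0] L.prob_space by (simp add: P_eq)
  then have "AE \<omega> in law Z (Some x). c - ext0 k (Y 0 \<omega>) = 0"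
    by (subst (asm) integral_nonneg_eq_0_iff_AE) (use integrable_ext0_Y[OF kb] k_le in auto)
  then have ge: "AE \<omega> in law Z (Some x). c \<le> ext0 ?h (Y 0 \<omega>)"
  proof eventually_elim
    case (elim \<omega>)
    then show ?case by (cases "Y 0 \<omega>") (auto simp: k_def)
  qed
  have "P 0 ?h x = c" unfolding c_def
    using P_R_eq[OF f(1) order_refl order_refl, of x] by (simp add: R_def)
  then have "(\<integral>\<omega>. ext0 ?h (Y 0 \<omega>) - c \<partial>law Z (Some x)) = 0"
    using integrable_ext0_Y[OF hb, of "Some x" 0] L.prob_space by (simp add: P_eq)
  then have "AE \<omega> in law Z (Some x). ext0 ?h (Y 0 \<omega>) - c = 0"
    by (subst (asm) integral_nonneg_eq_0_iff_AE) (use integrable_ext0_Y[OF hb] ge in auto)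
  then show ?thesis by eventually_elim (simp add: c_def)
qed

lemma potential_at_Y0:
  assumes f: "f \<in> bounded_borel"
  shows "AE \<omega> in law Z (Some x). ext0 (R 0 f) (Y 0 \<omega>) = R 0 f x"
proof -
  from f obtain c where c: "0 \<le> c" "\<And>x. \<bar>f x\<bar> \<le> c" unfolding bounded_borel_iff by blast
  let ?v = "\<lambda>x. f x + c" and ?c = "\<lambda>_ :: 'a. c"
  have v: "?v \<in> bounded_borel" by (intro bounded_borel_add f bounded_borel_const)
  have v0: "0 \<le> ?v y" for y using c(2)[of y] by (simp add: abs_le_iff)
  have Rf: "R 0 f y = R 0 ?v y - R 0 ?c y" for y
    using R_diff[OF v bounded_borel_const order_refl, of c y] by simp
  have "ext0 (R 0 f) z = ext0 (R 0 ?v) z - ext0 (R 0 ?c) z" for z by (cases z) (auto simp: Rf)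
  note ext = this
  show ?thesis
    using potential_at_Y0_nonneg[OF v v0, of x] potential_at_Y0_nonneg[OF bounded_borel_const c(1), of x]
    by eventually_elim (simp only: ext Rf)
qed

lemma potential_at_Y0':
  assumes f: "f \<in> bounded_borel"
  shows "AE \<omega> in law Z y. ext0 (R 0 f) (Y 0 \<omega>) = ext0 (R 0 f) (coord Z 0 \<omega>)"
proof (cases y)
  case None
  show ?thesis unfolding None using law_None_Y AE_coord_0[of None] by eventually_elim simp
next
  case (Some x)
  show ?thesis unfolding Some using potential_at_Y0[OF f, of x] AE_coord_0[of "Some x"] by eventually_elim simp
qed

text \<open>While A is still 0, a shift does not change Y_0. So the Markov property at a time q <
  \<tau>_0 gives h(X_q) = h(Y_0) = h(x) for h = R_0 f; rational q suffice by right
  continuity.\<close>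

lemma potential_before_tau:
  assumes f: "f \<in> bounded_borel"
  shows "AE \<omega> in law Z (Some x). \<forall>t < tau 0 \<omega>. ext0 (R 0 f) (coord Z t \<omega>) = R 0 f x"
proof -
  let ?h = "R 0 f"
  have hc: "continuous_on UNIV ?h" by (rule C0_continuous[OF R_C0[OF f]]) simp
  have hm [measurable]: "?h \<in> borel_measurable borel" by (rule borel_measurable_continuous_onI[OF hc])
  define S where "S = {\<omega>\<in>paths Z. ext0 ?h (Y 0 \<omega>) \<noteq> ext0 ?h (coord Z 0 \<omega>)}"
  have "S = {\<omega>\<in>space (aug_filt Z top). ext0 ?h (Y 0 \<omega>) \<noteq> ext0 ?h (coord Z 0 \<omega>)}" by (simp add: S_def)
  also have "\<dots> \<in> sets (aug_filt Z top)"
  proof -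
    have [measurable]: "coord Z 0 \<in> aug_filt Z top \<rightarrow>\<^sub>M cem_borel"
      by (rule measurable_sub_algebra[OF coord_nat_filt_top]) (simp_all add: nat_filt_sub_aug_filt)
    note [measurable] = Y_aug_measurable[of 0]
    show ?thesis by measurable
  qed
  finally have S: "S \<in> sets (aug_filt Z top)" .
  have S0: "AE \<omega> in law Z y. \<omega> \<notin> S" for y
    using potential_at_Y0'[OF f, of y] by eventually_elim (simp add: S_def)
  have "AE \<omega> in law Z (Some x). \<forall>q :: rat. shift Z (ennreal (of_rat q)) \<omega> \<notin> S"
    by (subst AE_all_countable) (intro allI strong_markov_AE[OF stopping_time_const S S0])
  then show ?thesis using potential_at_Y0[OF f, of x] Lam_AE[of "Some x"]
  proof eventually_elim
    case (elim \<omega>)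
    note \<omega> = elim(3) Lam_paths[OF elim(3)]
    have q: "ext0 ?h (coord Z (ennreal (of_rat q)) \<omega>) = ?h x" if lt: "ennreal (of_rat q) < tau 0 \<omega>" for q :: rat
    proof -
      have "A (ennreal (of_rat q)) \<omega> = ennreal 0" using A_below_tau[OF \<omega>(1) lt] by simp
      from Y_shift[OF \<omega>(1) _ order_refl this order_refl] have "Y 0 (shift Z (ennreal (of_rat q)) \<omega>) = Y 0 \<omega>" by simp
      moreover have "coord Z 0 (shift Z (ennreal (of_rat q)) \<omega>) = coord Z (ennreal (of_rat q)) \<omega>"
        using coord_shift[OF \<omega>(2)] by simp
      moreover have "ext0 ?h (Y 0 (shift Z (ennreal (of_rat q)) \<omega>)) = ext0 ?h (coord Z 0 (shift Z (ennreal (of_rat q)) \<omega>))"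
        using elim(1) shift_paths[OF \<omega>(2), of "ennreal (of_rat q)"] unfolding S_def by blast
      ultimately have "ext0 ?h (Y 0 \<omega>) = ext0 ?h (coord Z (ennreal (of_rat q)) \<omega>)" by simp
      then show ?thesis using elim(2) by simp
    qed
    show ?case
    proof (intro allI impI, rule ccontr)
      fix t assume t: "t < tau 0 \<omega>" and ne: "ext0 ?h (coord Z t \<omega>) \<noteq> ?h x"
      have tt: "t < top" using t by (auto intro: less_le_trans)
      have "eventually (\<lambda>s. ext0 ?h (coord Z s \<omega>) \<in> - {?h x}) (at_right t)"
        using ne by (intro topological_tendstoD[OF ext0_coord_right_cont[OF \<omega>(2) hc tt]]) auto
      from eventually_coord_rational[OF tt this t] q show False by (metis ComplD singletonI)
    qed
  qed
qed

text \<open>No R_n f with n \<ge> 1 separates the points of E from x, so P_0 f = c on E. Start at z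
  \<in> E with f(z) \<noteq> c. Then Y_0 lies in E or is the cemetery, and f(Y_0) = P_0 f(Y_0) = c;
  so Y_0 is not z and \<tau>_0 > 0. Until \<tau>_0 the path remains in E, and for a short time f
  \<noteq> c along it, hence it avoids B. Minimality then gives B = X, although x is not in B if
  f(x) \<noteq> c.\<close>

theorem P0_eq:
  assumes f: "f \<in> bounded_borel" "continuous_on UNIV f"
  shows "P 0 f x = f x"
proof (rule ccontr)
  assume ne: "P 0 f x \<noteq> f x"
  have fm [measurable]: "f \<in> borel_measurable borel" using f by (simp add: bounded_borel_def)
  note [measurable] = P0_measurable[OF f]
  define c where "c = P 0 f x"
  let ?a = "\<lambda>n. real (Suc n)"
  define E where "E = {z. \<forall>n. R (?a n) f z = R (?a n) f x}"
  define B where "B = - E \<union> {z. f z = c}"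
  define u where "u n y = f y - ?a n * R (?a n) f y" for n y
  have ub: "u n \<in> bounded_borel" for n
    unfolding u_def by (intro bounded_borel_diff bounded_borel_cmult f R_bounded_borel) simp
  have Ru: "R (?a n) f = R 0 (u n)" for n
  proof
    show "R (?a n) f y = R 0 (u n) y" for y
      unfolding u_def by (rule R_as_potential[OF f(1)]) simp
  qed
  have "closed {z. R (?a n) f z = R (?a n) f x}" for n
    by (intro closed_Collect_eq continuous_on_const C0_continuous[OF R_C0[OF f(1)]]) simp
  then have E_closed: "closed E" unfolding E_def by (intro closed_Collect_all)
  have f_closed: "closed {z. f z = c}" by (intro closed_Collect_eq f continuous_on_const)
  have Bm: "B \<in> sets borel" unfolding B_def
    using E_closed f_closed by (intro sets.Un borel_open borel_closed) auto
  have E_P0: "P 0 f z = c" if "z \<in> E" for z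
  proof -
    have "(\<lambda>n. ?a n * R (?a n) f z) \<longlonglongrightarrow> c"
      using R_limit[OF f, of x] that by (simp add: E_def c_def)
    with R_limit[OF f, of z] show ?thesis by (rule LIMSEQ_unique)
  qed
  have "- B \<subseteq> {z. P 0 f z \<noteq> f z}" using E_P0 by (auto simp: B_def)
  moreover have "- B \<in> sets \<mu>" using Bm by (simp add: mu_sets sets_eq_imp_space_eq[OF mu_sets] Compl_eq_Diff_UNIV)
  ultimately have Bn: "- B \<in> null_sets \<mu>" by (rule null_sets_subset[OF abnormal_null[OF f], rotated])
  have "finely_closed Z B"
    unfolding finely_closed_def
  proof (intro allI impI)
    fix z assume "z \<notin> B"
    then have z: "z \<in> E" "f z \<noteq> c" by (auto simp: B_def)
    have 1: "AE \<omega> in law Z (Some z). \<forall>n. \<forall>t < tau 0 \<omega>. ext0 (R 0 (u n)) (coord Z t \<omega>) = R 0 (u n) z"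
      by (subst AE_all_countable) (intro allI potential_before_tau ub)
    have 2: "AE \<omega> in law Z (Some z). \<forall>n. ext0 (R 0 (u n)) (Y 0 \<omega>) = R 0 (u n) z"
      by (subst AE_all_countable) (intro allI potential_at_Y0 ub)
    have 3: "AE \<omega> in law Z (Some z). \<exists>\<epsilon>>0. \<forall>t. 0 < t \<and> t < \<epsilon> \<longrightarrow> ext0 f (coord Z t \<omega>) \<in> - {c}"
      by (rule AE_coord_near_start[OF f(2)]) (use z in auto)
    show "thin_at Z B z"
    proof (rule thin_atI[OF Bm order_refl])
      show "AE \<omega> in law Z (Some z). \<exists>\<epsilon>>0. \<forall>t. 0 < t \<and> t < \<epsilon> \<longrightarrow> coord Z t \<omega> \<notin> Some ` B"
        using 1 2 3 AE_coord_0[of "Some z"] Y_normal_AE[OF f order_refl, of "Some z"]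
      proof eventually_elim
        case (elim \<omega>)
        have "ext0 (P 0 f) (Y 0 \<omega>) = c"
        proof (cases "Y 0 \<omega>")
          \<comment> \<open>If Y_0 is the cemetery, every R_n f vanishes at z and so does P_0 f(z) =
            c; the default value 0 of \<open>ext0\<close> is then the right one.\<close>
          case None
          then have "R (?a n) f z = 0" for n using elim(2) by (simp add: Ru del: of_nat_Suc)
          then have "P 0 f z = 0" using R_limit[OF f, of z] by (simp add: LIMSEQ_const_iff del: of_nat_Suc)
          then show ?thesis using None E_P0[OF z(1)] by simp
        next
          case (Some w)
          then have "w \<in> E" using elim(2) z(1) by (simp add: E_def Ru del: of_nat_Suc)
          then show ?thesis using Some E_P0 by simp
        qed
        then have "ext0 f (Y 0 \<omega>) = c" using elim(5) by simp
        then have "Y 0 \<omega> \<noteq> coord Z 0 \<omega>" using elim(4) z(2) by auto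
        then have tau: "0 < tau 0 \<omega>" by (auto simp: Y_def zero_less_iff_neq_zero)
        from elim(3) obtain e where e: "e > 0" "\<And>t. 0 < t \<Longrightarrow> t < e \<Longrightarrow> ext0 f (coord Z t \<omega>) \<noteq> c" by auto
        show ?case
        proof (intro exI[of _ "min e (tau 0 \<omega>)"] conjI allI impI)
          show "0 < min e (tau 0 \<omega>)" using e tau by simp
          fix t assume t: "0 < t \<and> t < min e (tau 0 \<omega>)"
          show "coord Z t \<omega> \<notin> Some ` B"
          proof
            assume "coord Z t \<omega> \<in> Some ` B"
            then obtain w where w: "coord Z t \<omega> = Some w" "w \<in> B" by auto
            have "f w \<noteq> c" using e(2)[of t] t w by simp
            moreover have "R 0 (u n) w = R 0 (u n) z" for n
              using elim(1)[rule_format, of t n] t w(1) by simp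
            then have "w \<in> E" using z(1) by (simp add: E_def Ru del: of_nat_Suc)
            ultimately show False using w by (simp add: B_def)
          qed
        qed
      qed
    qed
  qed
  from fine_full[OF Bm this Bn] have "x \<in> B" by simp
  then show False using ne by (auto simp: B_def E_def c_def)
qed

corollary R_pointwise:
  assumes "f \<in> bounded_borel" "continuous_on UNIV f"
  shows "(\<lambda>n. real (Suc n) * R (real (Suc n)) f x) \<longlonglongrightarrow> f x"
  using R_limit[OF assms, of x] P0_eq[OF assms, of x] by simp

end

section \<open>The Feller property of the resolvent\<close>

lemma supnorm_tendsto_0:
  assumes "\<And>\<epsilon>. 0 < \<epsilon> \<Longrightarrow> eventually (\<lambda>t. \<forall>x. \<bar>f t x\<bar> \<le> \<epsilon>) F"
  shows "((\<lambda>t. supnorm (f t)) \<longlongrightarrow> 0) F"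
proof (rule tendstoI)
  fix e :: real assume "0 < e"
  then have "0 < e / 2" by simp
  from assms[OF this] show "eventually (\<lambda>t. dist (supnorm (f t)) 0 < e) F"
  proof eventually_elim
    case (elim t)
    have "supnorm (f t) \<le> e / 2" unfolding supnorm_def by (rule cSUP_least) (use elim in auto)
    moreover have "\<bar>f t undefined\<bar> \<le> supnorm (f t)" unfolding supnorm_def
      by (rule cSUP_upper) (use elim in \<open>auto intro!: bdd_aboveI[of _ "e / 2"]\<close>)
    then have "0 \<le> supnorm (f t)" using abs_ge_zero order_trans by blast
    ultimately show ?case using \<open>0 < e\<close> by simp
  qed
qed

context full_fine_support begin

definition supermedian :: "('a \<Rightarrow> real) \<Rightarrow> bool" where
  "supermedian h \<longleftrightarrow> h \<in> C0 \<and> (\<forall>x. 0 \<le> h x) \<and> (\<forall>a>0. \<forall>x. a * R a h x \<le> h x)"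

definition strongly_approx :: "('a \<Rightarrow> real) \<Rightarrow> bool" where
  "strongly_approx u \<longleftrightarrow> u \<in> C0 \<and> (\<forall>\<epsilon>>0. \<exists>N>0. \<forall>a\<ge>N. \<forall>x. \<bar>a * R a u x - u x\<bar> \<le> \<epsilon>)"

lemma supermedian_strongly_approx:
  assumes "supermedian k" shows "strongly_approx k"
proof -
  have k: "k \<in> C0" "\<And>x. 0 \<le> k x" and sup: "\<And>a x. 0 < a \<Longrightarrow> a * R a k x \<le> k x"
    using assms by (auto simp: supermedian_def)
  have kb: "k \<in> bounded_borel" and kc: "continuous_on UNIV k"
    using k by (auto intro: C0_bounded_borel C0_continuous)
  let ?g = "\<lambda>n x. real (Suc n) * R (real (Suc n)) k x"
  have g0: "0 \<le> ?g n x" for n x by (intro mult_nonneg_nonneg R_nonneg k) simp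
  have g_mono: "?g n x \<le> ?g m x" if "n \<le> m" for n m x
    using that by (intro R_increasing kb sup) auto
  show ?thesis unfolding strongly_approx_def
  proof (intro conjI allI impI k(1))
    fix \<epsilon> :: real assume e: "0 < \<epsilon>"
    obtain K where K: "compact K" "\<And>x. x \<notin> K \<Longrightarrow> \<bar>k x\<bar> < \<epsilon>" using C0_vanish[OF k(1) e] by metis
    have op: "open {x. k x - ?g n x < \<epsilon>}" for n
      by (intro open_Collect_less continuous_intros kc C0_continuous[OF R_C0[OF kb]]) simp
    \<comment> \<open>The approximation is monotone in n, so a finite subcover reduces to its
      largest index. Outside K the bounds 0 \<le> a R_a k \<le> k < \<epsilon> suffice.\<close>
    have "K \<subseteq> (\<Union>n\<in>UNIV. {x. k x - ?g n x < \<epsilon>})"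
    proof
      fix x
      have "(\<lambda>n. k x - ?g n x) \<longlonglongrightarrow> k x - k x" by (intro tendsto_intros R_pointwise kb kc)
      then have "eventually (\<lambda>n. k x - ?g n x < \<epsilon>) sequentially" using e by (intro order_tendstoD(2)) auto
      then show "x \<in> (\<Union>n\<in>UNIV. {x. k x - ?g n x < \<epsilon>})"
        unfolding eventually_sequentially by blast
    qed
    then obtain D where "D \<subseteq> UNIV"
      and D: "finite D" "K \<subseteq> (\<Union>n\<in>D. {x. k x - ?g n x < \<epsilon>})"
      by (rule compactE_image[OF K(1) op])
    define N where "N = Max (insert 0 D)"
    have small: "k x - ?g N x < \<epsilon>" for x
    proof (cases "x \<in> K")
      case True
      then obtain n where n: "n \<in> D" "k x - ?g n x < \<epsilon>" using D(2) by blast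
      then have "n \<le> N" using D(1) by (simp add: N_def)
      then show ?thesis using g_mono[of n N x] n(2) by linarith
    next
      case False
      then show ?thesis using K(2)[of x] g0[of N x] by linarith
    qed
    show "\<exists>N>0. \<forall>a\<ge>N. \<forall>x. \<bar>a * R a k x - k x\<bar> \<le> \<epsilon>"
    proof (intro exI[of _ "real (Suc N)"] conjI allI impI)
      fix a x assume a: "real (Suc N) \<le> a"
      then have "0 < a" by (rule less_le_trans[rotated]) simp
      have "?g N x \<le> a * R a k x" using a \<open>0 < a\<close> by (intro R_increasing kb sup) auto
      then show "\<bar>a * R a k x - k x\<bar> \<le> \<epsilon>" using small[of x] sup[OF \<open>0 < a\<close>, of x] by linarith
    qed simp
  qed
qed

lemma strongly_approx_diff:
  assumes u: "strongly_approx u" and v: "strongly_approx v" shows "strongly_approx (\<lambda>x. u x - v x)"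
  unfolding strongly_approx_def
proof (intro conjI allI impI)
  have uC: "u \<in> C0" and vC: "v \<in> C0" using u v by (auto simp: strongly_approx_def)
  then show "(\<lambda>x. u x - v x) \<in> C0" by (rule C0_diff)
  fix \<epsilon> :: real assume "0 < \<epsilon>"
  then have e: "0 < \<epsilon> / 2" by simp
  obtain N where N: "0 < N" "\<And>a x. N \<le> a \<Longrightarrow> \<bar>a * R a u x - u x\<bar> \<le> \<epsilon> / 2"
    using u e unfolding strongly_approx_def by blast
  obtain M where M: "\<And>a x. M \<le> a \<Longrightarrow> \<bar>a * R a v x - v x\<bar> \<le> \<epsilon> / 2"
    using v e unfolding strongly_approx_def by blast
  show "\<exists>N>0. \<forall>a\<ge>N. \<forall>x. \<bar>a * R a (\<lambda>x. u x - v x) x - (u x - v x)\<bar> \<le> \<epsilon>"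
  proof (intro exI[of _ "max N M"] conjI allI impI)
    show "0 < max N M" using N(1) by simp
    fix a x assume a: "max N M \<le> a"
    then have "0 \<le> a" using N(1) by simp
    have Rd: "R a (\<lambda>x. u x - v x) x = R a u x - R a v x"
      by (rule R_diff[OF C0_bounded_borel[OF uC] C0_bounded_borel[OF vC] \<open>0 \<le> a\<close>])
    have "a * R a (\<lambda>x. u x - v x) x - (u x - v x) = (a * R a u x - u x) - (a * R a v x - v x)"
      unfolding Rd by (simp add: algebra_simps)
    then show "\<bar>a * R a (\<lambda>x. u x - v x) x - (u x - v x)\<bar> \<le> \<epsilon>"
      using N(2)[of a x] M[of a x] a unfolding max.bounded_iff by linarith
  qed
qed

lemma strongly_approx_closed:
  assumes u: "u \<in> C0" and ap: "\<And>\<epsilon>. 0 < \<epsilon> \<Longrightarrow> \<exists>v. strongly_approx v \<and> (\<forall>x. \<bar>u x - v x\<bar> \<le> \<epsilon>)"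
  shows "strongly_approx u"
  unfolding strongly_approx_def
proof (intro conjI allI impI u)
  fix \<epsilon> :: real assume "0 < \<epsilon>"
  then have e: "0 < \<epsilon> / 3" by simp
  from ap[OF e] obtain v where v: "strongly_approx v" "\<And>x. \<bar>u x - v x\<bar> \<le> \<epsilon> / 3" by blast
  have vC: "v \<in> C0" using v(1) by (simp add: strongly_approx_def)
  obtain N where N: "0 < N" "\<And>a x. N \<le> a \<Longrightarrow> \<bar>a * R a v x - v x\<bar> \<le> \<epsilon> / 3"
    using v(1) e unfolding strongly_approx_def by blast
  show "\<exists>N>0. \<forall>a\<ge>N. \<forall>x. \<bar>a * R a u x - u x\<bar> \<le> \<epsilon>"
  proof (intro exI[of _ N] conjI allI impI N(1))
    fix a x assume a: "N \<le> a"
    then have "0 < a" using N(1) by simp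
    have d: "(\<lambda>x. u x - v x) \<in> bounded_borel" by (intro C0_bounded_borel C0_diff u vC)
    have "\<bar>a * R a (\<lambda>x. u x - v x) x\<bar> \<le> \<epsilon> / 3"
      by (rule R_abs_le) (use d v(2) \<open>0 < a\<close> in \<open>auto simp: bounded_borel_def\<close>)
    moreover have "a * R a (\<lambda>x. u x - v x) x = a * R a u x - a * R a v x"
      by (subst R_diff[OF C0_bounded_borel[OF u] C0_bounded_borel[OF vC]]) (use \<open>0 < a\<close> in \<open>simp_all add: right_diff_distrib\<close>)
    ultimately show "\<bar>a * R a u x - u x\<bar> \<le> \<epsilon>"
      using N(2)[OF a, of x] v(2)[of x] by linarith
  qed
qed

section \<open>The lattice of differences of supermedian functions\<close>

lemma supermedianD:
  assumes "supermedian h"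
  shows "h \<in> C0" "0 \<le> h x" "0 < a \<Longrightarrow> a * R a h x \<le> h x" "h \<in> bounded_borel"
  using assms by (auto simp: supermedian_def intro: C0_bounded_borel)

lemma supermedian_add:
  assumes h: "supermedian h" and k: "supermedian k" shows "supermedian (\<lambda>x. h x + k x)"
  unfolding supermedian_def
proof (intro conjI allI impI)
  show "(\<lambda>x. h x + k x) \<in> C0" by (intro C0_add supermedianD h k)
  show "0 \<le> h x + k x" for x using supermedianD(2)[OF h, of x] supermedianD(2)[OF k, of x] by simp
  fix a x assume a: "(0 :: real) < a"
  then show "a * R a (\<lambda>x. h x + k x) x \<le> h x + k x"
    using R_add[OF supermedianD(4)[OF h] supermedianD(4)[OF k], of a x] supermedianD(3)[OF h a, of x] supermedianD(3)[OF k a, of x]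
    by (simp add: algebra_simps)
qed

lemma supermedian_min:
  assumes h: "supermedian h" and k: "supermedian k" shows "supermedian (\<lambda>x. min (h x) (k x))"
  unfolding supermedian_def
proof (intro conjI allI impI)
  show m: "(\<lambda>x. min (h x) (k x)) \<in> C0" by (intro C0_min supermedianD h k)
  show "0 \<le> min (h x) (k x)" for x using supermedianD(2)[OF h, of x] supermedianD(2)[OF k, of x] by simp
  fix a x assume a: "(0 :: real) < a"
  let ?m = "\<lambda>x. min (h x) (k x)"
  have "R a ?m x \<le> R a h x" "R a ?m x \<le> R a k x"
    using a by (auto intro!: R_mono C0_bounded_borel m supermedianD(1) h k)
  then have "a * R a ?m x \<le> a * R a h x" "a * R a ?m x \<le> a * R a k x" using a by auto
  then show "a * R a ?m x \<le> min (h x) (k x)"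
    using supermedianD(3)[OF h a, of x] supermedianD(3)[OF k a, of x] by simp
qed

lemma supermedian_R0:
  assumes f: "f \<in> bounded_borel" "\<And>y. 0 \<le> f y" shows "supermedian (R 0 f)"
  unfolding supermedian_def
proof (intro conjI allI impI R_nonneg f R_C0)
  fix a x assume a: "(0 :: real) < a"
  show "a * R a (R 0 f) x \<le> R 0 f x"
    using resolvent_equation[OF f(1) order_refl less_imp_le[OF a], of x] R_nonneg[of f a x] f(2) by simp
qed simp

definition sm_diff :: "('a \<Rightarrow> real) \<Rightarrow> bool" where
  "sm_diff u \<longleftrightarrow> (\<exists>h k. supermedian h \<and> supermedian k \<and> u = (\<lambda>x. h x - k x))"

lemma sm_diff_strongly_approx: "sm_diff u \<Longrightarrow> strongly_approx u"
  unfolding sm_diff_def by (auto intro: strongly_approx_diff supermedian_strongly_approx)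

lemma sm_diff_C0: "sm_diff u \<Longrightarrow> u \<in> C0"
  using sm_diff_strongly_approx by (auto simp: strongly_approx_def)

text \<open>Adding h2 + k2 to both differences clears the minus signs, and their minimum becomes a
  minimum of sums of supermedian functions.\<close>

lemma sm_diff_min:
  assumes "sm_diff u" "sm_diff v" shows "sm_diff (\<lambda>x. min (u x) (v x))"
proof -
  from assms obtain h1 h2 k1 k2 where s: "supermedian h1" "supermedian h2" "supermedian k1" "supermedian k2"
    and u: "u = (\<lambda>x. h1 x - h2 x)" and v: "v = (\<lambda>x. k1 x - k2 x)" unfolding sm_diff_def by blast
  have "(\<lambda>x. min (u x) (v x)) = (\<lambda>x. min (h1 x + k2 x) (k1 x + h2 x) - (h2 x + k2 x))"
    by (auto simp: u v min_def)
  then show ?thesis unfolding sm_diff_def using s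
    by (intro exI[of _ "\<lambda>x. min (h1 x + k2 x) (k1 x + h2 x)"] exI[of _ "\<lambda>x. h2 x + k2 x"])
      (auto intro: supermedian_min supermedian_add)
qed

lemma sm_diff_max:
  assumes "sm_diff u" "sm_diff v" shows "sm_diff (\<lambda>x. max (u x) (v x))"
proof -
  from assms obtain h1 h2 k1 k2 where s: "supermedian h1" "supermedian h2" "supermedian k1" "supermedian k2"
    and u: "u = (\<lambda>x. h1 x - h2 x)" and v: "v = (\<lambda>x. k1 x - k2 x)" unfolding sm_diff_def by blast
  have "(\<lambda>x. max (u x) (v x)) = (\<lambda>x. (h1 x + k1 x) - min (h1 x + k2 x) (k1 x + h2 x))"
    by (auto simp: u v max_def min_def)
  then show ?thesis unfolding sm_diff_def using s
    by (intro exI[of _ "\<lambda>x. min (h1 x + k2 x) (k1 x + h2 x)"] exI[of _ "\<lambda>x. h1 x + k1 x"])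
      (auto intro: supermedian_min supermedian_add)
qed

lemma sm_diff_Min:
  fixes f :: "'i \<Rightarrow> 'a \<Rightarrow> real"
  assumes "finite I" "I \<noteq> {}" "\<And>i. i \<in> I \<Longrightarrow> sm_diff (f i)" shows "sm_diff (\<lambda>x. Min ((\<lambda>i. f i x) ` I))"
  using assms
proof (induction I rule: finite_ne_induct)
  case (insert i I)
  then show ?case using sm_diff_min[of "f i" "\<lambda>x. Min ((\<lambda>i. f i x) ` I)"] by simp
qed simp

lemma sm_diff_Max:
  fixes f :: "'i \<Rightarrow> 'a \<Rightarrow> real"
  assumes "finite I" "I \<noteq> {}" "\<And>i. i \<in> I \<Longrightarrow> sm_diff (f i)" shows "sm_diff (\<lambda>x. Max ((\<lambda>i. f i x) ` I))"
  using assms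
proof (induction I rule: finite_ne_induct)
  case (insert i I)
  then show ?case using sm_diff_max[of "f i" "\<lambda>x. Max ((\<lambda>i. f i x) ` I)"] by simp
qed simp

lemma sm_diff_R0:
  assumes f: "f \<in> bounded_borel" shows "sm_diff (R 0 f)"
proof -
  from f obtain c where c: "0 \<le> c" "\<And>x. \<bar>f x\<bar> \<le> c" unfolding bounded_borel_iff by blast
  let ?v = "\<lambda>x. f x + c" and ?c = "\<lambda>_ :: 'a. c"
  have v: "?v \<in> bounded_borel" by (intro bounded_borel_add f bounded_borel_const)
  have v0: "0 \<le> ?v y" for y using c(2)[of y] by (simp add: abs_le_iff)
  have Rf: "R 0 f = (\<lambda>y. R 0 ?v y - R 0 ?c y)"
    using R_diff[OF v bounded_borel_const order_refl, of c] by auto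
  then show ?thesis unfolding sm_diff_def
    using supermedian_R0[OF v v0] supermedian_R0[OF bounded_borel_const c(1)] by blast
qed

text \<open>Places a R_a u in the range of R_0. This makes it a difference of supermedian functions,
  and later it shows that R_0 has dense range in C0.\<close>

lemma aR_as_R0:
  assumes u: "u \<in> bounded_borel" and a: "0 \<le> a"
  shows "(\<lambda>x. a * R a u x) = R 0 (\<lambda>y. a * (u y - a * R a u y))"
    and "(\<lambda>y. a * (u y - a * R a u y)) \<in> bounded_borel"
proof -
  have w: "(\<lambda>y. u y - a * R a u y) \<in> bounded_borel"
    by (intro bounded_borel_diff bounded_borel_cmult u R_bounded_borel a)
  show "(\<lambda>x. a * R a u x) = R 0 (\<lambda>y. a * (u y - a * R a u y))"
  proof
    show "a * R a u x = R 0 (\<lambda>y. a * (u y - a * R a u y)) x" for x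
      unfolding R_cmult[OF w order_refl] R_as_potential[OF u a, of x, symmetric] ..
  qed
  show "(\<lambda>y. a * (u y - a * R a u y)) \<in> bounded_borel" by (rule bounded_borel_cmult[OF w])
qed

text \<open>Kakutani's lattice argument; the interpolating functions are the \<open>\<alpha> R\<^sub>\<alpha> u\<close> themselves,
  because they converge to \<open>u\<close> at any two points simultaneously.\<close>

lemma sm_diff_dense:
  assumes u: "u \<in> C0" and e: "0 < \<epsilon>"
  shows "\<exists>g. sm_diff g \<and> (\<forall>x. \<bar>u x - g x\<bar> \<le> \<epsilon>)"
proof -
  have ub: "u \<in> bounded_borel" and uc: "continuous_on UNIV u"
    using u by (auto intro: C0_bounded_borel C0_continuous)
  define f where "f n x = real (Suc n) * R (real (Suc n)) u x" for n x
  have f: "sm_diff (f n)" for n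
    unfolding f_def using aR_as_R0[OF ub, of "real (Suc n)"] by (simp add: sm_diff_R0 del: of_nat_Suc)
  have lim: "(\<lambda>n. f n x) \<longlonglongrightarrow> u x" for x unfolding f_def by (rule R_pointwise[OF ub uc])
  have near: "eventually (\<lambda>n. \<bar>f n x - u x\<bar> < \<epsilon>) sequentially" for x
    using tendstoD[OF lim e, of x] by (simp add: dist_real_def)
  have e2: "0 < \<epsilon> / 2" using e by simp
  obtain Ku where Ku: "compact Ku" "\<And>x. x \<notin> Ku \<Longrightarrow> \<bar>u x\<bar> < \<epsilon> / 2" using C0_vanish[OF u e2] by metis
  have one: "\<exists>h. sm_diff h \<and> u x - \<epsilon> < h x \<and> (\<forall>y. h y < u y + \<epsilon>)" for x
  proof -
    define I where "I = {n. \<bar>f n x - u x\<bar> < \<epsilon>}"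
    obtain n0 where n0: "n0 \<in> I" using near[of x] by (auto simp: I_def eventually_sequentially)
    obtain K0 where K0: "compact K0" "\<And>x. x \<notin> K0 \<Longrightarrow> \<bar>f n0 x\<bar> < \<epsilon> / 2"
      using C0_vanish[OF sm_diff_C0[OF f] e2] by metis
    have op: "open {y. f n y < u y + \<epsilon>}" for n
      by (intro open_Collect_less continuous_intros uc C0_continuous[OF sm_diff_C0[OF f]])
    have "K0 \<union> Ku \<subseteq> (\<Union>n\<in>I. {y. f n y < u y + \<epsilon>})"
    proof
      fix y
      obtain n where "\<bar>f n x - u x\<bar> < \<epsilon>" "\<bar>f n y - u y\<bar> < \<epsilon>"
        using eventually_conj[OF near[of x] near[of y]] by (auto simp: eventually_sequentially)
      then show "y \<in> (\<Union>n\<in>I. {y. f n y < u y + \<epsilon>})" by (auto simp: I_def abs_less_iff)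
    qed
    then obtain D where D: "D \<subseteq> I" "finite D" "K0 \<union> Ku \<subseteq> (\<Union>n\<in>D. {y. f n y < u y + \<epsilon>})"
      by (rule compactE_image[OF compact_Un[OF K0(1) Ku(1)] op])
    \<comment> \<open>f n0 takes care of the points outside K0 \<union> Ku, where both it and u are
      below \<epsilon> / 2 in absolute value.\<close>
    let ?D = "insert n0 D"
    let ?h = "\<lambda>y. Min ((\<lambda>n. f n y) ` ?D)"
    have "sm_diff ?h" using D(2) by (intro sm_diff_Min f) auto
    moreover have "u x - \<epsilon> < ?h x"
    proof -
      have "?h x \<in> (\<lambda>n. f n x) ` ?D" using D(2) by (intro Min_in) auto
      then obtain n where "n \<in> I" "?h x = f n x" using D(1) n0 by auto
      then show ?thesis by (simp add: I_def abs_less_iff)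
    qed
    moreover have "?h y < u y + \<epsilon>" for y
    proof -
      have "\<exists>n\<in>?D. f n y < u y + \<epsilon>"
      proof (cases "y \<in> K0 \<union> Ku")
        case True
        then show ?thesis using D(3) by blast
      next
        case False
        then have "f n0 y < u y + \<epsilon>" using K0(2)[of y] Ku(2)[of y] by (simp add: abs_less_iff)
        then show ?thesis by blast
      qed
      then obtain n where n: "n \<in> ?D" "f n y < u y + \<epsilon>" by blast
      have "?h y \<le> f n y" using n(1) D(2) by (intro Min_le) auto
      with n(2) show ?thesis by simp
    qed
    ultimately show ?thesis by blast
  qed
  then obtain h where h: "\<And>x. sm_diff (h x)" "\<And>x. u x - \<epsilon> < h x x" "\<And>x y. h x y < u y + \<epsilon>" by metis
  \<comment> \<open>Any point will do: h x0 is small outside a compact set, so putting x0 into the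
    index set bounds the maximum from below near infinity.\<close>
  obtain x0 :: 'a where True by simp
  obtain K0 where K0: "compact K0" "\<And>y. y \<notin> K0 \<Longrightarrow> \<bar>h x0 y\<bar> < \<epsilon> / 2"
    using C0_vanish[OF sm_diff_C0[OF h(1)] e2] by metis
  have op: "open {y. u y - \<epsilon> < h x y}" for x
    by (intro open_Collect_less continuous_intros uc C0_continuous[OF sm_diff_C0[OF h(1)]])
  have "K0 \<union> Ku \<subseteq> (\<Union>x\<in>UNIV. {y. u y - \<epsilon> < h x y})" using h(2) by blast
  then obtain D where "D \<subseteq> UNIV" and D: "finite D" "K0 \<union> Ku \<subseteq> (\<Union>x\<in>D. {y. u y - \<epsilon> < h x y})"
    by (rule compactE_image[OF compact_Un[OF K0(1) Ku(1)] op])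
  let ?D = "insert x0 D"
  let ?g = "\<lambda>y. Max ((\<lambda>x. h x y) ` ?D)"
  have "sm_diff ?g" using D(1) by (intro sm_diff_Max h(1)) auto
  moreover have "\<bar>u y - ?g y\<bar> \<le> \<epsilon>" for y
  proof -
    have "?g y \<in> (\<lambda>x. h x y) ` ?D" using D(1) by (intro Max_in) auto
    then have up: "?g y < u y + \<epsilon>" using h(3) by auto
    have "\<exists>x\<in>?D. u y - \<epsilon> < h x y"
    proof (cases "y \<in> K0 \<union> Ku")
      case True
      then show ?thesis using D(2) by blast
    next
      case False
      then have "u y - \<epsilon> < h x0 y" using K0(2)[of y] Ku(2)[of y] by (simp add: abs_less_iff)
      then show ?thesis by blast
    qed
    then obtain x where x: "x \<in> ?D" "u y - \<epsilon> < h x y" by blast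
    have "h x y \<le> ?g y" using x(1) D(1) by (intro Max_ge) auto
    with x(2) up show ?thesis by (simp add: abs_le_iff)
  qed
  ultimately show ?thesis by blast
qed

theorem C0_strongly_approx: "u \<in> C0 \<Longrightarrow> strongly_approx u"
  using sm_diff_dense sm_diff_strongly_approx by (intro strongly_approx_closed) blast+

theorem tc_resolvent_feller: "feller_resolvent (tc_resolvent Z A)"
proof -
  have eq: "tc_resolvent Z A a u = R a u" if "0 < a" "u \<in> bounded_borel" for a u
    using tc_resolvent_eq[OF that(2,1)] by blast
  show ?thesis unfolding feller_resolvent_def
  proof (intro conjI allI impI ballI)
    fix a :: real assume a: "0 < a"
    show "linear_on_bounded_borel (tc_resolvent Z A a)"
      unfolding linear_on_bounded_borel_def
      using a by (auto simp: eq R_bounded_borel bounded_borel_lin R_lin)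
    show "sub_markovian (\<lambda>u x. a * tc_resolvent Z A a u x)"
      unfolding sub_markovian_def
    proof (intro ballI impI allI)
      fix u :: "'a \<Rightarrow> real" and x assume u: "u \<in> bounded_borel" "\<forall>x. 0 \<le> u x \<and> u x \<le> 1"
      have "\<bar>a * R a u x\<bar> \<le> 1" by (rule R_abs_le) (use u a in \<open>auto simp: bounded_borel_def\<close>)
      moreover have "0 \<le> a * R a u x" using a u by (intro mult_nonneg_nonneg R_nonneg) auto
      ultimately show "0 \<le> a * tc_resolvent Z A a u x \<and> a * tc_resolvent Z A a u x \<le> 1"
        by (simp add: eq[OF a u(1)])
    qed
    show "tc_resolvent Z A a u \<in> C0" if "u \<in> C0" for u
      using that a by (simp add: eq C0_bounded_borel R_C0)
  next
    fix a b :: real and u :: "'a \<Rightarrow> real" and x assume ab: "0 < a" "0 < b" and u: "u \<in> bounded_borel"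
    show "tc_resolvent Z A a u x - tc_resolvent Z A b u x = (b - a) * tc_resolvent Z A a (tc_resolvent Z A b u) x"
      using resolvent_equation[OF u, of b a x] ab u by (simp add: eq R_bounded_borel)
  next
    fix u :: "'a \<Rightarrow> real" assume u: "u \<in> C0"
    show "((\<lambda>\<alpha>. supnorm (\<lambda>x. \<alpha> * tc_resolvent Z A \<alpha> u x - u x)) \<longlongrightarrow> 0) at_top"
    proof (rule supnorm_tendsto_0)
      fix \<epsilon> :: real assume "0 < \<epsilon>"
      then obtain N where N: "0 < N" "\<And>a x. N \<le> a \<Longrightarrow> \<bar>a * R a u x - u x\<bar> \<le> \<epsilon>"
        using C0_strongly_approx[OF u] unfolding strongly_approx_def by blast
      then show "eventually (\<lambda>a. \<forall>x. \<bar>a * tc_resolvent Z A a u x - u x\<bar> \<le> \<epsilon>) at_top"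
        unfolding eventually_at_top_linorder using C0_bounded_borel[OF u]
        by (intro exI[of _ N] allI impI) (simp add: eq)
    qed
  qed
qed

end

section \<open>The Feller property of the semigroup\<close>

lemma C0_sum:
  fixes f :: "nat \<Rightarrow> 'a::topological_space \<Rightarrow> real"
  assumes "\<And>i. f i \<in> C0" shows "(\<lambda>x. \<Sum>i\<le>n. f i x) \<in> C0"
  by (induction n) (auto intro: assms C0_add)

context full_fine_support begin

text \<open>[0, t) and [t, \<infinity>) partition the half-line, so that the indicators add up
  pointwise in \<open>P_R0\<close>.\<close>

definition J :: "real \<Rightarrow> ('a \<Rightarrow> real) \<Rightarrow> 'a \<Rightarrow> real" where
  "J t u x = (\<integral>s. indicator {0..<t} s * P s u x \<partial>lborel)"

lemma integrable_J:
  assumes u: "u \<in> bounded_borel" shows "integrable lborel (\<lambda>s. indicator {0..<t} s * P s u x)"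
proof (rule Bochner_Integration.integrable_bound[OF integrable_P[OF u, of x]])
  have [measurable]: "u \<in> borel_measurable borel" using u by (simp add: bounded_borel_def)
  show "(\<lambda>s. indicator {0..<t} s * P s u x) \<in> borel_measurable lborel" by measurable
qed (auto split: split_indicator)

text \<open>The factor exp (- s) beside the polynomial is the density of the substitution y = exp (-
  s). It turns uniform approximation in y into L1 approximation in s; the monomial of degree i
  contributes a multiple of R_(i+1) u.\<close>

lemma exp_poly_C0:
  assumes u: "u \<in> bounded_borel"
  shows "integrable lborel (\<lambda>s. indicator {0..} s * ((\<Sum>i\<le>n. a i * exp (- s) ^ i) * exp (- s)) * P s u x)"
    and "(\<lambda>x. \<integral>s. indicator {0..} s * ((\<Sum>i\<le>n. a i * exp (- s) ^ i) * exp (- s)) * P s u x \<partial>lborel) \<in> C0"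
proof -
  have eq: "indicator {0..} s * ((\<Sum>i\<le>n. a i * exp (- s) ^ i) * exp (- s)) * P s u x
    = (\<Sum>i\<le>n. a i * (indicator {0..} s * (exp (- real (Suc i) * s) * P s u x)))" for s :: real and x
  proof -
    have e: "exp (- s) ^ i * exp (- s) = exp (- real (Suc i) * s)" for i
      by (simp add: exp_of_nat_mult[symmetric] exp_add[symmetric] algebra_simps)
    have "indicator {0..} s * ((\<Sum>i\<le>n. a i * exp (- s) ^ i) * exp (- s)) * P s u x
      = (\<Sum>i\<le>n. a i * (indicator {0..} s * ((exp (- s) ^ i * exp (- s)) * P s u x)))"
      by (simp add: sum_distrib_left sum_distrib_right mult_ac)
    then show ?thesis by (simp only: e)
  qed
  show "integrable lborel (\<lambda>s. indicator {0..} s * ((\<Sum>i\<le>n. a i * exp (- s) ^ i) * exp (- s)) * P s u x)"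
    unfolding eq by (intro Bochner_Integration.integrable_sum integrable_mult_right integrable_exp_P u) simp
  have "(\<integral>s. indicator {0..} s * ((\<Sum>i\<le>n. a i * exp (- s) ^ i) * exp (- s)) * P s u x \<partial>lborel)
    = (\<Sum>i\<le>n. a i * R (real (Suc i)) u x)" for x
  proof -
    have int: "integrable lborel (\<lambda>s. indicator {0..} s * (exp (- real (Suc i) * s) * P s u x))" for i
      by (rule integrable_exp_P[OF u]) simp
    have "(\<integral>s. (\<Sum>i\<le>n. a i * (indicator {0..} s * (exp (- real (Suc i) * s) * P s u x))) \<partial>lborel)
      = (\<Sum>i\<le>n. \<integral>s. a i * (indicator {0..} s * (exp (- real (Suc i) * s) * P s u x)) \<partial>lborel)"
      by (rule Bochner_Integration.integral_sum) (intro integrable_mult_right int)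
    then show ?thesis unfolding eq by (simp only: integral_mult_right_zero R_def)
  qed
  moreover have "(\<lambda>x. \<Sum>i\<le>n. a i * R (real (Suc i)) u x) \<in> C0"
    by (intro C0_sum C0_cmult R_C0 u) simp
  ultimately show "(\<lambda>x. \<integral>s. indicator {0..} s * ((\<Sum>i\<le>n. a i * exp (- s) ^ i) * exp (- s)) * P s u x \<partial>lborel) \<in> C0"
    by simp
qed

text \<open>In the variable \<open>y = e\<^sup>-\<^sup>s\<close> the indicator of \<open>[0,t)\<close> is approximated in \<open>L\<^sup>1\<close> by polynomials,
  whose Laplace-type integrals are combinations of the \<open>R\<^sub>k u\<close>.\<close>

lemma J_C0:
  assumes u: "u \<in> bounded_borel" and t: "0 \<le> t" shows "J t u \<in> C0"
proof (rule C0_uniform_closed)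
  fix \<epsilon> :: real assume e: "0 < \<epsilon>"
  from u obtain c0 where um [measurable]: "u \<in> borel_measurable borel" and c0: "0 \<le> c0" "\<And>x. \<bar>u x\<bar> \<le> c0"
    unfolding bounded_borel_iff by blast
  define c where "c = c0 + 1"
  have c: "0 < c" "\<And>x. \<bar>u x\<bar> \<le> c" using c0(1) by (auto simp: c_def intro: order_trans[OF c0(2)])
  \<comment> \<open>Two errors of mass \<delta> each, weighted by |P_s u| \<le> c, add up to
    \<epsilon>.\<close>
  define \<delta> where "\<delta> = \<epsilon> / (2 * c)"
  have \<delta>: "0 < \<delta>" using e c by (simp add: \<delta>_def)
  define w where "w = exp (- t - \<delta>)"
  define v where "v = exp (- t)"
  have wv: "0 < w" "w < v" using \<delta> by (auto simp: w_def v_def)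
  define cl where "cl y = max 0 (min 1 ((y - w) / (v - w)))" for y
  have cl: "0 \<le> cl y" "cl y \<le> 1" for y by (auto simp: cl_def)
  \<comment> \<open>The weight exp (- s) = y has to be cancelled, so the target is 1/y times a ramp
    that rises from 0 at w to 1 at v. As the ramp vanishes below w, \<open>max y w\<close> only
    keeps the quotient continuous at 0.\<close>
  define \<psi> where "\<psi> y = cl y / max y w" for y
  have "max y w \<noteq> 0" for y using wv by (auto simp: max_def)
  then have "continuous_on {0..1} \<psi>" unfolding \<psi>_def cl_def
    using wv by (intro continuous_intros) auto
  then obtain q where q: "real_polynomial_function q" "\<And>y. y \<in> {0..1} \<Longrightarrow> \<bar>\<psi> y - q y\<bar> < \<delta>"
    using Stone_Weierstrass_real_polynomial_function[of "{0..1::real}" \<psi> \<delta>] \<delta> by auto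
  obtain a n where qa: "q = (\<lambda>y. \<Sum>i\<le>n. a i * y ^ i)"
    using q(1) unfolding real_polynomial_function_iff_sum by blast
  let ?f = "\<lambda>s. indicator {0..} s * ((\<Sum>i\<le>n. a i * exp (- s) ^ i) * exp (- s))"
  \<comment> \<open>The first term covers the ramp, which in the variable s occupies
    [t, t + \<delta>]; the second covers the polynomial error \<delta> y = \<delta> exp (- s). Each
    has integral \<delta>.\<close>
  let ?B = "\<lambda>s. indicator {t..t + \<delta>} s + \<delta> * (indicator {0..} s * exp (- 1 * s))"
  have bound: "\<bar>indicator {0..<t} s - ?f s\<bar> \<le> ?B s" for s
  proof (cases "s < 0")
    case True
    then show ?thesis using \<delta> t by simp
  next
    case False
    define y where "y = exp (- s)"
    have y: "0 < y" "y \<in> {0..1}" using False by (auto simp: y_def)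
    have "\<bar>q y * y - \<psi> y * y\<bar> = \<bar>\<psi> y - q y\<bar> * y"
      using y by (simp add: abs_mult left_diff_distrib[symmetric] abs_minus_commute)
    also have "\<dots> \<le> \<delta> * y" using q(2)[OF y(2)] y by (intro mult_right_mono) auto
    finally have 1: "\<bar>q y * y - \<psi> y * y\<bar> \<le> \<delta> * y" .
    have 2: "\<bar>indicator {0..<t} s - \<psi> y * y\<bar> \<le> indicator {t..t + \<delta>} s"
    proof -
      consider "s < t" | "t \<le> s" "s \<le> t + \<delta>" | "t + \<delta> < s" by linarith
      then show ?thesis
      proof cases
        case 1
        then have "v \<le> y" by (simp add: v_def y_def)
        then have "cl y = 1" "max y w = y" using wv by (auto simp: cl_def)
        then show ?thesis using 1 False y by (simp add: \<psi>_def)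
      next
        case 2
        then have "w \<le> y" by (simp add: w_def y_def)
        then have "\<psi> y * y = cl y" using y by (simp add: \<psi>_def max_def)
        then show ?thesis using 2 cl[of y] by simp
      next
        case 3
        then have "y < w" by (simp add: w_def y_def)
        then have "cl y = 0" using wv by (simp add: cl_def divide_le_0_iff)
        then show ?thesis using 3 \<delta> by (simp add: \<psi>_def)
      qed
    qed
    have f_eq: "?f s = q y * y" using False by (simp add: qa y_def)
    have B_eq: "?B s = indicator {t..t + \<delta>} s + \<delta> * y" using False by (simp add: y_def)
    show ?thesis unfolding f_eq B_eq using 1 2 by linarith
  qed
  have I_int: "integrable lborel (\<lambda>s. indicator {t..t + \<delta>} s :: real)"
    by (rule integrable_real_indicator) (use \<delta> in auto)
  have B_int: "integrable lborel ?B"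
    by (intro Bochner_Integration.integrable_add I_int integrable_mult_right integrable_exp_Ici) simp
  have B_val: "(\<integral>s. ?B s \<partial>lborel) = 2 * \<delta>"
  proof -
    have "(\<integral>s. ?B s \<partial>lborel) = (\<integral>s. indicator {t..t + \<delta>} s \<partial>lborel) + (\<integral>s. \<delta> * (indicator {0..} s * exp (- 1 * s)) \<partial>lborel)"
      by (intro Bochner_Integration.integral_add I_int integrable_mult_right integrable_exp_Ici) simp
    also have "\<dots> = \<delta> + \<delta> * (1 / 1)"
      unfolding integral_mult_right_zero integral_exp_Ici[OF zero_less_one] using \<delta> by simp
    finally show ?thesis by simp
  qed
  show "\<exists>g\<in>C0. \<forall>x. \<bar>J t u x - g x\<bar> \<le> \<epsilon>"
  proof (intro bexI[OF _ exp_poly_C0(2)[OF u, where n = n and a = a]] allI)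
    fix x
    have "J t u x - (\<integral>s. ?f s * P s u x \<partial>lborel) = (\<integral>s. (indicator {0..<t} s - ?f s) * P s u x \<partial>lborel)"
      unfolding J_def left_diff_distrib
      by (rule Bochner_Integration.integral_diff[symmetric, OF integrable_J[OF u] exp_poly_C0(1)[OF u]])
    moreover have "\<bar>\<integral>s. (indicator {0..<t} s - ?f s) * P s u x \<partial>lborel\<bar> \<le> (\<integral>s. ?B s * c \<partial>lborel)"
    proof -
      have "integrable lborel (\<lambda>s. (indicator {0..<t} s - ?f s) * P s u x)"
        unfolding left_diff_distrib
        by (intro Bochner_Integration.integrable_diff integrable_J exp_poly_C0 u)
      then have "\<bar>\<integral>s. (indicator {0..<t} s - ?f s) * P s u x \<partial>lborel\<bar> \<le> (\<integral>s. \<bar>(indicator {0..<t} s - ?f s) * P s u x\<bar> \<partial>lborel)"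
        by (intro integral_abs_bound)
      also have "\<dots> \<le> (\<integral>s. ?B s * c \<partial>lborel)"
      proof (rule integral_mono)
        show "integrable lborel (\<lambda>s. \<bar>(indicator {0..<t} s - ?f s) * P s u x\<bar>)" by (rule integrable_abs) fact
        show "integrable lborel (\<lambda>s. ?B s * c)" using B_int by (rule integrable_mult_left)
        show "\<bar>(indicator {0..<t} s - ?f s) * P s u x\<bar> \<le> ?B s * c" for s
          unfolding abs_mult by (rule mult_mono[OF bound P_abs_le[OF um c(2)]]) (use \<delta> in \<open>auto intro!: add_nonneg_nonneg\<close>)
      qed
      finally show ?thesis .
    qed
    moreover have "(\<integral>s. ?B s * c \<partial>lborel) = \<epsilon>"
      using B_val c(1) by (subst integral_mult_left_zero) (simp add: \<delta>_def)
    ultimately show "\<bar>J t u x - (\<integral>s. ?f s * P s u x \<partial>lborel)\<bar> \<le> \<epsilon>" by simp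
  qed
qed

lemma J_abs_le:
  assumes u: "u \<in> borel_measurable borel" "\<And>y. \<bar>u y\<bar> \<le> c" and t: "0 \<le> t"
  shows "\<bar>J t u x\<bar> \<le> t * c"
proof -
  have ub: "u \<in> bounded_borel" by (rule bounded_borelI[OF u])
  have "\<bar>J t u x\<bar> \<le> (\<integral>s. \<bar>indicator {0..<t} s * P s u x\<bar> \<partial>lborel)" unfolding J_def by (rule integral_abs_bound)
  also have "\<dots> \<le> (\<integral>s. indicator {0..<t} s * c \<partial>lborel)"
  proof (rule integral_mono)
    show "integrable lborel (\<lambda>s. \<bar>indicator {0..<t} s * P s u x\<bar>)" by (intro integrable_abs integrable_J ub)
    show "\<bar>indicator {0..<t} s * P s u x\<bar> \<le> indicator {0..<t} s * c" for s
      using P_abs_le[OF u, of s x] by (simp add: abs_mult split: split_indicator)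
  qed (use t in auto)
  finally show ?thesis using t by simp
qed

lemma P_R0:
  assumes u: "u \<in> bounded_borel" and t: "0 \<le> t"
  shows "P t (R 0 u) x = R 0 u x - J t u x"
proof -
  have um [measurable]: "u \<in> borel_measurable borel" using u by (simp add: bounded_borel_def)
  have split: "indicator {0..} r * P r u x = indicator {0..<t} r * P r u x + indicator {t..} r * P r u x" for r
    using t by (auto split: split_indicator)
  have int: "integrable lborel (\<lambda>r. indicator {t..} r * P r u x)"
  proof (rule Bochner_Integration.integrable_bound[OF integrable_P[OF u, of x]])
    show "(\<lambda>r. indicator {t..} r * P r u x) \<in> borel_measurable lborel" by measurable
  qed (use t in \<open>auto split: split_indicator\<close>)
  have "P t (R 0 u) x = (\<integral>s. indicator {0..} s * P (t + s) u x \<partial>lborel)"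
    using P_R_eq[OF u order_refl t, of x] by simp
  also have "\<dots> = (\<integral>r. indicator {t..} r * P r u x \<partial>lborel)"
    by (subst (2) lborel_integral_real_affine[where c = 1 and t = t])
      (auto intro!: Bochner_Integration.integral_cong simp: indicator_def)
  finally have 1: "P t (R 0 u) x = (\<integral>r. indicator {t..} r * P r u x \<partial>lborel)" .
  have "R 0 u x = (\<integral>r. indicator {0..<t} r * P r u x + indicator {t..} r * P r u x \<partial>lborel)"
    unfolding R_def split[symmetric] by simp
  also have "\<dots> = J t u x + (\<integral>r. indicator {t..} r * P r u x \<partial>lborel)"
    unfolding J_def by (rule Bochner_Integration.integral_add[OF integrable_J[OF u] int])
  finally show ?thesis using 1 by simp
qed

lemma R0_dense:
  assumes u: "u \<in> C0" and e: "0 < \<epsilon>"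
  obtains f where "f \<in> bounded_borel" "\<And>x. \<bar>u x - R 0 f x\<bar> \<le> \<epsilon>"
proof -
  obtain N where N: "0 < N" "\<And>a x. N \<le> a \<Longrightarrow> \<bar>a * R a u x - u x\<bar> \<le> \<epsilon>"
    using C0_strongly_approx[OF u] e unfolding strongly_approx_def by blast
  note w = aR_as_R0[OF C0_bounded_borel[OF u] less_imp_le[OF N(1)]]
  show ?thesis
    by (rule that[OF w(2)]) (use N(2)[OF order_refl] in \<open>simp add: fun_cong[OF w(1), symmetric] abs_minus_commute\<close>)
qed

lemma P_C0:
  assumes u: "u \<in> C0" and t: "0 \<le> t" shows "P t u \<in> C0"
proof (rule C0_uniform_closed)
  fix \<epsilon> :: real assume e: "0 < \<epsilon>"
  obtain f where f: "f \<in> bounded_borel" "\<And>x. \<bar>u x - R 0 f x\<bar> \<le> \<epsilon>" using R0_dense[OF u e] by metis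
  have RC: "R 0 f \<in> C0" by (rule R_C0[OF f(1) order_refl])
  have ub: "u \<in> bounded_borel" and Rb: "R 0 f \<in> bounded_borel" by (auto intro: C0_bounded_borel u RC)
  have "(\<lambda>x. R 0 f x - J t f x) \<in> C0" by (intro C0_diff RC J_C0 f t)
  moreover have "\<bar>P t u x - (R 0 f x - J t f x)\<bar> \<le> \<epsilon>" for x
    unfolding P_R0[OF f(1) t, symmetric] P_diff[OF ub Rb, symmetric]
    by (rule P_abs_le) (use bounded_borel_diff[OF ub Rb] f(2) in \<open>auto simp: bounded_borel_def\<close>)
  ultimately show "\<exists>g\<in>C0. \<forall>x. \<bar>P t u x - g x\<bar> \<le> \<epsilon>"
    by (intro bexI[of _ "\<lambda>x. R 0 f x - J t f x"] allI)
qed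

text \<open>On the range of R_0 the deviation is J_t f, bounded by t times a bound of f; density of
  the range and contraction of P_t do the rest.\<close>

lemma P_strongly_continuous:
  assumes u: "u \<in> C0" and e: "0 < \<epsilon>"
  shows "eventually (\<lambda>t. \<forall>x. \<bar>P t u x - u x\<bar> \<le> \<epsilon>) (at_right 0)"
proof -
  have e3: "0 < \<epsilon> / 3" using e by simp
  obtain f where f: "f \<in> bounded_borel" "\<And>x. \<bar>u x - R 0 f x\<bar> \<le> \<epsilon> / 3" using R0_dense[OF u e3] by metis
  from f(1) obtain c where fm: "f \<in> borel_measurable borel" and c: "0 \<le> c" "\<And>x. \<bar>f x\<bar> \<le> c"
    unfolding bounded_borel_iff by blast
  have ub: "u \<in> bounded_borel" and Rb: "R 0 f \<in> bounded_borel"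
    by (auto intro: C0_bounded_borel u R_C0[OF f(1)])
  have d: "(\<lambda>x. u x - R 0 f x) \<in> borel_measurable borel"
    using bounded_borel_diff[OF ub Rb] by (simp add: bounded_borel_def)
  have "((\<lambda>t. t * c) \<longlongrightarrow> 0 * c) (at_right 0)" by (intro tendsto_intros)
  then have "eventually (\<lambda>t. t * c < \<epsilon> / 3) (at_right 0)" using e3 by (intro order_tendstoD(2)) auto
  moreover have "eventually (\<lambda>t :: real. 0 < t) (at_right 0)" by (rule eventually_at_right_less)
  ultimately show ?thesis
  proof eventually_elim
    case (elim t)
    show ?case
    proof
      fix x
      have "\<bar>P t (\<lambda>x. u x - R 0 f x) x\<bar> \<le> \<epsilon> / 3" by (rule P_abs_le[OF d f(2)])
      then have "\<bar>P t u x - P t (R 0 f) x\<bar> \<le> \<epsilon> / 3" by (simp add: P_diff[OF ub Rb])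
      moreover have "\<bar>P t (R 0 f) x - R 0 f x\<bar> \<le> \<epsilon> / 3"
        using J_abs_le[OF fm c(2), of t x] elim by (simp add: P_R0[OF f(1)])
      ultimately show "\<bar>P t u x - u x\<bar> \<le> \<epsilon>" using f(2)[of x] by linarith
    qed
  qed
qed

text \<open>Y_t is known to be measurable only for the augmented filtration, so Borel measurability
  of x \<mapsto> E_x[f(Y_t)] does not follow from that of the coordinate laws. P_t f is recovered as
  the right derivative in t of J_t f, which lies in C0 for every t.\<close>

lemma P_continuous_measurable:
  assumes f: "f \<in> bounded_borel" "continuous_on UNIV f" and t: "0 \<le> t"
  shows "P t f \<in> borel_measurable borel"
proof (rule borel_measurable_LIMSEQ_real)
  from f obtain c where um [measurable]: "f \<in> borel_measurable borel" and c: "0 \<le> c" "\<And>x. \<bar>f x\<bar> \<le> c"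
    unfolding bounded_borel_iff by blast
  let ?h = "\<lambda>n. 1 / real (Suc n)"
  show "(\<lambda>x. real (Suc n) * (J (t + ?h n) f x - J t f x)) \<in> borel_measurable borel" for n
  proof -
    have "0 \<le> t + ?h n" using t by simp
    then have "J (t + ?h n) f \<in> bounded_borel" "J t f \<in> bounded_borel"
      using J_C0[OF f(1)] t by (auto intro!: C0_bounded_borel)
    then have [measurable]: "J (t + ?h n) f \<in> borel_measurable borel" "J t f \<in> borel_measurable borel"
      unfolding bounded_borel_def by simp_all
    show ?thesis by measurable
  qed
  fix x
  have eq: "real (Suc n) * (J (t + ?h n) f x - J t f x) = (\<integral>r. indicator {0..<1} r * P (t + ?h n * r) f x \<partial>lborel)" for n
  proof -
    have h0: "0 < ?h n" by simp
    have "J (t + ?h n) f x - J t f x = (\<integral>s. indicator {0..<t + ?h n} s * P s f x - indicator {0..<t} s * P s f x \<partial>lborel)"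
      unfolding J_def by (rule Bochner_Integration.integral_diff[symmetric, OF integrable_J[OF f(1)] integrable_J[OF f(1)]])
    also have "\<dots> = (\<integral>s. indicator {t..<t + ?h n} s * P s f x \<partial>lborel)"
    proof (intro Bochner_Integration.integral_cong refl)
      have "indicator {0..<t + h} s * y - indicator {0..<t} s * y = indicator {t..<t + h} s * y" if "0 < h" for s y h :: real
        using t that by (auto split: split_indicator)
      from this[OF h0] show "indicator {0..<t + ?h n} s * P s f x - indicator {0..<t} s * P s f x = indicator {t..<t + ?h n} s * P s f x" for s .
    qed
    also have "\<dots> = \<bar>?h n\<bar> *\<^sub>R (\<integral>r. indicator {t..<t + ?h n} (t + ?h n * r) * P (t + ?h n * r) f x \<partial>lborel)"
      by (rule lborel_integral_real_affine) simp
    also have "(\<lambda>r. indicator {t..<t + ?h n} (t + ?h n * r) * P (t + ?h n * r) f x) = (\<lambda>r. indicator {0..<1} r * P (t + ?h n * r) f x)"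
      using h0 by (auto simp: zero_le_divide_iff pos_divide_less_eq divide_less_cancel fun_eq_iff split: split_indicator)
    finally show ?thesis by (simp del: of_nat_Suc)
  qed
  have "(\<lambda>n. \<integral>r. indicator {0..<1} r * P (t + ?h n * r) f x \<partial>lborel) \<longlonglongrightarrow> (\<integral>r. indicator {0..<1 :: real} r * P t f x \<partial>lborel)"
  proof (rule integral_dominated_convergence[where w = "\<lambda>r. c * indicator {0..<1} r"])
    show "AE r in lborel. (\<lambda>n. indicator {0..<1} r * P (t + ?h n * r) f x) \<longlonglongrightarrow> indicator {0..<1} r * P t f x"
    proof (rule AE_I2)
      fix r :: real
      consider "r = 0" | "0 < r" | "r < 0" by linarith
      then show "(\<lambda>n. indicator {0..<1} r * P (t + ?h n * r) f x) \<longlonglongrightarrow> indicator {0..<1} r * P t f x"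
      proof cases
        case 2
        have "?h \<longlonglongrightarrow> 0" using LIMSEQ_Suc[OF lim_inverse_n'] by simp
        then have "(\<lambda>n. t + ?h n * r) \<longlonglongrightarrow> t + 0 * r" by (intro tendsto_intros)
        then have "filterlim (\<lambda>n. t + ?h n * r) (at_right t) sequentially"
          using 2 by (auto simp: filterlim_at intro!: always_eventually)
        from P_right_cont[OF f this, of x] show ?thesis by (rule tendsto_mult_left)
      qed auto
    qed
    show "AE r in lborel. norm (indicator {0..<1} r * P (t + ?h n * r) f x) \<le> c * indicator {0..<1} r" for n
      by (intro AE_I2) (use P_abs_le[OF um c(2)] in \<open>auto simp: abs_mult split: split_indicator\<close>)
    show "integrable lborel (\<lambda>r. c * indicator {0..<1 :: real} r)"
      by (intro integrable_mult_right integrable_real_indicator) auto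
  qed measurable
  then show "(\<lambda>n. real (Suc n) * (J (t + ?h n) f x - J t f x)) \<longlonglongrightarrow> P t f x" unfolding eq by simp
qed

section \<open>Transition kernels of the time-changed process and the semigroup law\<close>

definition tc_kernel :: "real \<Rightarrow> 'a \<Rightarrow> 'a option measure" where
  "tc_kernel t x = distr (law Z (Some x)) cem_borel (Y t)"

lemma P_tc_kernel:
  "u \<in> borel_measurable borel \<Longrightarrow> P t u x = (\<integral>z. ext0 u z \<partial>tc_kernel t x)"
  unfolding tc_kernel_def P_eq by (subst integral_distr) auto

lemma tc_kernel_closed_measurable:
  assumes C: "closed C" and t: "0 \<le> t"
  shows "(\<lambda>x. emeasure (tc_kernel t x) (Some ` C)) \<in> borel_measurable borel"
proof (cases "C = {}")
  case False
  \<comment> \<open>Continuous functions that decrease to the indicator of C; at a point outside C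
    they vanish once n exceeds the reciprocal of its distance from C.\<close>
  define f where "f n y = max 0 (1 - real n * infdist y C)" for n y
  have fc: "continuous_on UNIV (f n)" for n unfolding f_def by (intro continuous_intros)
  have f01: "0 \<le> f n y" "f n y \<le> 1" for n y by (auto simp: f_def infdist_nonneg)
  have fb: "f n \<in> bounded_borel" for n
    by (rule bounded_borelI[where c = 1]) (use f01 borel_measurable_continuous_onI[OF fc] in auto)
  have fm [measurable]: "f n \<in> borel_measurable borel" for n using fb[of n] by (simp add: bounded_borel_def)
  have Cm [measurable]: "C \<in> sets borel" using C by (rule borel_closed)
  have lim: "(\<lambda>n. f n y) \<longlonglongrightarrow> indicator C y" for y
  proof (cases "y \<in> C")
    case True
    then show ?thesis by (simp add: f_def)
  next
    case F: False
    have "infdist y C \<noteq> 0" using F in_closed_iff_infdist_zero[OF C False, of y] by simp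
    then have pos: "0 < infdist y C" using infdist_nonneg[of y C] by linarith
    obtain N where N: "1 / infdist y C < real N" using reals_Archimedean2 by blast
    have "f n y = 0" if "N \<le> n" for n
    proof -
      have "1 / infdist y C < real n" using N that by linarith
      then have "1 < real n * infdist y C" using pos by (simp add: pos_divide_less_eq)
      then show ?thesis by (simp add: f_def)
    qed
    then have "eventually (\<lambda>n. f n y = indicator C y) sequentially"
      using F by (auto simp: eventually_sequentially)
    then show ?thesis by (rule tendsto_eventually)
  qed
  have lim': "(\<lambda>n. P t (f n) x) \<longlonglongrightarrow> P t (indicator C) x" for x
  proof -
    interpret L: prob_space "law Z (Some x)" by (rule prob_law)
    show ?thesis unfolding P_eq
    proof (rule integral_dominated_convergence[where w = "\<lambda>_. 1"])
      show "AE \<omega> in law Z (Some x). (\<lambda>n. ext0 (f n) (Y t \<omega>)) \<longlonglongrightarrow> ext0 (indicator C) (Y t \<omega>)"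
      proof (rule AE_I2)
        fix \<omega> show "(\<lambda>n. ext0 (f n) (Y t \<omega>)) \<longlonglongrightarrow> ext0 (indicator C) (Y t \<omega>)"
          using lim by (cases "Y t \<omega>") auto
      qed
      show "AE \<omega> in law Z (Some x). norm (ext0 (f n) (Y t \<omega>)) \<le> 1" for n
      proof (rule AE_I2)
        fix \<omega> show "norm (ext0 (f n) (Y t \<omega>)) \<le> 1" using f01 by (cases "Y t \<omega>") auto
      qed
    qed auto
  qed
  have "P t (indicator C) \<in> borel_measurable borel"
    by (rule borel_measurable_LIMSEQ_real[OF lim' P_continuous_measurable[OF fb fc t]])
  moreover have "emeasure (tc_kernel t x) (Some ` C) = ennreal (P t (indicator C) x)" for x
  proof -
    have i: "(indicator C :: 'a \<Rightarrow> real) \<in> bounded_borel" by (rule bounded_borelI[where c = 1]) (auto simp: indicator_def)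
    have "ennreal (P t (indicator C) x) = (\<integral>\<^sup>+ \<omega>. ennreal (ext0 (indicator C) (Y t \<omega>)) \<partial>law Z (Some x))"
      by (rule ennreal_P[OF i]) simp
    also have "\<dots> = (\<integral>\<^sup>+ \<omega>. indicator (Some ` C) (Y t \<omega>) \<partial>law Z (Some x))"
    proof (rule nn_integral_cong)
      fix \<omega> show "ennreal (ext0 (indicator C) (Y t \<omega>)) = indicator (Some ` C) (Y t \<omega>)"
        by (cases "Y t \<omega>") (auto simp: indicator_def)
    qed
    also have "\<dots> = (\<integral>\<^sup>+ z. indicator (Some ` C) z \<partial>tc_kernel t x)"
      unfolding tc_kernel_def using Some_closed_in_cem_borel[OF C]
      by (subst nn_integral_distr) auto
    also have "\<dots> = emeasure (tc_kernel t x) (Some ` C)"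
      using Some_closed_in_cem_borel[OF C] by (subst nn_integral_indicator) (auto simp: tc_kernel_def)
    finally show ?thesis by simp
  qed
  ultimately show ?thesis by simp
qed simp

lemma P_measurable:
  assumes u [measurable]: "u \<in> borel_measurable borel" and t: "0 \<le> t"
  shows "P t u \<in> borel_measurable borel"
proof -
  \<comment> \<open>None of the images of closed sets contains the cemetery, so the whole space is
    added to the generator; on it the kernel has mass 1.\<close>
  let ?G = "insert UNIV {Some ` C | C :: 'a set. closed C}"
  have gen: "sets (cem_borel :: 'a option measure) = sigma_sets UNIV ?G"
  proof (rule equalityI)
    have "?G \<subseteq> sets cem_borel" using Some_closed_in_cem_borel sets.top[of "cem_borel :: 'a option measure"] by auto
    from sets.sigma_sets_subset[OF this] show "sigma_sets UNIV ?G \<subseteq> sets cem_borel" by simp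
    show "sets cem_borel \<subseteq> sigma_sets UNIV ?G"
      unfolding sets_cem_borel
    proof (rule sigma_sets_mono, rule subsetI)
      interpret sigma_algebra UNIV "sigma_sets UNIV ?G" by (rule sigma_algebra_sigma_sets) simp
      have b: "Some ` C \<in> sigma_sets UNIV ?G" if "closed C" for C :: "'a set"
        using that by (intro sigma_sets.Basic) blast
      fix U :: "'a option set" assume "U \<in> {U. openin cem_top U}"
      then have "openin cem_top U" by simp
      then show "U \<in> sigma_sets UNIV ?G"
      proof (cases rule: cem_openE)
        case (1 C)
        then show ?thesis using b[OF 1(1)] by (simp add: sigma_sets.Compl)
      next
        case (2 C)
        then show ?thesis using b[OF 2(1)] b[of UNIV] by auto
      qed
    qed
  qed
  have stable: "Int_stable ?G"
  proof (rule Int_stableI)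
    fix a b assume ab: "a \<in> ?G" "b \<in> ?G"
    have G2: "Some ` C \<inter> Some ` D \<in> ?G" if "closed C" "closed D" for C D :: "'a set"
    proof -
      have "Some ` C \<inter> Some ` D = Some ` (C \<inter> D)" by auto
      then show ?thesis using closed_Int[OF that] by blast
    qed
    show "a \<inter> b \<in> ?G"
    proof (cases "a = UNIV \<or> b = UNIV")
      case True
      then show ?thesis using ab by (elim disjE) (simp_all only: Int_UNIV_left Int_UNIV_right)
    next
      case False
      then obtain C D where "a = Some ` C" "closed C" "b = Some ` D" "closed D" using ab by blast
      then show ?thesis using G2 by simp
    qed
  qed
  have prob: "prob_space (tc_kernel t x)" for x
    unfolding tc_kernel_def by (rule prob_space.prob_space_distr[OF prob_law]) simp
  have k: "tc_kernel t \<in> borel \<rightarrow>\<^sub>M subprob_algebra cem_borel"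
  proof (rule measurable_subprob_algebra_generated[OF gen stable])
    show "subprob_space (tc_kernel t x)" for x by (rule prob_space_imp_subprob_space[OF prob])
    show "sets (tc_kernel t x) = sets cem_borel" for x by (simp add: tc_kernel_def)
    have 1: "emeasure (tc_kernel t x) UNIV = 1" for x
      using prob_space.emeasure_space_1[OF prob, of x] by (simp add: tc_kernel_def)
    then show "(\<lambda>x. emeasure (tc_kernel t x) UNIV) \<in> borel_measurable borel" by simp
    show "(\<lambda>x. emeasure (tc_kernel t x) A) \<in> borel_measurable borel" if "A \<in> ?G" for A
      using that 1 tc_kernel_closed_measurable[OF _ t] by auto
  qed simp
  have "(\<lambda>x. \<integral>z. ext0 u z \<partial>tc_kernel t x) \<in> borel_measurable borel"
    by (rule measurable_compose[OF k integral_measurable_subprob_algebra]) measurable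
  then show ?thesis by (simp add: P_tc_kernel[OF u, symmetric])
qed

lemma P_bounded_borel:
  assumes "u \<in> bounded_borel" "0 \<le> t" shows "P t u \<in> bounded_borel"
proof -
  from assms obtain c where u: "u \<in> borel_measurable borel" "\<And>x. \<bar>u x\<bar> \<le> c" unfolding bounded_borel_iff by blast
  show ?thesis by (rule bounded_borelI[OF P_measurable[OF u(1) assms(2)] P_abs_le[OF u]])
qed

text \<open>Strong Markov property at \<tau>_s for the functional u(Y_t). Its mean P_t u must be
  Borel in the starting point, which is the purpose of \<open>P_measurable\<close>.\<close>

lemma P_semigroup_nonneg:
  assumes u: "u \<in> bounded_borel" "\<And>y. 0 \<le> u y" and s: "0 \<le> s" and t: "0 \<le> t"
  shows "P (s + t) u x = P s (P t u) x"
proof -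
  have um [measurable]: "u \<in> borel_measurable borel" using u by (simp add: bounded_borel_def)
  note Pb = P_bounded_borel[OF u(1) t]
  have [measurable]: "P t u \<in> borel_measurable borel" using Pb by (simp add: bounded_borel_def)
  define \<Phi> where "\<Phi> \<omega> = ennreal (ext0 u (Y t \<omega>))" for \<omega>
  have \<Phi>: "\<Phi> \<in> borel_measurable (aug_filt Z top)"
    unfolding \<Phi>_def using Y_aug_measurable[of t, measurable] by measurable
  have g: "ext0 (\<lambda>x. ennreal (P t u x)) y = (\<integral>\<^sup>+ \<omega>. \<Phi> \<omega> \<partial>law Z y)" for y
  proof (cases y)
    case None
    have "(\<integral>\<^sup>+ \<omega>. \<Phi> \<omega> \<partial>law Z None) = (\<integral>\<^sup>+ \<omega>. 0 \<partial>law Z None)"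
      by (rule nn_integral_cong_AE, rule eventually_mono[OF law_None_Y]) (simp add: \<Phi>_def)
    then show ?thesis using None by simp
  qed (simp add: \<Phi>_def ennreal_P[OF u])
  have "ennreal (P (s + t) u x) = (\<integral>\<^sup>+ \<omega>. ennreal (ext0 u (Y (s + t) \<omega>)) \<partial>law Z (Some x))"
    by (rule ennreal_P[OF u])
  also have "\<dots> = (\<integral>\<^sup>+ \<omega>. \<Phi> (shift Z (tau s \<omega>) \<omega>) * indicator (paths Z) \<omega> \<partial>law Z (Some x))"
    by (rule nn_integral_cong_AE, rule eventually_mono[OF Lam_AE]) (simp add: \<Phi>_def Y_shift_tau s t Lam_paths)
  also have "\<dots> = (\<integral>\<^sup>+ \<omega>. ext0 (\<lambda>x. ennreal (P t u x)) (coord Z (tau s \<omega>) \<omega>) * indicator (paths Z) \<omega> \<partial>law Z (Some x))"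
    by (rule strong_markov_aug[OF tau_stopping paths_pre_sigma \<Phi> _ g]) measurable
  also have "\<dots> = (\<integral>\<^sup>+ \<omega>. ennreal (ext0 (P t u) (Y s \<omega>)) \<partial>law Z (Some x))"
    by (intro nn_integral_cong) (simp add: ennreal_ext0 Y_def)
  also have "\<dots> = ennreal (P s (P t u) x)"
    by (rule ennreal_P[OF Pb, symmetric]) (rule P_nonneg[OF u(2)])
  finally show ?thesis
    by (subst (asm) ennreal_inj) (auto intro!: P_nonneg[OF u(2)] P_nonneg[OF P_nonneg[OF u(2)]])
qed

lemma P_semigroup:
  assumes u: "u \<in> bounded_borel" and s: "0 \<le> s" and t: "0 \<le> t"
  shows "P (s + t) u x = P s (P t u) x"
proof -
  from u obtain c where c: "0 \<le> c" "\<And>x. \<bar>u x\<bar> \<le> c" unfolding bounded_borel_iff by blast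
  let ?v = "\<lambda>x. u x + c" and ?c = "\<lambda>_ :: 'a. c"
  have v: "?v \<in> bounded_borel" by (intro bounded_borel_add u bounded_borel_const)
  have v0: "0 \<le> ?v y" for y using c(2)[of y] by (simp add: abs_le_iff)
  have Pu: "P r u = (\<lambda>y. P r ?v y - P r ?c y)" for r
    using P_diff[OF v bounded_borel_const, of r c] by auto
  have "P (s + t) u x = P s (P t ?v) x - P s (P t ?c) x"
    unfolding Pu[of "s + t"] P_semigroup_nonneg[OF v v0 s t] P_semigroup_nonneg[OF bounded_borel_const c(1) s t] ..
  also have "\<dots> = P s (\<lambda>y. P t ?v y - P t ?c y) x"
    by (rule P_diff[symmetric, OF P_bounded_borel[OF v t] P_bounded_borel[OF bounded_borel_const t]])
  finally show ?thesis by (simp only: Pu[of t, symmetric])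
qed

theorem tc_semigroup_feller: "feller_semigroup (tc_semigroup Z A)"
  unfolding feller_semigroup_def
proof (intro conjI allI impI ballI)
  fix t :: real assume t: "0 \<le> t"
  show "linear_on_bounded_borel (P t)"
    unfolding linear_on_bounded_borel_def using t by (auto simp: P_bounded_borel P_lin)
  show "sub_markovian (P t)"
    unfolding sub_markovian_def
  proof (intro ballI impI allI)
    fix u :: "'a \<Rightarrow> real" and x assume u: "u \<in> bounded_borel" "\<forall>x. 0 \<le> u x \<and> u x \<le> 1"
    have "\<bar>P t u x\<bar> \<le> 1" by (rule P_abs_le) (use u in \<open>auto simp: bounded_borel_def\<close>)
    then show "0 \<le> P t u x \<and> P t u x \<le> 1" using P_nonneg[of u t x] u by simp
  qed
  show "P t u \<in> C0" if "u \<in> C0" for u using P_C0[OF that t] .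
next
  fix s t :: real and u :: "'a \<Rightarrow> real" assume "0 \<le> s" "0 \<le> t" "u \<in> bounded_borel"
  then show "P (s + t) u = P s (P t u)" using P_semigroup by blast
next
  fix u :: "'a \<Rightarrow> real" assume "u \<in> C0"
  then show "((\<lambda>t. supnorm (\<lambda>x. P t u x - u x)) \<longlongrightarrow> 0) (at_right 0)"
    by (intro supnorm_tendsto_0 P_strongly_continuous)
qed

end

text \<open>If the time integral of the density vanished, the density would vanish at almost every t
  in (0, 1), against its positivity for all t > 0.\<close>

lemma green_pos:
  assumes "transition_density m Z p" shows "0 < green p 0 x y"
proof -
  have p: "(\<lambda>(t, x, y). p t x y) \<in> borel_measurable (restrict_space borel {0<..} \<Otimes>\<^sub>M borel \<Otimes>\<^sub>M borel)"
    and pos: "\<And>t. 0 < t \<Longrightarrow> 0 < p t x y" using assms unfolding transition_density_def by blast+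
  have "(\<lambda>t. (t, x, y)) \<in> restrict_space borel {0<..} \<rightarrow>\<^sub>M restrict_space borel {0<..} \<Otimes>\<^sub>M borel \<Otimes>\<^sub>M borel"
    by measurable
  from measurable_compose[OF this p] have "(\<lambda>t. p t x y) \<in> borel_measurable (restrict_space borel {0 :: real<..})" by simp
  then have m: "(\<lambda>t. indicator {0<..} t * p t x y) \<in> borel_measurable borel"
    by (subst (asm) borel_measurable_restrict_space_iff) (simp_all add: mult.commute)
  have eq: "green p 0 x y = (\<integral>\<^sup>+ t. ennreal (indicator {0<..} t * p t x y) \<partial>lborel)"
    unfolding green_def by (intro nn_integral_cong) (auto split: split_indicator)
  have "green p 0 x y \<noteq> 0"
  proof
    assume "green p 0 x y = 0"
    then have "AE t in lborel. ennreal (indicator {0<..} t * p t x y) = 0"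
      unfolding eq using m by (subst (asm) nn_integral_0_iff_AE) auto
    then have "AE t in lborel. t \<notin> {0<..<1 :: real}"
    proof eventually_elim
      case (elim t)
      then show ?case using pos[of t] by (auto simp: ennreal_eq_0_iff)
    qed
    then have "emeasure lborel {0<..<1 :: real} = 0"
      by (subst (asm) AE_iff_null_sets[symmetric]) (auto simp: null_sets_def)
    then show False by simp
  qed
  then show ?thesis by (simp add: zero_less_iff_neq_zero)
qed

theorem corollary2p4:
  fixes Z :: "('w, 'a::{metric_space, second_countable_topology}) process"
    and Z' :: "('v, 'a) process"
    and m \<mu> :: "'a measure"
    and p :: "real \<Rightarrow> 'a \<Rightarrow> 'a \<Rightarrow> real"
    and A :: "ennreal \<Rightarrow> 'w \<Rightarrow> ennreal"
    and F :: "'a set"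
  assumes "locally_compact_space (euclidean :: 'a topology)"
    and "radon_measure m" and "full_support m"
    and "standard_process Z" and "transient Z"
    and "standard_process Z'" and "transient Z'" and "in_duality m Z Z'"
    and "transition_density m Z p"
    and "\<exists>x y. green p 0 x y \<noteq> \<infinity>"
    and "\<forall>c. open {(x, y). c < green p 0 x y}"
    and "G_Kato p \<mu>"
    and "pcaf Z A" and "revuz_measure Z m A \<mu>"
    and "\<forall>\<alpha>\<ge>0. \<forall>x. \<forall>u\<in>bounded_borel. (\<forall>y. 0 \<le> u y) \<longrightarrow>
           (\<integral>\<^sup>+ \<omega>. stieltjes (\<lambda>t. A t \<omega>)
              (\<lambda>t. ennreal (exp (- \<alpha> * t) * ext0 u (coord Z (ennreal t) \<omega>))) \<partial>law Z (Some x)) =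
           (\<integral>\<^sup>+ y. green p \<alpha> x y * ennreal (u y) \<partial>\<mu>)"
    and "fine_support Z \<mu> F" and "F = UNIV"
  shows "feller_resolvent (tc_resolvent Z A) \<and> feller_semigroup (tc_semigroup Z A)"
proof -
  note std = assms(4) and dens = assms(9) and lsc = assms(11) and kato = assms(12) and pc = assms(13)
    and formula = assms(15) and fine = assms(16) and F = assms(17)
  obtain \<Lambda> where L: "\<Lambda> \<in> sets (aug_filt Z \<infinity>)" "\<forall>x. AE \<omega> in law Z x. \<omega> \<in> \<Lambda>"
    "\<forall>\<omega>\<in>\<Lambda>.
           (\<forall>t<\<infinity>. shift Z t \<omega> \<in> \<Lambda>) \<and>
           A 0 \<omega> = 0 \<and>
           continuous_on {..<\<infinity>} (\<lambda>t. A t \<omega>) \<and>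
           (\<forall>t<lifetime Z \<omega>. A t \<omega> < \<infinity>) \<and>
           (\<forall>t<\<infinity>. lifetime Z \<omega> \<le> t \<longrightarrow> A t \<omega> = A (lifetime Z \<omega>) \<omega>) \<and>
           (\<forall>s<\<infinity>. \<forall>t<\<infinity>. A (t + s) \<omega> = A t \<omega> + A s (shift Z t \<omega>))"
    using pc unfolding pcaf_def by blast
  have Am: "\<forall>t<\<infinity>. A t \<in> borel_measurable (aug_filt Z t)" using pc unfolding pcaf_def by blast
  interpret std_process Z by (rule std_process.intro[OF std])
  interpret time_change Z A \<Lambda>
    by unfold_locales (use L Am in \<open>simp_all\<close>)
  have musets: "sets \<mu> = sets borel" using kato by (simp add: G_Kato_def radon_measure_def)
  have pot: "(\<integral>\<^sup>+ \<omega>. (\<integral>\<^sup>+ s\<in>{0..}. ennreal (ext0 u (Y s \<omega>)) \<partial>lborel) \<partial>law Z (Some x)) = (\<integral>\<^sup>+ y. green p 0 x y * ennreal (u y) \<partial>\<mu>)"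
    if u: "u \<in> bounded_borel" "\<And>y. 0 \<le> u y" for u x
  proof -
    have [measurable]: "u \<in> borel_measurable borel" using u by (simp add: bounded_borel_def)
    have "(\<integral>\<^sup>+ \<omega>. (\<integral>\<^sup>+ s\<in>{0..}. ennreal (ext0 u (Y s \<omega>)) \<partial>lborel) \<partial>law Z (Some x)) =
      (\<integral>\<^sup>+ \<omega>. stieltjes (\<lambda>t. A t \<omega>) (\<lambda>t. ennreal (exp (- 0 * t) * ext0 u (coord Z (ennreal t) \<omega>))) \<partial>law Z (Some x))"
    \<comment> \<open>The potential formula at \<alpha> = 0 speaks of Stieltjes integrals along X;
      on \<Lambda> these are occupation integrals of Y.\<close>
    proof (rule nn_integral_cong_AE, rule eventually_mono[OF Lam_AE])
      fix \<omega> assume "\<omega> \<in> \<Lambda>"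
      from stieltjes_eq_occupation[OF this, of "\<lambda>z. ennreal (ext0 u z)"]
      show "(\<integral>\<^sup>+ s\<in>{0..}. ennreal (ext0 u (Y s \<omega>)) \<partial>lborel) =
        stieltjes (\<lambda>t. A t \<omega>) (\<lambda>t. ennreal (exp (- 0 * t) * ext0 u (coord Z (ennreal t) \<omega>)))" by simp
    qed
    also have "\<dots> = (\<integral>\<^sup>+ y. green p 0 x y * ennreal (u y) \<partial>\<mu>)" using formula u by blast
    finally show ?thesis .
  qed
  \<comment> \<open>Borel sets are nearly Borel and \<mu>-null sets remain null in the completion,
    so minimality in \<open>fine_support\<close> applies to B.\<close>
  have full: "B = UNIV" if B: "B \<in> sets borel" "finely_closed Z B" "- B \<in> null_sets \<mu>" for B
    using fine B nearly_borel_borel[OF B(1)] null_sets_completionI[OF B(3)]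
    unfolding fine_support_def Let_def F by blast
  interpret full_fine_support Z A \<Lambda> \<mu> "green p 0"
  proof unfold_locales
    show "sets \<mu> = sets borel" by (rule musets)
    show "open {(x, y). c < green p 0 x y}" for c using lsc by blast
    show "0 < green p 0 x y" for x y by (rule green_pos[OF dens])
    show "(\<integral>\<^sup>+ y. green p 0 x y \<partial>\<mu>) < top" for x using kato by (simp add: G_Kato_def)
    show "(\<lambda>x. enn2real (\<integral>\<^sup>+ y. green p 0 x y \<partial>\<mu>)) \<in> C0" using kato by (simp add: G_Kato_def)
  qed (fact pot full)+
  show ?thesis using tc_resolvent_feller tc_semigroup_feller by blast
qed

end
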